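(* For every full trio $\mathcal{C}$, the following are equivalent: (1) The simultaneous unboundedness problem (SUP) is decidable for $\mathcal{C}$. (2) For every parameterized WQO $\preceq$, $\preceq$-downward closures are computable for $\mathcal{C}$. (3) For every parameterized WQO $\preceq$, separability by $\preceq$-PTL is decidable for $\mathcal{C}$.
   Context: All alphabets are finite. A (finite-state) transducer over $\Sigma,\Gamma$ is a finite automaton whose edges are labeled by pairs in $(\Sigma\cup\{\varepsilon\})\times(\Gamma\cup\{\varepsilon\})$; the relation it realizes (the set of pairs read along runs from an initial to a final state) is a rational transduction $T\subseteq\Sigma^*\times\Gamma^*$, and $TL=\{v\mid \exists u\in L: (u,v)\in T\}$. A rational transduction is functional if for every $u\in\Sigma^*$ there is exactly one $v$ with $(u,v)\in T$; it is then a total function $f:\Sigma^*\to\Gamma^*$. A language class $\mathcal{C}$ (with a fixed effective representation of its members) is a full trio if it is effectively closed under rational transductions: from a representation of $L\in\mathcal{C}$ and a transducer $T$ one can compute a representation of $TL$ in $\mathcal{C}$. The subword ordering: $u\sqsubseteq v$ iff $u=u_1\cdots u_n$ and $v=v_0u_1v_1\cdots u_nv_n$ for some words $u_i,v_i$. For a quasi-order $\preceq$ on $X$ and $L\subseteq X$: $\downarrow_\preceq L=\{x\mid\exists y\in L: x\preceq y\}$, $\uparrow_\preceq L=\{x\mid \exists y\in L: y\preceq x\}$. The parameterized WQOs are the smallest class of orderings on word sets closed under: (i) for each alphabet $\Sigma$, $(\Sigma^*,\sqsubseteq)$ is parameterized; (ii) if $f:\Sigma^*\to\Gamma^*$ is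 a functional rational transduction and $(\Gamma^*,\preceq)$ is parameterized, then $(\Sigma^*,\preceq_f)$ is parameterized, where $u\preceq_f v$ iff $f(u)\preceq f(v)$; (iii) if $(\Sigma^*,\preceq_1)$ and $(\Sigma^*,\preceq_2)$ are parameterized then so is their conjunction $\preceq$ ($u\preceq v$ iff $u\preceq_1 v$ and $u\preceq_2 v$). (All are well-quasi-orderings.) For a WQO $\preceq$ on $\Sigma^*$, a $\preceq$-PTL (piecewise testable language) is a finite Boolean combination of sets $\uparrow_\preceq\{w\}$, $w\in\Sigma^*$. $\preceq$-downward closures are computable for $\mathcal{C}$ if there is an algorithm that, given $L\in\mathcal{C}$, outputs a finite automaton for $\downarrow_\preceq L$. Languages $K,L$ are separated by $R$ if $K\subseteq R$ and $L\cap R=\emptyset$; separability by $\preceq$-PTL is decidable for $\mathcal{C}$ if, given $K,L\in\mathcal{C}$, one can decide whether some $\preceq$-PTL separates them. The SUP for $\mathcal{C}$: given $L\in\mathcal{C}$ with $L\subseteq a_1^*\cdots a_n^*$ for letters $a_1,\dots,a_n$, decide whether $a_1^*\cdots a_n^*\subseteq\downarrow_\sqsubseteq L$. *)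

theory Defs
  imports Main "HOL-Library.Sublist" "HOL-Library.Nat_Bijection"
begin

text \<open>Letters are natural numbers; an alphabet is a finite set of naturals;
  words are lists. Sigma-star is lists Sigma.\<close>

datatype recf = Z | S | Id nat | Cn recf "recf list" | Pr recf recf | Mn recf

inductive eval :: "recf \<Rightarrow> nat list \<Rightarrow> nat \<Rightarrow> bool" where
  eval_Z: "eval Z xs 0"
| eval_S: "eval S (x # xs) (Suc x)"
| eval_Id: "i < length xs \<Longrightarrow> eval (Id i) xs (xs ! i)"
| eval_Cn: "length ys = length gs \<Longrightarrow> (\<forall>i < length gs. eval (gs ! i) xs (ys ! i))
     \<Longrightarrow> eval f ys z \<Longrightarrow> eval (Cn f gs) xs z"
| eval_Pr0: "eval f xs y \<Longrightarrow> eval (Pr f g) (0 # xs) y"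
| eval_PrS: "eval (Pr f g) (n # xs) y \<Longrightarrow> eval g (n # y # xs) z
     \<Longrightarrow> eval (Pr f g) (Suc n # xs) z"
| eval_Mn: "eval f (n # xs) 0 \<Longrightarrow> (\<forall>m < n. \<exists>y. eval f (m # xs) (Suc y))
     \<Longrightarrow> eval (Mn f) xs n"

definition getd :: "nat list \<Rightarrow> nat \<Rightarrow> nat" where
  "getd xs i = (if i < length xs then xs ! i else 0)"

fun dec_opt :: "nat \<Rightarrow> nat option" where
  "dec_opt 0 = None"
| "dec_opt (Suc x) = Some x"

text \<open>A transducer: initial states, final states, edges (p, a, b, q) with
  a, b in letters or epsilon (None).\<close>
datatype trans = Trans (t_init: "nat list") (t_fin: "nat list")
  (t_edges: "(nat \<times> nat option \<times> nat option \<times> nat) list")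

fun ocons :: "nat option \<Rightarrow> nat list \<Rightarrow> nat list" where
  "ocons None w = w"
| "ocons (Some a) w = a # w"

inductive trun :: "trans \<Rightarrow> nat \<Rightarrow> nat list \<Rightarrow> nat list \<Rightarrow> nat \<Rightarrow> bool" for T where
  trun_nil: "trun T p [] [] p"
| trun_step: "(p, a, b, q) \<in> set (t_edges T) \<Longrightarrow> trun T q u v r
     \<Longrightarrow> trun T p (ocons a u) (ocons b v) r"

definition trel :: "trans \<Rightarrow> (nat list \<times> nat list) set" where
  "trel T = {(u, v). \<exists>p \<in> set (t_init T). \<exists>q \<in> set (t_fin T). trun T p u v q}"

definition timage :: "trans \<Rightarrow> nat list set \<Rightarrow> nat list set" where
  "timage T L = {v. \<exists>u \<in> L. (u, v) \<in> trel T}"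

definition trans_over :: "nat set \<Rightarrow> nat set \<Rightarrow> trans \<Rightarrow> bool" where
  "trans_over \<Sigma> \<Gamma> T \<longleftrightarrow> (\<forall>(p, a, b, q) \<in> set (t_edges T). set_option a \<subseteq> \<Sigma> \<and> set_option b \<subseteq> \<Gamma>)"

definition functional_on :: "nat set \<Rightarrow> trans \<Rightarrow> bool" where
  "functional_on \<Sigma> T \<longleftrightarrow> (\<forall>u \<in> lists \<Sigma>. \<exists>!v. (u, v) \<in> trel T)"

definition tfun :: "trans \<Rightarrow> nat list \<Rightarrow> nat list" where
  "tfun T u = (THE v. (u, v) \<in> trel T)"

definition dec_edge :: "nat \<Rightarrow> nat \<times> nat option \<times> nat option \<times> nat" where
  "dec_edge e = (let l = list_decode e in
     (getd l 0, dec_opt (getd l 1), dec_opt (getd l 2), getd l 3))"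

definition dec_trans :: "nat \<Rightarrow> trans" where
  "dec_trans t = (let l = list_decode t in
     Trans (list_decode (getd l 0)) (list_decode (getd l 1)) (map dec_edge (list_decode (getd l 2))))"

datatype nfa = NFA (n_init: "nat list") (n_fin: "nat list") (n_edges: "(nat \<times> nat \<times> nat) list")

inductive nrun :: "nfa \<Rightarrow> nat \<Rightarrow> nat list \<Rightarrow> nat \<Rightarrow> bool" for A where
  nrun_nil: "nrun A p [] p"
| nrun_step: "(p, a, q) \<in> set (n_edges A) \<Longrightarrow> nrun A q u r \<Longrightarrow> nrun A p (a # u) r"

definition nlang :: "nfa \<Rightarrow> nat list set" where
  "nlang A = {u. \<exists>p \<in> set (n_init A). \<exists>q \<in> set (n_fin A). nrun A p u q}"

definition dec_nedge :: "nat \<Rightarrow> nat \<times> nat \<times> nat" where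
  "dec_nedge e = (let l = list_decode e in (getd l 0, getd l 1, getd l 2))"

definition dec_nfa :: "nat \<Rightarrow> nfa" where
  "dec_nfa n = (let l = list_decode n in
     NFA (list_decode (getd l 0)) (list_decode (getd l 1)) (map dec_nedge (list_decode (getd l 2))))"

text \<open>A language class is given by a set D of codes and a map rep assigning
  to each code the language it represents; every represented language is over
  a finite alphabet.\<close>

definition full_trio :: "nat set \<Rightarrow> (nat \<Rightarrow> nat list set) \<Rightarrow> bool" where
  "full_trio D rep \<longleftrightarrow>
     (\<forall>c \<in> D. \<exists>\<Sigma>. finite \<Sigma> \<and> rep c \<subseteq> lists \<Sigma>) \<and>
     (\<exists>p. \<forall>c \<in> D. \<forall>t. \<exists>y. eval p [prod_encode (c, t)] y \<and> y \<in> D \<and>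
                         rep y = timage (dec_trans t) (rep c))"

definition dclo :: "('w \<Rightarrow> 'w \<Rightarrow> bool) \<Rightarrow> 'w set \<Rightarrow> 'w set" where
  "dclo r L = {x. \<exists>y \<in> L. r x y}"

definition uclo :: "('w \<Rightarrow> 'w \<Rightarrow> bool) \<Rightarrow> 'w set \<Rightarrow> 'w set" where
  "uclo r L = {x. \<exists>y \<in> L. r y x}"

text \<open>Parameterized WQOs: pairs (alphabet, ordering on Sigma-star); the
  ordering is a relation that only relates words of Sigma-star.\<close>
inductive pwqo :: "nat set \<Rightarrow> (nat list \<Rightarrow> nat list \<Rightarrow> bool) \<Rightarrow> bool" where
  pwqo_subword: "finite \<Sigma> \<Longrightarrow> pwqo \<Sigma> (\<lambda>u v. u \<in> lists \<Sigma> \<and> v \<in> lists \<Sigma> \<and> subseq u v)"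
| pwqo_trans: "pwqo \<Gamma> r \<Longrightarrow> finite \<Sigma> \<Longrightarrow> trans_over \<Sigma> \<Gamma> T \<Longrightarrow> functional_on \<Sigma> T
     \<Longrightarrow> pwqo \<Sigma> (\<lambda>u v. u \<in> lists \<Sigma> \<and> v \<in> lists \<Sigma> \<and> r (tfun T u) (tfun T v))"
| pwqo_conj: "pwqo \<Sigma> r1 \<Longrightarrow> pwqo \<Sigma> r2 \<Longrightarrow> pwqo \<Sigma> (\<lambda>u v. r1 u v \<and> r2 u v)"

inductive ptl :: "nat set \<Rightarrow> (nat list \<Rightarrow> nat list \<Rightarrow> bool) \<Rightarrow> nat list set \<Rightarrow> bool"
  for \<Sigma> r where
  ptl_up: "w \<in> lists \<Sigma> \<Longrightarrow> ptl \<Sigma> r (uclo r {w})"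
| ptl_compl: "ptl \<Sigma> r R \<Longrightarrow> ptl \<Sigma> r (lists \<Sigma> - R)"
| ptl_inter: "ptl \<Sigma> r R1 \<Longrightarrow> ptl \<Sigma> r R2 \<Longrightarrow> ptl \<Sigma> r (R1 \<inter> R2)"
| ptl_union: "ptl \<Sigma> r R1 \<Longrightarrow> ptl \<Sigma> r R2 \<Longrightarrow> ptl \<Sigma> r (R1 \<union> R2)"

definition blang :: "nat list \<Rightarrow> nat list set" where
  "blang as = {w. \<exists>ks. length ks = length as \<and> w = concat (map2 replicate ks as)}"

definition SUP_decidable :: "nat set \<Rightarrow> (nat \<Rightarrow> nat list set) \<Rightarrow> bool" where
  "SUP_decidable D rep \<longleftrightarrow>
     (\<exists>p. \<forall>c \<in> D. \<forall>as. rep c \<subseteq> blang as \<longrightarrow>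
        eval p [prod_encode (c, list_encode as)]
          (if blang as \<subseteq> dclo subseq (rep c) then 1 else 0))"

definition dclo_computable ::
  "nat set \<Rightarrow> (nat \<Rightarrow> nat list set) \<Rightarrow> nat set \<Rightarrow> (nat list \<Rightarrow> nat list \<Rightarrow> bool) \<Rightarrow> bool" where
  "dclo_computable D rep \<Sigma> r \<longleftrightarrow>
     (\<exists>p. \<forall>c \<in> D. rep c \<subseteq> lists \<Sigma> \<longrightarrow>
        (\<exists>y. eval p [c] y \<and> nlang (dec_nfa y) = dclo r (rep c)))"

definition sep_decidable ::
  "nat set \<Rightarrow> (nat \<Rightarrow> nat list set) \<Rightarrow> nat set \<Rightarrow> (nat list \<Rightarrow> nat list \<Rightarrow> bool) \<Rightarrow> bool" where
  "sep_decidable D rep \<Sigma> r \<longleftrightarrow>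
     (\<exists>p. \<forall>c1 \<in> D. \<forall>c2 \<in> D. rep c1 \<subseteq> lists \<Sigma> \<longrightarrow> rep c2 \<subseteq> lists \<Sigma> \<longrightarrow>
        eval p [prod_encode (c1, c2)]
          (if \<exists>R. ptl \<Sigma> r R \<and> rep c1 \<subseteq> R \<and> rep c2 \<inter> R = {} then 1 else 0))"

end

theory Submission
  imports Defs "HOL-Library.Infinite_Set"
begin

text \<open>A parameterized WQO compares the outputs of one fixed transducer componentwise: the letters of the
  outputs are tagged, and \<open>z \<le> z'\<close> means that every projection of \<open>z\<close> to the letters of one tag is a subword
  of the corresponding projection of \<open>z'\<close>. The plain subword ordering on the tagged words is finer than this
  product ordering, so it suffices to handle ideals of words, which are products of sets \<open>A*\<close> and
  \<open>{b, \<epsilon>}\<close>; every downward closed set is a finite union of them. That an ideal \<open>P\<close> lies below a language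
  \<open>L\<close> is one instance of the SUP. Hence one can search for ideals below the transduced language that cover it,
  which gives its downward closure. For separability one searches either for finitely many ideals whose
  membership patterns separate the two languages, or for an ideal adherent to both of them.

  Conversely, write \<open>a1^k1 \<cdots> an^kn\<close> below a word of \<open>L\<close> as \<open>0^k1 1 \<cdots> 0^kn 1\<close>. Simultaneous
  unboundedness can be read off an automaton for the downward closure by pumping, and it is equivalent to
  the inseparability of the words with doubled exponents from all such words with odd exponents.\<close>

subsection \<open>Computable functions on encodable types\<close>

text \<open>All that is known about the class is its closure under transductions and the SUP oracle,
  so every decision has to be phrased as a transduction followed by an instance of the SUP. This
  includes emptiness: erase all letters and ask the SUP for the empty list of letters. Membership in
  an ideal fits in as well, since the derivatives of an ideal are its suffixes and the test is
  finite state.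

  The tagged outputs for a conjunction are shuffled arbitrarily into one word, so the representing
  transducer is not functional; what survives is that any two outputs of a word are equivalent. An
  ideal of the product ordering can be presented by several word ideals. Hence the ideal adherent to
  both languages appears as a pair \<open>P\<close>, \<open>Q\<close>: among the words whose
  projections lie in both, one language is dense for \<open>P\<close> and the other for
  \<open>Q\<close>.

  In the converse direction an algorithm belongs to one fixed ordering, while the number of letters
  of a SUP instance varies. This forces the encoding over \<open>{0, 1}\<close>, where one ordering
  serves all instances. Doubling makes the parity of a bounded exponent visible, and the odd words
  supply the nearest possible counterparts of unbounded ones.\<close>

lemma eval_Cn1: "eval g xs a \<Longrightarrow> eval f [a] z \<Longrightarrow> eval (Cn f [g]) xs z"
  by (rule eval_Cn[where ys="[a]"]) auto

lemma eval_Cn2: "eval g xs a \<Longrightarrow> eval h xs b \<Longrightarrow> eval f [a, b] z \<Longrightarrow> eval (Cn f [g, h]) xs z"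
  by (rule eval_Cn[where ys="[a, b]"]) (auto simp: less_Suc_eq nth_Cons')

lemma eval_Id0: "eval (Id 0) (x # xs) x"
  using eval_Id[of 0 "x # xs"] by simp

lemma eval_Id1: "eval (Id 1) (x # y # xs) y"
  using eval_Id[of 1 "x # y # xs"] by simp

lemma eval_Id2: "eval (Id 2) (x # y # z # xs) z"
  using eval_Id[of 2 "x # y # z # xs"] by simp

lemmas eval_basic = eval_Cn1 eval_Cn2 eval_Id0 eval_Id1 eval_Id2 eval_S

lemma eval_add: "\<exists>p. \<forall>n m. eval p [n, m] (n + m)"
proof -
  have "eval (Pr (Id 0) (Cn S [Id 1])) [n, m] (n + m)" for n m
  proof (induction n)
    case (Suc n)
    have "eval (Cn S [Id 1]) [n, n + m, m] (Suc (n + m))" by (rule eval_basic)+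
    then show ?case using eval_PrS[OF Suc] by simp
  qed (simp add: eval_Pr0 eval_Id0)
  then show ?thesis by blast
qed

lemma eval_sub: "\<exists>p. \<forall>n m. eval p [n, m] (n - m)"
proof -
  have pred: "eval (Pr Z (Id 0)) [n] (n - 1)" for n
  proof (induction n)
    case (Suc n)
    show ?case using eval_PrS[OF Suc eval_Id0] by simp
  qed (simp add: eval_Pr0 eval_Z)
  have "eval (Pr (Id 0) (Cn (Pr Z (Id 0)) [Id 1])) [m, n] (n - m)" for n m
  proof (induction m)
    case (Suc m)
    show ?case
      using eval_PrS[OF Suc eval_Cn1[OF eval_Id1 pred]] by simp
  qed (simp add: eval_Pr0 eval_Id0)
  then have "eval (Cn (Pr (Id 0) (Cn (Pr Z (Id 0)) [Id 1])) [Id 1, Id 0]) [n, m] (n - m)" for n m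
    by (intro eval_Cn2[OF eval_Id1 eval_Id0])
  then show ?thesis by blast
qed

lemma eval_triangle: "\<exists>p. \<forall>n. eval p [n] (triangle n)"
proof -
  obtain a where a: "\<And>n m. eval a [n, m] (n + m)" using eval_add by blast
  have "eval (Pr Z (Cn a [Id 1, Cn S [Id 0]])) [n] (triangle n)" for n
  proof (induction n)
    case (Suc n)
    show ?case unfolding triangle_Suc
      by (rule eval_PrS[OF Suc]) (rule eval_basic a)+
  qed (simp add: eval_Pr0 eval_Z)
  then show ?thesis by blast
qed

lemma eval_prod_encode: "\<exists>p. \<forall>n m. eval p [n, m] (prod_encode (n, m))"
proof -
  obtain a where a: "\<And>n m. eval a [n, m] (n + m)" using eval_add by blast
  obtain t where t: "\<And>n. eval t [n] (triangle n)" using eval_triangle by blast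
  have "eval (Cn a [Cn t [a], Id 0]) [n, m] (prod_encode (n, m))" for n m
    unfolding prod_encode_def prod.case by (rule eval_basic a t)+
  then show ?thesis by blast
qed

text \<open>The diagonal containing \<open>n\<close>, i.e. the sum of the two components of \<open>prod_decode n\<close>.\<close>

definition diag :: "nat \<Rightarrow> nat" where
  "diag n = rec_nat 0 (\<lambda>k d. d + (1 - (triangle (Suc d) - Suc k))) n"

text \<open>The increment in \<open>diag\<close> is 1 exactly when the argument reaches the next
  triangular number, so \<open>diag\<close> moves on precisely when the pairing enters a new
  diagonal.\<close>

lemma diag_bounds: "triangle (diag n) \<le> n \<and> n < triangle (Suc (diag n))"
proof (induction n)
  case (Suc n)
  have d: "diag (Suc n) = diag n + (1 - (triangle (Suc (diag n)) - Suc n))"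
    by (simp add: diag_def)
  show ?case
  proof (cases "triangle (Suc (diag n)) \<le> Suc n")
    case True
    then have "diag (Suc n) = Suc (diag n)" using d by simp
    then show ?thesis using True Suc by simp
  next
    case False
    then have "diag (Suc n) = diag n" using d by simp
    then show ?thesis using False Suc by simp
  qed
qed (simp add: diag_def)

lemma triangle_mono: "i \<le> j \<Longrightarrow> triangle i \<le> triangle j"
  by (induction rule: dec_induct) auto

lemma diag_prod_encode: "diag (prod_encode (a, b)) = a + b"
proof -
  let ?n = "prod_encode (a, b)"
  have n: "?n = triangle (a + b) + a" by (simp add: prod_encode_def)
  have "\<not> Suc (diag ?n) \<le> a + b"
    using triangle_mono[of "Suc (diag ?n)" "a + b"] diag_bounds[of ?n] n by linarith
  moreover have "\<not> Suc (a + b) \<le> diag ?n"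
    using triangle_mono[of "Suc (a + b)" "diag ?n"] diag_bounds[of ?n] n
    by (metis add_Suc_right leD le_add1 le_imp_less_Suc le_trans nat_add_left_cancel_less triangle_Suc)
  ultimately show ?thesis by linarith
qed

lemma eval_diag: "\<exists>p. \<forall>n. eval p [n] (diag n)"
proof -
  obtain a where a: "\<And>n m. eval a [n, m] (n + m)" using eval_add by blast
  obtain s where s: "\<And>n m. eval s [n, m] (n - m)" using eval_sub by blast
  obtain t where t: "\<And>n. eval t [n] (triangle n)" using eval_triangle by blast
  have "eval (Pr Z (Cn a [Id 1, Cn s [Cn S [Z], Cn s [Cn t [Cn S [Id 1]], Cn S [Id 0]]]])) [n] (diag n)" for n
  proof (induction n)
    case (Suc n)
    have d: "diag (Suc n) = diag n + (Suc 0 - (triangle (Suc (diag n)) - Suc n))"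
      by (simp add: diag_def)
    show ?case unfolding d
      by (rule eval_PrS[OF Suc])
        (rule eval_basic a s t eval_Z)+
  qed (simp add: eval_Pr0 eval_Z diag_def)
  then show ?thesis by blast
qed

lemma eval_prod_fst: "\<exists>p. \<forall>a b. eval p [prod_encode (a, b)] a"
proof -
  obtain s where s: "\<And>n m. eval s [n, m] (n - m)" using eval_sub by blast
  obtain t where t: "\<And>n. eval t [n] (triangle n)" using eval_triangle by blast
  obtain d where d: "\<And>n. eval d [n] (diag n)" using eval_diag by blast
  have "eval (Cn s [Id 0, Cn t [d]]) [n] (n - triangle (diag n))" for n
    by (rule eval_basic s t d)+
  moreover have "prod_encode (a, b) - triangle (diag (prod_encode (a, b))) = a" for a b
    unfolding diag_prod_encode by (simp add: prod_encode_def)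
  ultimately show ?thesis by metis
qed

lemma eval_prod_snd: "\<exists>p. \<forall>a b. eval p [prod_encode (a, b)] b"
proof -
  obtain s where s: "\<And>n m. eval s [n, m] (n - m)" using eval_sub by blast
  obtain f where f: "\<And>a b. eval f [prod_encode (a, b)] a" using eval_prod_fst by blast
  obtain d where d: "\<And>n. eval d [n] (diag n)" using eval_diag by blast
  have "eval (Cn s [d, f]) [prod_encode (a, b)] (diag (prod_encode (a, b)) - a)" for a b
    by (rule eval_basic s f d)+
  moreover have "diag (prod_encode (a, b)) - a = b" for a b
    unfolding diag_prod_encode by simp
  ultimately show ?thesis by metis
qed

text \<open>Codes are bijective: decoding is then the identity on numbers, hence computable, and an
  unbounded search over numbers runs through all values of the type.\<close>

class enc =
  fixes enc :: "'a \<Rightarrow> nat" and dec :: "nat \<Rightarrow> 'a"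
  assumes dec_enc [simp]: "dec (enc x) = x" and enc_dec [simp]: "enc (dec n) = n"

lemma enc_eq_iff [simp]: "enc x = enc y \<longleftrightarrow> x = y"
  by (metis dec_enc)

instantiation nat :: enc
begin
definition enc_nat_def [simp]: "enc (n::nat) = n"
definition dec_nat_def [simp]: "dec n = (n::nat)"
instance by standard simp_all
end

instantiation prod :: (enc, enc) enc
begin
definition enc_prod_def: "enc p = prod_encode (enc (fst p), enc (snd p))"
definition dec_prod_def: "dec n = (dec (fst (prod_decode n)), dec (snd (prod_decode n)))"
instance by standard (simp_all add: enc_prod_def dec_prod_def)
end

instantiation option :: (enc) enc
begin
definition enc_option_def: "enc x = (case x of None \<Rightarrow> 0 | Some y \<Rightarrow> Suc (enc y))"
definition dec_option_def: "dec n = (case n of 0 \<Rightarrow> None | Suc m \<Rightarrow> Some (dec m))"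
instance by standard (simp_all add: enc_option_def dec_option_def split: option.split nat.split)
end

text \<open>This agrees with \<open>list_encode\<close>, the format that \<open>dec_trans\<close>,
  \<open>dec_nfa\<close> and the SUP input expect.\<close>

instantiation list :: (enc) enc
begin
definition enc_list_def: "enc xs = list_encode (map enc xs)"
definition dec_list_def: "dec n = map dec (list_decode n)"
instance by standard (simp_all add: enc_list_def dec_list_def comp_def)
end

lemma enc_Pair [simp]: "enc (a, b) = prod_encode (enc a, enc b)"
  by (simp add: enc_prod_def)

lemma enc_Nil [simp]: "enc [] = 0"
  by (simp add: enc_list_def)

lemma enc_Cons [simp]: "enc (x # xs) = Suc (enc (x, xs))"
  by (simp add: enc_list_def)

lemma enc_nat_list: "enc (xs :: nat list) = list_encode xs"
  by (simp add: enc_list_def map_idI)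

text \<open>The procedures granted by a full trio or by the SUP are only specified on valid inputs,
  so nothing is demanded outside \<open>A\<close>, not even termination.\<close>

definition computable_on :: "'a::enc set \<Rightarrow> ('a \<Rightarrow> 'b::enc) \<Rightarrow> bool" where
  "computable_on A f \<longleftrightarrow> (\<exists>p. \<forall>x\<in>A. eval p [enc x] (enc (f x)))"

abbreviation decidable_on :: "'a::enc set \<Rightarrow> ('a \<Rightarrow> bool) \<Rightarrow> bool" where
  "decidable_on A P \<equiv> computable_on A (\<lambda>x. of_bool (P x) :: nat)"

named_theorems computable_intros

lemma cmpI: "(\<And>x. x \<in> A \<Longrightarrow> eval p [enc x] (enc (f x))) \<Longrightarrow> computable_on A f"
  by (auto simp: computable_on_def)

lemma computable_cong: "(\<And>x. x \<in> A \<Longrightarrow> f x = g x) \<Longrightarrow> computable_on A f \<longleftrightarrow> computable_on A g"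
  by (auto simp: computable_on_def)

lemma computable_comp: assumes "computable_on B f" "computable_on A g" "\<And>x. x \<in> A \<Longrightarrow> g x \<in> B"
  shows "computable_on A (\<lambda>x. f (g x))"
proof -
  obtain p where p: "\<And>x. x \<in> B \<Longrightarrow> eval p [enc x] (enc (f x))" using assms(1) unfolding computable_on_def by blast
  obtain q where q: "\<And>x. x \<in> A \<Longrightarrow> eval q [enc x] (enc (g x))" using assms(2) unfolding computable_on_def by blast
  show ?thesis
    by (rule cmpI[of _ "Cn p [q]"]) (rule eval_Cn1[OF q p]; simp add: assms(3))
qed

lemma computable_comp_UNIV: "computable_on UNIV f \<Longrightarrow> computable_on A g \<Longrightarrow> computable_on A (\<lambda>x. f (g x))"
  by (rule computable_comp) auto

lemma computable_const [computable_intros]: "computable_on A (\<lambda>_. c)"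
proof -
  have "\<exists>p. \<forall>x. eval p [x] n" for n
  proof (induction n)
    case (Suc n)
    then show ?case by (meson eval_Cn1 eval_S)
  qed (auto intro: eval_Z)
  then show ?thesis unfolding computable_on_def by blast
qed

lemma computable_id [computable_intros]: "computable_on A (\<lambda>x. x)"
  by (rule cmpI[of _ "Id 0"]) (rule eval_Id0)

lemma computable_Pair [computable_intros]: assumes "computable_on A f" "computable_on A g" shows "computable_on A (\<lambda>x. (f x, g x))"
proof -
  obtain p where p: "\<And>x. x \<in> A \<Longrightarrow> eval p [enc x] (enc (f x))" using assms(1) unfolding computable_on_def by blast
  obtain q where q: "\<And>x. x \<in> A \<Longrightarrow> eval q [enc x] (enc (g x))" using assms(2) unfolding computable_on_def by blast
  obtain r where r: "\<And>n m. eval r [n, m] (prod_encode (n, m))" using eval_prod_encode by blast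
  show ?thesis
    by (rule cmpI[of _ "Cn r [p, q]"], rule eval_Cn2[OF p q]) (simp_all add: r)
qed

lemma computable_fst_UNIV: "computable_on UNIV fst"
  using eval_prod_fst unfolding computable_on_def by (metis enc_prod_def)

lemma computable_snd_UNIV: "computable_on UNIV snd"
  using eval_prod_snd unfolding computable_on_def by (metis enc_prod_def)

lemmas computable_fst [computable_intros] = computable_comp_UNIV[OF computable_fst_UNIV]
lemmas computable_snd [computable_intros] = computable_comp_UNIV[OF computable_snd_UNIV]

lemma computable_Suc [computable_intros]: "computable_on A f \<Longrightarrow> computable_on A (\<lambda>x. Suc (f x))"
  by (rule computable_comp_UNIV[of Suc]) (rule cmpI[of _ recf.S], simp_all add: eval_S)

lemma computable_enc: "computable_on A f \<Longrightarrow> computable_on A (\<lambda>x. enc (f x))"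
  by (simp add: computable_on_def)

lemma computable_dec: "computable_on A f \<Longrightarrow> computable_on A (\<lambda>x. dec (f x))"
  by (simp add: computable_on_def)

lemma computable_of_enc: "computable_on A (\<lambda>x. enc (f x)) \<Longrightarrow> computable_on A f"
  by (simp add: computable_on_def)

lemma computable_nat2:
  assumes "\<exists>p. \<forall>n m. eval p [n, m] (F n m :: nat)" "computable_on A f" "computable_on A g"
  shows "computable_on A (\<lambda>x. F (f x) (g x))"
proof -
  obtain r where r: "\<And>n m. eval r [n, m] (F n m)" using assms(1) by blast
  obtain p where p: "\<And>x. x \<in> A \<Longrightarrow> eval p [enc x] (enc (f x))" using assms(2) unfolding computable_on_def by blast
  obtain q where q: "\<And>x. x \<in> A \<Longrightarrow> eval q [enc x] (enc (g x))" using assms(3) unfolding computable_on_def by blast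
  show ?thesis
    by (rule cmpI[of _ "Cn r [p, q]"], rule eval_Cn2[OF p q]) (simp_all add: r)
qed

lemmas computable_add [computable_intros] = computable_nat2[OF eval_add]
lemmas computable_diff [computable_intros] = computable_nat2[OF eval_sub]

text \<open>\<open>Pr\<close> hands over counter, accumulator and parameter as
  \<open>[k, y, x]\<close>; the step program repacks them into the code of \<open>(x, k, y)\<close>,
  so that programs of one argument suffice.\<close>

lemma computable_rec_nat [computable_intros]:
  assumes "computable_on A g" "computable_on (A \<times> UNIV) (\<lambda>p. h (fst p) (fst (snd p)) (snd (snd p)))" "computable_on A n"
  shows "computable_on A (\<lambda>x. rec_nat (g x) (h x) (n x))"
proof -
  obtain p where p: "\<And>x. x \<in> A \<Longrightarrow> eval p [enc x] (enc (g x))" using assms(1) unfolding computable_on_def by blast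
  obtain q where q: "\<And>x. x \<in> A \<times> UNIV \<Longrightarrow>
      eval q [enc x] (enc (h (fst x) (fst (snd x)) (snd (snd x))))"
    using assms(2) unfolding computable_on_def by blast
  obtain r where r: "\<And>x. x \<in> A \<Longrightarrow> eval r [enc x] (enc (n x))" using assms(3) unfolding computable_on_def by blast
  obtain e where e: "\<And>n m. eval e [n, m] (prod_encode (n, m))" using eval_prod_encode by blast
  let ?s = "Cn q [Cn e [Id 2, Cn e [Id 0, Id 1]]]"
  have "eval (Pr p ?s) [k, enc x] (enc (rec_nat (g x) (h x) k))" if x: "x \<in> A" for k x
  proof (induction k)
    case 0
    then show ?case using p[OF x] by (auto intro: eval_Pr0)
  next
    case (Suc k)
    show ?case
    proof (rule eval_PrS[OF Suc], rule eval_Cn1)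
      let ?y = "rec_nat (g x) (h x) k"
      show "eval (Cn e [Id 2, Cn e [Id 0, Id 1]]) [k, enc ?y, enc x] (enc (x, k, ?y))"
        unfolding enc_Pair enc_nat_def by (rule eval_basic e)+
      show "eval q [enc (x, k, ?y)] (enc (rec_nat (g x) (h x) (Suc k)))"
        using q[of "(x, k, ?y)"] x by simp
    qed
  qed
  then have "eval (Cn (Pr p ?s) [r, Id 0]) [enc x] (enc (rec_nat (g x) (h x) (n x)))" if "x \<in> A" for x
    using that by (intro eval_Cn2[OF r[OF that] eval_Id0]) simp
  then show ?thesis by (rule cmpI)
qed

lemma computable_case_nat [computable_intros]:
  assumes "computable_on A n" "computable_on A g" "computable_on (A \<times> UNIV) (\<lambda>p. h (fst p) (snd p))"
  shows "computable_on A (\<lambda>x. case n x of 0 \<Rightarrow> g x | Suc m \<Rightarrow> h x m)"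
proof -
  have "computable_on (A \<times> UNIV) (\<lambda>p. h (fst p) (fst (snd p)))"
    by (rule computable_comp[OF assms(3), of "A \<times> UNIV" "\<lambda>p. (fst p, fst (snd p))", unfolded fst_conv snd_conv])
      ((rule computable_intros computable_dec)+, auto)
  moreover have "(case m of 0 \<Rightarrow> g x | Suc m \<Rightarrow> h x m) = rec_nat (g x) (\<lambda>k y. h x k) m" for x m
    by (cases m) auto
  ultimately show ?thesis using assms by (simp, intro computable_rec_nat)
qed

lemma computable_weaken: assumes "computable_on A f" shows "computable_on (A \<times> UNIV) (\<lambda>p. f (fst p))"
  by (rule computable_comp[OF assms]) ((rule computable_fst computable_id)+, auto)

lemma computable_if [computable_intros]:
  assumes "decidable_on A P" "computable_on A f" "computable_on A g"
  shows "computable_on A (\<lambda>x. if P x then f x else g x)"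
proof -
  have "computable_on (A \<times> UNIV) (\<lambda>p. f (fst p))"
    by (rule computable_comp[OF assms(2)]) (intro computable_intros, auto)
  then have "computable_on A (\<lambda>x. case of_bool (P x) of 0 \<Rightarrow> g x | Suc (m::nat) \<Rightarrow> f x)"
    using assms by (intro computable_case_nat)
  then show ?thesis by (rule computable_cong[THEN iffD1, rotated]) auto
qed

lemma computable_case_option [computable_intros]:
  assumes "computable_on A n" "computable_on A g" "computable_on (A \<times> UNIV) (\<lambda>p. h (fst p) (snd p))"
  shows "computable_on A (\<lambda>x. case n x of None \<Rightarrow> g x | Some m \<Rightarrow> h x m)"
proof -
  have "computable_on (A \<times> UNIV) (\<lambda>p. h (fst p) (dec (snd p)))"
    by (rule computable_comp[OF assms(3), of "A \<times> UNIV" "\<lambda>p. (fst p, dec (snd p))", unfolded fst_conv snd_conv])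
      ((rule computable_intros computable_dec)+, auto)
  then have "computable_on A (\<lambda>x. case enc (n x) of 0 \<Rightarrow> g x | Suc m \<Rightarrow> h x (dec m))"
    using assms by (intro computable_case_nat computable_enc)
  then show ?thesis by (rule computable_cong[THEN iffD1, rotated]) (auto simp: enc_option_def split: option.split)
qed

lemma computable_case_list [computable_intros]:
  fixes n :: "'a::enc \<Rightarrow> 'b::enc list"
  assumes "computable_on A n" "computable_on A g" "computable_on (A \<times> UNIV) (\<lambda>p. h (fst p) (fst (snd p)) (snd (snd p)))"
  shows "computable_on A (\<lambda>x. case n x of [] \<Rightarrow> g x | y # ys \<Rightarrow> h x y ys)"
proof -
  have "computable_on (A \<times> UNIV) (\<lambda>p. h (fst p) (fst (dec (snd p) :: 'b \<times> 'b list)) (snd (dec (snd p) :: 'b \<times> 'b list)))"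
    by (rule computable_comp[OF assms(3), of "A \<times> UNIV" "\<lambda>p. (fst p, dec (snd p) :: 'b \<times> 'b list)", unfolded fst_conv snd_conv])
      ((rule computable_intros computable_dec)+, auto)
  then have "computable_on A (\<lambda>x. case enc (n x) of 0 \<Rightarrow> g x | Suc m \<Rightarrow> h x (fst (dec m :: 'b \<times> 'b list)) (snd (dec m :: 'b \<times> 'b list)))"
    using assms by (intro computable_case_nat computable_enc)
  then show ?thesis
    by (rule computable_cong[THEN iffD1, rotated]) (auto simp del: enc_Pair split: list.split)
qed

lemma computable_case_prod [computable_intros]:
  "computable_on A (\<lambda>x. f x (fst (g x)) (snd (g x))) \<Longrightarrow> computable_on A (\<lambda>x. case g x of (a, b) \<Rightarrow> f x a b)"
  by (simp add: case_prod_beta)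

lemma computable_Some [computable_intros]: "computable_on A f \<Longrightarrow> computable_on A (\<lambda>x. Some (f x))"
  by (rule computable_of_enc) (simp add: enc_option_def computable_intros computable_enc)

lemma computable_Cons [computable_intros]: assumes "computable_on A f" "computable_on A g" shows "computable_on A (\<lambda>x. f x # g x)"
proof (rule computable_of_enc)
  show "computable_on A (\<lambda>x. enc (f x # g x))"
    unfolding enc_Cons by (intro computable_Suc computable_enc computable_Pair assms)
qed

subsection \<open>Decidable predicates\<close>

lemma decidable_not [computable_intros]: assumes "decidable_on A P" shows "decidable_on A (\<lambda>x. \<not> P x)"
proof -
  have "computable_on A (\<lambda>x. 1 - of_bool (P x) :: nat)" by (intro computable_intros assms)
  then show ?thesis by (rule computable_cong[THEN iffD1, rotated]) auto
qed

lemma decidable_conj [computable_intros]: assumes "decidable_on A P" "decidable_on A Q" shows "decidable_on A (\<lambda>x. P x \<and> Q x)"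
proof -
  have "computable_on A (\<lambda>x. if P x then of_bool (Q x) else 0 :: nat)" by (intro computable_intros assms)
  then show ?thesis by (rule computable_cong[THEN iffD1, rotated]) auto
qed

lemma decidable_disj [computable_intros]: assumes "decidable_on A P" "decidable_on A Q" shows "decidable_on A (\<lambda>x. P x \<or> Q x)"
proof -
  have "computable_on A (\<lambda>x. if P x then 1 else of_bool (Q x) :: nat)" by (intro computable_intros assms)
  then show ?thesis by (rule computable_cong[THEN iffD1, rotated]) auto
qed

lemma decidable_eq [computable_intros]: assumes "computable_on A f" "computable_on A g" shows "decidable_on A (\<lambda>x. f x = g x)"
proof -
  have "computable_on A (\<lambda>x. 1 - ((enc (f x) - enc (g x)) + (enc (g x) - enc (f x))))"
    by (intro computable_intros computable_enc assms)
  moreover have "1 - ((enc y - enc z) + (enc z - enc y)) = of_bool (y = z)" for y z :: 'b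
  proof (cases "y = z")
    case False
    then have "enc y < enc z \<or> enc z < enc y" by (simp add: neq_iff[symmetric])
    then show ?thesis using False by auto
  qed simp
  ultimately show ?thesis by simp
qed

text \<open>Minimisation over codes; it meets a witness because \<open>enc\<close> is onto. The
  predicate is negated as \<open>Mn\<close> stops at the value 0.\<close>

lemma computable_search:
  fixes P :: "'a::enc \<Rightarrow> 'b::enc \<Rightarrow> bool"
  assumes ex: "\<And>x. x \<in> A \<Longrightarrow> \<exists>y. P x y" and P: "decidable_on (A \<times> UNIV) (\<lambda>p. P (fst p) (snd p))"
  shows "\<exists>f. computable_on A f \<and> (\<forall>x\<in>A. P x (f x))"
proof -
  obtain p where p: "\<And>x::'a \<times> 'b. x \<in> A \<times> UNIV \<Longrightarrow>
      eval p [enc x] (enc (of_bool (\<not> P (fst x) (snd x)) :: nat))"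
    using decidable_not[OF P] unfolding computable_on_def by blast
  obtain e where e: "\<And>n m. eval e [n, m] (prod_encode (n, m))" using eval_prod_encode by blast
  let ?q = "Cn p [Cn e [Id 1, Id 0]]"
  have q: "eval ?q [n, enc x] (of_bool (\<not> P x (dec n)))" if "x \<in> A" for x n
  proof (rule eval_Cn1)
    show "eval (Cn e [Id 1, Id 0]) [n, enc x] (enc (x, dec n :: 'b))"
      unfolding enc_Pair enc_dec by (rule eval_basic e)+
    show "eval p [enc (x, dec n :: 'b)] (of_bool (\<not> P x (dec n)))"
      using p[of "(x, dec n)"] that by simp
  qed
  define f where "f x = (LEAST n. P x (dec n))" for x
  have f: "P x (dec (f x))" if "x \<in> A" for x
    unfolding f_def by (rule LeastI_ex) (metis ex[OF that] dec_enc)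
  have "eval (Mn ?q) [enc x] (f x)" if x: "x \<in> A" for x
  proof (rule eval_Mn)
    show "eval ?q [f x, enc x] 0" using q[OF x, of "f x"] f[OF x] by simp
    show "\<forall>m<f x. \<exists>y. eval ?q [m, enc x] (Suc y)"
    proof (intro allI impI)
      fix m assume "m < f x"
      then have "\<not> P x (dec m)" unfolding f_def by (rule not_less_Least)
      then show "\<exists>y. eval ?q [m, enc x] (Suc y)" using q[OF x, of m] by auto
    qed
  qed
  then have "computable_on A (\<lambda>x. dec (f x) :: 'b)" by (intro cmpI) simp
  then show ?thesis using f by blast
qed

subsection \<open>Lists\<close>

text \<open>Provides a computable bound on the number of iterations needed to traverse a list,
  before \<open>length\<close> itself is known to be computable.\<close>

lemma length_le_enc: "length (xs :: 'a::enc list) \<le> enc xs"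
proof (induction xs)
  case (Cons x xs)
  then show ?case using le_prod_encode_2[of "enc xs" "enc x"] by (simp add: le_trans)
qed simp

lemma computable_fold [computable_intros]:
  fixes s :: "'a::enc \<Rightarrow> 'c::enc" and g :: "'a \<Rightarrow> 'b::enc list"
  assumes "computable_on A s" "computable_on A g" "computable_on (A \<times> UNIV) (\<lambda>p. f (fst p) (fst (snd p)) (snd (snd p)))"
  shows "computable_on A (\<lambda>x. fold (f x) (g x) (s x))"
proof -
  \<comment> \<open>The state holds the rest of the list and the accumulator. Once the list is used
    up, further iterations change nothing, so the generous bound \<open>enc (g x)\<close> does no
    harm.\<close>
  let ?step = "\<lambda>x st. case fst st of [] \<Rightarrow> st | y # ys \<Rightarrow> (ys, f x y (snd st))"
  have iter: "snd (rec_nat (l, a) (\<lambda>_. ?step x) n) = fold (f x) l a" if "length l \<le> n" for x l a n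
  proof -
    have "rec_nat (l, a) (\<lambda>_. ?step x) m = (drop m l, fold (f x) (take m l) a)" for m
    proof (induction m)
      case (Suc m)
      show ?case
      proof (cases "drop m l")
        case Nil
        then show ?thesis using Suc by (simp add: drop_Suc tl_drop)
      next
        case (Cons y ys)
        then have "m < length l" by (metis drop_eq_Nil list.distinct(1) not_less)
        with Cons have "take (Suc m) l = take m l @ [y]"
          by (simp add: take_Suc_conv_app_nth) (metis nth_via_drop)
        moreover from Cons have "drop (Suc m) l = ys" by (metis drop_Suc list.sel(3) tl_drop)
        ultimately show ?thesis using Suc Cons by simp
      qed
    qed simp
    then show ?thesis using that by simp
  qed
  have "computable_on ((A \<times> UNIV) \<times> UNIV :: (('a \<times> nat \<times> 'b list \<times> 'c) \<times> 'b \<times> 'b list) set) (\<lambda>p. f (fst (fst p)) (fst (snd p)) (snd (snd (snd (fst p)))))"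
    by (rule computable_comp[OF assms(3), of "(A \<times> UNIV) \<times> UNIV :: (('a \<times> nat \<times> 'b list \<times> 'c) \<times> 'b \<times> 'b list) set" "\<lambda>p. (fst (fst p), fst (snd p), snd (snd (snd (fst p))))", unfolded fst_conv snd_conv])
      ((rule computable_intros computable_dec)+, auto)
  then have "computable_on A (\<lambda>x. snd (rec_nat (g x, s x) (\<lambda>_. ?step x) (enc (g x))))"
    by (intro computable_intros computable_enc assms)
  then show ?thesis
    by (rule computable_cong[THEN iffD1, rotated]) (rule iter[OF length_le_enc])
qed

lemma computable_rev [computable_intros]: "computable_on A f \<Longrightarrow> computable_on A (\<lambda>x. rev (f x))"
  unfolding rev_conv_fold by (intro computable_intros)

lemma computable_append [computable_intros]: "computable_on A f \<Longrightarrow> computable_on A g \<Longrightarrow> computable_on A (\<lambda>x. f x @ g x)"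
proof -
  have "xs @ ys = fold Cons (rev xs) ys" for xs ys :: "'b list"
    by (simp add: fold_Cons_rev)
  then show "computable_on A f \<Longrightarrow> computable_on A g \<Longrightarrow> computable_on A (\<lambda>x. f x @ g x)"
    by (simp only:) (intro computable_intros)
qed

lemma computable_concat [computable_intros]: "computable_on A f \<Longrightarrow> computable_on A (\<lambda>x. concat (f x))"
  unfolding concat_conv_foldr foldr_conv_fold by (intro computable_intros)

lemma computable_map [computable_intros]:
  assumes "computable_on A g" "computable_on (A \<times> UNIV) (\<lambda>p. f (fst p) (snd p))"
  shows "computable_on A (\<lambda>x. map (f x) (g x))"
proof -
  have "map h xs = fold (\<lambda>y acc. h y # acc) (rev xs) []" for h :: "'b \<Rightarrow> 'c" and xs
    by (simp flip: foldr_conv_fold) (induction xs, auto)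
  moreover have "computable_on (A \<times> UNIV) (\<lambda>p. f (fst p) (fst (snd p)))"
    by (rule computable_comp[OF assms(2), of "A \<times> UNIV" "\<lambda>p. (fst p, fst (snd p))", unfolded fst_conv snd_conv])
      ((rule computable_intros)+, auto)
  ultimately show ?thesis using assms(1) by (simp only:) (intro computable_intros)
qed

lemma computable_filter [computable_intros]:
  assumes "computable_on A g" "decidable_on (A \<times> UNIV) (\<lambda>p. P (fst p) (snd p))"
  shows "computable_on A (\<lambda>x. filter (P x) (g x))"
proof -
  have "filter Q xs = concat (map (\<lambda>y. if Q y then [y] else []) xs)" for Q and xs :: "'b list"
    by (induction xs) auto
  then show ?thesis using assms by (simp only:) (intro computable_intros)
qed

lemma decidable_Bex [computable_intros]:
  assumes "computable_on A g" "decidable_on (A \<times> UNIV) (\<lambda>p. P (fst p) (snd p))"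
  shows "decidable_on A (\<lambda>x. \<exists>y\<in>set (g x). P x y)"
proof -
  have "(\<exists>y\<in>set xs. Q y) \<longleftrightarrow> \<not> filter Q xs = []" for Q and xs :: "'b list"
    by (auto simp: filter_empty_conv)
  then show ?thesis using assms by (simp only:) (intro computable_intros)
qed

lemma decidable_Ball [computable_intros]:
  assumes "computable_on A g" "decidable_on (A \<times> UNIV) (\<lambda>p. P (fst p) (snd p))"
  shows "decidable_on A (\<lambda>x. \<forall>y\<in>set (g x). P x y)"
proof -
  have "(\<forall>y\<in>set xs. Q y) \<longleftrightarrow> \<not> (\<exists>y\<in>set xs. \<not> Q y)" for Q and xs :: "'b list"
    by auto
  then show ?thesis using assms by (simp only:) (intro computable_intros)
qed

lemma decidable_mem [computable_intros]:
  assumes "computable_on A f" "computable_on A g"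
  shows "decidable_on A (\<lambda>x. f x \<in> set (g x))"
proof -
  have "computable_on (A \<times> UNIV) (\<lambda>p. f (fst p))"
    by (rule computable_weaken[OF assms(1)])
  then have "decidable_on A (\<lambda>x. \<exists>y\<in>set (g x). f x = y)"
    using assms by (intro computable_intros)
  then show ?thesis by simp
qed

lemma computable_length [computable_intros]: "computable_on A f \<Longrightarrow> computable_on A (\<lambda>x. length (f x))"
proof -
  have "fold (\<lambda>_ n. Suc n) xs k = length xs + k" for xs :: "'b list" and k
    by (induction xs arbitrary: k) auto
  then have "length xs = fold (\<lambda>_ n. Suc n) xs 0" for xs :: "'b list"
    by simp
  then show "computable_on A f \<Longrightarrow> computable_on A (\<lambda>x. length (f x))"
    by (simp only:) (intro computable_intros)
qed

lemma computable_upt [computable_intros]: "computable_on A f \<Longrightarrow> computable_on A (\<lambda>x. [0..<f x])"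
proof -
  have "[0..<n] = rec_nat [] (\<lambda>k l. l @ [k]) n" for n
    by (induction n) auto
  then show "computable_on A f \<Longrightarrow> computable_on A (\<lambda>x. [0..<f x])"
    by (simp only:) (intro computable_intros)
qed

lemma computable_drop [computable_intros]: "computable_on A n \<Longrightarrow> computable_on A f \<Longrightarrow> computable_on A (\<lambda>x. drop (n x) (f x))"
proof -
  have "drop n xs = rec_nat xs (\<lambda>_ l. case l of [] \<Rightarrow> [] | y # ys \<Rightarrow> ys) n" for n and xs :: "'b list"
    by (induction n) (auto simp: drop_Suc drop_tl split: list.split)
  then show "computable_on A n \<Longrightarrow> computable_on A f \<Longrightarrow> computable_on A (\<lambda>x. drop (n x) (f x))"
    by (simp only:) (intro computable_intros)
qed

lemma computable_replicate [computable_intros]: "computable_on A n \<Longrightarrow> computable_on A f \<Longrightarrow> computable_on A (\<lambda>x. replicate (n x) (f x))"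
proof -
  have "replicate n y = map (\<lambda>_. y) [0..<n]" for n and y :: 'b
    by (simp add: map_replicate_const)
  moreover assume n: "computable_on A n" and f: "computable_on A f"
  moreover have "computable_on (A \<times> UNIV) (\<lambda>p. f (fst p))"
    by (rule computable_weaken[OF f])
  ultimately show "computable_on A (\<lambda>x. replicate (n x) (f x))"
    by (simp only:) (intro computable_intros)
qed

lemma computable_product_lists [computable_intros]: "computable_on A f \<Longrightarrow> computable_on A (\<lambda>x. product_lists (f x))"
proof -
  have "product_lists xss = fold (\<lambda>xs r. concat (map (\<lambda>x. map (Cons x) r) xs)) (rev xss) [[]]"
    for xss :: "'b list list"
    by (simp flip: foldr_conv_fold) (induction xss, auto)
  then show "computable_on A f \<Longrightarrow> computable_on A (\<lambda>x. product_lists (f x))"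
    by (simp only:) (intro computable_intros)
qed

subsection \<open>Higman's lemma\<close>

text \<open>The form with infinite ascending subsequences is preferred to that with one good pair,
  since it composes: a second component is handled inside the subsequence chosen for the
  first.\<close>

definition wqo_subseq :: "nat list set \<Rightarrow> bool" where
  "wqo_subseq X \<longleftrightarrow> (\<forall>f. (\<forall>i. f i \<in> X) \<longrightarrow>
     (\<exists>h. strict_mono (h :: nat \<Rightarrow> nat) \<and> (\<forall>i j. i \<le> j \<longrightarrow> subseq (f (h i)) (f (h j)))))"

lemma wqo_subseqD:
  assumes "wqo_subseq X" "\<And>i. f i \<in> X"
  obtains h :: "nat \<Rightarrow> nat" where "strict_mono h" "\<And>i j. i \<le> j \<Longrightarrow> subseq (f (h i)) (f (h j))"
  using assms unfolding wqo_subseq_def by blast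

lemma wqo_subseq_mono: "wqo_subseq Y \<Longrightarrow> X \<subseteq> Y \<Longrightarrow> wqo_subseq X"
  unfolding wqo_subseq_def by (simp add: subset_iff)

lemma wqo_subseq_infinite:
  assumes "wqo_subseq X" "infinite {i. f i \<in> X}"
  shows "\<exists>h. strict_mono (h :: nat \<Rightarrow> nat) \<and> (\<forall>i j. i \<le> j \<longrightarrow> subseq (f (h i)) (f (h j)))"
proof -
  define e where "e = Infinite_Set.enumerate {i. f i \<in> X}"
  have fe: "\<And>i. f (e i) \<in> X" and e: "strict_mono e"
    using enumerate_in_set[OF assms(2)] strict_mono_enumerate[OF assms(2)] by (auto simp: e_def)
  obtain h :: "nat \<Rightarrow> nat" where "strict_mono h" "\<And>i j. i \<le> j \<Longrightarrow> subseq (f (e (h i))) (f (e (h j)))"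
    using wqo_subseqD[OF assms(1), of "\<lambda>i. f (e i)"] fe by blast
  with e show ?thesis
    by (intro exI[of _ "e \<circ> h"]) (auto simp: strict_mono_def)
qed

lemma wqo_subseq_Un: assumes "wqo_subseq X" "wqo_subseq Y" shows "wqo_subseq (X \<union> Y)"
  unfolding wqo_subseq_def
proof (intro allI impI)
  fix f :: "nat \<Rightarrow> nat list" assume "\<forall>i. f i \<in> X \<union> Y"
  then have "{i. f i \<in> X} \<union> {i. f i \<in> Y} = UNIV" by auto
  then have "infinite {i. f i \<in> X} \<or> infinite {i. f i \<in> Y}"
    by (metis finite_Un infinite_UNIV_nat)
  then show "\<exists>h. strict_mono (h :: nat \<Rightarrow> nat) \<and> (\<forall>i j. i \<le> j \<longrightarrow> subseq (f (h i)) (f (h j)))"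
    using assms wqo_subseq_infinite by blast
qed

lemma wqo_subseq_concat:
  assumes X: "wqo_subseq X" and Y: "wqo_subseq Y"
  shows "wqo_subseq {u @ a # v |u v. u \<in> X \<and> v \<in> Y}"
  unfolding wqo_subseq_def
proof (intro allI impI)
  fix f :: "nat \<Rightarrow> nat list" assume "\<forall>i. f i \<in> {u @ a # v |u v. u \<in> X \<and> v \<in> Y}"
  then have "\<forall>i. \<exists>u v. f i = u @ a # v \<and> u \<in> X \<and> v \<in> Y" by blast
  then obtain u v where f: "\<And>i. f i = u i @ a # v i" "\<And>i. u i \<in> X" "\<And>i. v i \<in> Y" by metis
  obtain h :: "nat \<Rightarrow> nat" where h: "strict_mono h" "\<And>i j. i \<le> j \<Longrightarrow> subseq (u (h i)) (u (h j))"
    using wqo_subseqD[OF X, of u] f by blast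
  obtain k :: "nat \<Rightarrow> nat" where k: "strict_mono k"
    "\<And>i j. i \<le> j \<Longrightarrow> subseq (v (h (k i))) (v (h (k j)))"
    using wqo_subseqD[OF Y, of "\<lambda>i. v (h i)"] f by metis
  have "subseq (f (h (k i))) (f (h (k j)))" if "i \<le> j" for i j
    unfolding f using that h(2)[of "k i" "k j"] k
    by (intro list_emb_append_mono) (auto simp: strict_mono_less_eq)
  with h k show "\<exists>h. strict_mono (h :: nat \<Rightarrow> nat) \<and> (\<forall>i j. i \<le> j \<longrightarrow> subseq (f (h i)) (f (h j)))"
    by (intro exI[of _ "h \<circ> k"]) (auto simp: strict_mono_def)
qed

text \<open>A word that avoids \<open>a # w\<close> either lacks \<open>a\<close>, or is cut at its
  first \<open>a\<close> into a part without \<open>a\<close> and a part that avoids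
  \<open>w\<close>. Smaller alphabets and shorter patterns therefore suffice.\<close>

lemma wqo_subseq_avoid:
  assumes "\<And>a. a \<in> \<Sigma> \<Longrightarrow> wqo_subseq (lists (\<Sigma> - {a}))" "w \<in> lists \<Sigma>"
  shows "wqo_subseq {x \<in> lists \<Sigma>. \<not> subseq w x}"
  using assms(2)
proof (induction w rule: list.induct)
  case Nil
  then show ?case by (simp add: wqo_subseq_def)
next
  case (Cons a w)
  have "{x \<in> lists \<Sigma>. \<not> subseq (a # w) x} \<subseteq>
      {u @ a # v |u v. u \<in> lists (\<Sigma> - {a}) \<and> v \<in> {x \<in> lists \<Sigma>. \<not> subseq w x}} \<union> lists (\<Sigma> - {a})"
  proof (rule subsetI, rule UnCI, unfold mem_Collect_eq)
    fix x assume "x \<in> lists \<Sigma> \<and> \<not> subseq (a # w) x" and nx: "x \<notin> lists (\<Sigma> - {a})"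
    then have x: "x \<in> lists \<Sigma>" "\<not> subseq (a # w) x" by auto
    then have "a \<in> set x" using nx by auto
    then obtain u v where uv: "x = u @ a # v" "a \<notin> set u" by (meson split_list_first)
    then have "\<not> subseq w v" using x(2) subseq_drop_many by blast
    then show "\<exists>u v. x = u @ a # v \<and> u \<in> lists (\<Sigma> - {a}) \<and> (v \<in> lists \<Sigma> \<and> \<not> subseq w v)"
      using uv x(1) by (intro exI[of _ u] exI[of _ v]) auto
  qed
  moreover have "a \<in> \<Sigma>" "w \<in> lists \<Sigma>" using Cons.prems by auto
  ultimately show ?case
    by (intro wqo_subseq_mono[OF wqo_subseq_Un[OF wqo_subseq_concat[OF assms(1) Cons.IH] assms(1)]])
qed

text \<open>If some \<open>f i\<close> fails to embed into infinitely many members, these avoid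
  \<open>f i\<close> and \<open>wqo_subseq_avoid\<close> applies. Otherwise every member embeds into
  a later one, and iterating this choice gives the chain.\<close>

theorem higman: "finite \<Sigma> \<Longrightarrow> wqo_subseq (lists \<Sigma>)"
proof (induction "card \<Sigma>" arbitrary: \<Sigma>)
  case 0
  then show ?case by (auto simp: wqo_subseq_def strict_mono_def intro: exI[of _ "\<lambda>i. i"])
next
  case (Suc n)
  have IH: "wqo_subseq (lists (\<Sigma> - {a}))" if "a \<in> \<Sigma>" for a
    using Suc that by simp
  show ?case unfolding wqo_subseq_def
  proof (intro allI impI)
    fix f :: "nat \<Rightarrow> nat list" assume f: "\<forall>i. f i \<in> lists \<Sigma>"
    show "\<exists>h. strict_mono (h :: nat \<Rightarrow> nat) \<and> (\<forall>i j. i \<le> j \<longrightarrow> subseq (f (h i)) (f (h j)))"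
    proof (cases "\<exists>i. infinite {j. \<not> subseq (f i) (f j)}")
      case True
      then obtain i where "infinite {j. f j \<in> {x \<in> lists \<Sigma>. \<not> subseq (f i) x}}"
        using f by auto
      then show ?thesis
        using wqo_subseq_infinite wqo_subseq_avoid[OF IH] f by blast
    next
      case False
      have "\<exists>j>i. subseq (f i) (f j)" for i
      proof -
        have "finite ({j. \<not> subseq (f i) (f j)} \<union> {..i})" using False by auto
        then obtain j where "j \<notin> {j. \<not> subseq (f i) (f j)} \<union> {..i}"
          using ex_new_if_finite[OF infinite_UNIV_nat] by blast
        then show ?thesis by (intro exI[of _ j]) auto
      qed
      then obtain g where g: "\<And>i. g i > i" "\<And>i. subseq (f i) (f (g i))" by metis
      let ?h = "\<lambda>n. (g ^^ n) 0"
      have "strict_mono ?h" by (rule strict_mono_Suc_iff[THEN iffD2]) (simp add: g)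
      moreover have "subseq (f (?h i)) (f (?h j))" if "i \<le> j" for i j
        using that by (induction rule: dec_induct) (use g in \<open>auto intro: subseq_order.trans\<close>)
      ultimately show ?thesis by blast
    qed
  qed
qed

subsection \<open>Ideals of words\<close>

text \<open>The list \<open>[(D1, b1), \<dots>, (Dm, bm)]\<close> stands for the ideal \<open>D1* {b1, \<epsilon>} \<cdots> Dm* {bm, \<epsilon>}\<close>.
  A trailing \<open>D*\<close> is written as \<open>(D, b)\<close> with \<open>b \<in> D\<close>.\<close>

type_synonym ideal = "(nat list \<times> nat) list"

text \<open>The left quotient of the ideal by a letter. The leftmost component able to read
  \<open>a\<close> is optimal, because shorter suffixes of the list denote smaller ideals.\<close>

primrec der :: "ideal \<Rightarrow> nat \<Rightarrow> ideal option" where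
  "der [] a = None"
| "der (e # P) a = (if a \<in> set (fst e) then Some (e # P) else if a = snd e then Some P else der P a)"

fun imem :: "ideal \<Rightarrow> nat list \<Rightarrow> bool" where
  "imem P [] \<longleftrightarrow> True"
| "imem P (a # x) \<longleftrightarrow> (case der P a of None \<Rightarrow> False | Some Q \<Rightarrow> imem Q x)"

text \<open>An ascending chain that is cofinal in the ideal: it stays inside by
  \<open>imem_expn\<close>, and every member is reached by \<open>imem_subseq_expn\<close>. It
  reduces inclusion of an ideal in a downward closure to countably many words.\<close>

primrec expn :: "ideal \<Rightarrow> nat \<Rightarrow> nat list" where
  "expn [] n = []"
| "expn (e # P) n = concat (replicate n (fst e)) @ snd e # expn P n"

lemma der_suffix: "der P a = Some Q \<Longrightarrow> suffix Q P"
  by (induction P) (auto split: if_splits intro: suffix_ConsI)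

lemma suffix_der: "suffix Q P \<Longrightarrow> der Q a = Some Q' \<Longrightarrow> \<exists>P'. der P a = Some P' \<and> suffix Q' P'"
proof (induction P)
  case (Cons e P)
  show ?case
  proof (cases "Q = e # P")
    case False
    then have QP: "suffix Q P" using Cons.prems by (simp add: suffix_Cons)
    then have "suffix Q' P" using der_suffix[OF Cons.prems(2)] suffix_order.trans by blast
    then show ?thesis using Cons.IH[OF QP Cons.prems(2)] by (auto intro: suffix_ConsI)
  qed (use Cons.prems in auto)
qed auto

lemma imem_suffix: "imem Q x \<Longrightarrow> suffix Q P \<Longrightarrow> imem P x"
proof (induction x arbitrary: P Q)
  case (Cons a x)
  then obtain Q' where Q': "der Q a = Some Q'" "imem Q' x" by (auto split: option.splits)
  with suffix_der[OF Cons.prems(2) Q'(1)] Cons.IH[OF Q'(2)] show ?case by auto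
qed simp

lemma imem_subseq: "imem P x \<Longrightarrow> subseq y x \<Longrightarrow> imem P y"
proof (induction x arbitrary: P y)
  case (Cons a x)
  then obtain Q where Q: "der P a = Some Q" "imem Q x" by (auto split: option.splits)
  show ?case
  proof (cases "subseq y x")
    case True
    then show ?thesis using Cons.IH Q der_suffix imem_suffix by blast
  next
    case False
    then obtain y' where "y = a # y'" "subseq y' x"
      using Cons.prems(2) by (cases y) (auto split: if_splits)
    then show ?thesis using Q Cons.IH by simp
  qed
qed (auto dest: list_emb_Nil2)

lemma imem_block: "u \<in> lists (set (fst e)) \<Longrightarrow> imem (e # P) (u @ v) \<longleftrightarrow> imem (e # P) v"
  by (induction u) auto

lemma imem_Cons_iff:
  "imem (e # P) x \<longleftrightarrow> (\<exists>u v. x = u @ v \<and> u \<in> lists (set (fst e)) \<and>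
     (imem P v \<or> (\<exists>v'. v = snd e # v' \<and> imem P v')))" (is "_ \<longleftrightarrow> ?R x")
proof
  show "imem (e # P) x \<Longrightarrow> ?R x"
  proof (induction x)
    case (Cons a x)
    show ?case
    proof (cases "a \<in> set (fst e)")
      case True
      then have "?R x" using Cons by simp
      then obtain u v where "x = u @ v" "u \<in> lists (set (fst e))"
        "imem P v \<or> (\<exists>v'. v = snd e # v' \<and> imem P v')" by blast
      then show ?thesis using True by (intro exI[of _ "a # u"] exI[of _ v]) auto
    next
      case False
      then show ?thesis using Cons.prems by (intro exI[of _ "[]"] exI[of _ "a # x"]) (auto split: if_splits)
    qed
  qed auto
next
  assume "?R x"
  then obtain u v where x: "x = u @ v" "u \<in> lists (set (fst e))"
    and v: "imem P v \<or> (\<exists>v'. v = snd e # v' \<and> imem P v')" by blast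
  have P: "imem (e # P) y" if "imem P y" for y
    using that by (rule imem_suffix) (simp add: suffix_ConsI)
  from v have "imem (e # P) v" using P by auto
  then show "imem (e # P) x" using x imem_block by blast
qed

lemma imem_expn: "imem P (expn P n)"
proof (induction P)
  case (Cons e P)
  have "concat (replicate n (fst e)) \<in> lists (set (fst e))" by auto
  with Cons show ?case by (auto simp: imem_Cons_iff)
qed simp

lemma expn_mono: "n \<le> m \<Longrightarrow> subseq (expn P n) (expn P m)"
proof (induction P)
  case (Cons e P)
  have "replicate m (fst e) = replicate n (fst e) @ replicate (m - n) (fst e)"
    using Cons.prems by (simp flip: replicate_add)
  then have "subseq (concat (replicate n (fst e))) (concat (replicate m (fst e)))" by auto
  then show ?case using Cons by (simp add: list_emb_append_mono)
qed simp

text \<open>One more round of every loop makes room for one more leading letter, whether it is read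
  by a loop or by an optional letter.\<close>

lemma subseq_expn_der: "der P a = Some Q \<Longrightarrow> subseq (a # expn Q n) (expn P (Suc n))"
proof (induction P)
  case (Cons e P)
  consider "a \<in> set (fst e)" "Q = e # P" | "a = snd e" "Q = P" | "der P a = Some Q"
    using Cons.prems by (cases "a \<in> set (fst e)"; cases "a = snd e") simp_all
  then show ?case
  proof cases
    case 1
    have "subseq ([a] @ concat (replicate n (fst e)) @ snd e # expn P n)
        (fst e @ concat (replicate n (fst e)) @ snd e # expn P (Suc n))"
      using 1 expn_mono[of n "Suc n" P]
      by (intro list_emb_append_mono[of _ "[a]"]) (simp_all add: subseq_singleton_left subseq_append')
    then show ?thesis using 1 by simp
  next
    case 2
    then have "subseq (a # expn Q n) (concat (replicate (Suc n) (fst e)) @ snd e # expn P (Suc n))"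
      using expn_mono[of n "Suc n" P] by (intro subseq_drop_many) simp
    then show ?thesis by (simp del: replicate.simps)
  next
    case 3
    then have "subseq (a # expn Q n) ((concat (replicate (Suc n) (fst e)) @ [snd e]) @ expn P (Suc n))"
      by (intro subseq_drop_many Cons.IH)
    then show ?thesis by (simp del: replicate.simps)
  qed
qed simp

lemma imem_subseq_expn: "imem P x \<Longrightarrow> subseq x (expn P (length x))"
proof (induction x arbitrary: P)
  case (Cons a x)
  then obtain Q where Q: "der P a = Some Q" "imem Q x" by (auto split: option.splits)
  have "subseq (a # x) (a # expn Q (length x))" using Cons.IH[OF Q(2)] by simp
  from subseq_order.trans[OF this subseq_expn_der[OF Q(1)]] show ?case by simp
qed simp

definition downset :: "nat list set \<Rightarrow> bool" where
  "downset X \<longleftrightarrow> (\<forall>x\<in>X. \<forall>y. subseq y x \<longrightarrow> y \<in> X)"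

text \<open>In a strictly descending chain pick a word that is lost at each step. By Higman's lemma
  an earlier lost word embeds into a later one, whose downset lies in those that had already lost
  the earlier word.\<close>

lemma wf_downsets:
  assumes "finite \<Sigma>"
  shows "wf {(Y, X). Y \<subset> X \<and> X \<subseteq> lists \<Sigma> \<and> downset Y \<and> downset X}" (is "wf ?R")
  unfolding wf_iff_no_infinite_down_chain
proof
  assume "\<exists>f. \<forall>i. (f (Suc i), f i) \<in> ?R"
  then obtain f where "\<forall>i. (f (Suc i), f i) \<in> ?R" by (elim exE)
  then have f: "f (Suc i) \<subset> f i" "f i \<subseteq> lists \<Sigma>" "downset (f i)" for i by simp_all
  have "\<exists>x. x \<in> f i \<and> x \<notin> f (Suc i)" for i using f(1)[of i] by blast
  then obtain x where x: "\<And>i. x i \<in> f i" "\<And>i. x i \<notin> f (Suc i)" by metis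
  have anti: "f j \<subseteq> f i" if "i \<le> j" for i j
    using that
  proof (induction rule: dec_induct)
    case (step j)
    then show ?case using f(1)[of j] by simp
  qed simp
  obtain h :: "nat \<Rightarrow> nat" where h: "strict_mono h" "\<And>i j. i \<le> j \<Longrightarrow> subseq (x (h i)) (x (h j))"
    using wqo_subseqD[OF higman[OF assms], of x] x(1) f(2) by (metis subsetD)
  have "Suc (h 0) \<le> h 1" using h(1) by (simp add: Suc_leI strict_mono_less)
  then have "x (h 1) \<in> f (Suc (h 0))" using anti x by blast
  then have "x (h 0) \<in> f (Suc (h 0))" using h(2)[of 0 1] f(3) unfolding downset_def by auto
  then show False using x by blast
qed

text \<open>With \<open>A\<close> the letters \<open>a\<close> satisfying \<open>a X \<subseteq> X\<close>, every nonempty downset \<open>X\<close> equals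
  \<open>A* \<union> (\<Union>b\<in>\<Sigma> - A. A* {b, \<epsilon>} (b\<^sup>-\<^sup>1 X))\<close>, where \<open>b\<^sup>-\<^sup>1 X\<close> is a proper subset of \<open>X\<close>.\<close>

theorem downset_ideals:
  assumes fin: "finite \<Sigma>" and "X \<subseteq> lists \<Sigma>" "downset X"
  shows "\<exists>Ps. X = {x. \<exists>P\<in>set Ps. imem P x}"
  using wf_downsets[OF fin] assms(2,3)
proof (induction X rule: wf_induct_rule)
  case (less X)
  show ?case
  proof (cases "X = {}")
    case True
    then show ?thesis by (intro exI[of _ "[]"]) auto
  next
    case False
    define A where "A = {a \<in> \<Sigma>. \<forall>x\<in>X. a # x \<in> X}"
    have "finite A" using fin by (simp add: A_def)
    then obtain As where As: "set As = A" using finite_list by blast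
    obtain Bs where Bs: "set Bs = \<Sigma> - A" using fin finite_list by (metis finite_Diff)
    define d where "d b = {y. b # y \<in> X}" for b
    have dX: "d b \<subseteq> X" for b
      using less.prems(2) by (auto simp: d_def downset_def)
    have "\<exists>Ps. d b = {x. \<exists>P\<in>set Ps. imem P x}" if "b \<in> set Bs" for b
    proof -
      have "d b \<noteq> X" using that Bs by (auto simp: A_def d_def)
      moreover have "downset (d b)"
        using less.prems(2) unfolding downset_def d_def by (metis mem_Collect_eq subseq_Cons2)
      ultimately show ?thesis
        using less dX[of b] by (intro less.IH) auto
    qed
    then have "\<forall>b\<in>set Bs. \<exists>Ps. d b = {x. \<exists>P\<in>set Ps. imem P x}" by simp
    from bchoice[OF this] obtain F where F: "\<And>b. b \<in> set Bs \<Longrightarrow> d b = {x. \<exists>P\<in>set (F b). imem P x}"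
      by blast
    define star where "star = (if As = [] then [] else [(As, hd As)])"
    have star: "imem star x \<longleftrightarrow> x \<in> lists A" for x
    proof (cases "As = []")
      case True
      then show ?thesis using As by (cases x) (auto simp: star_def)
    next
      case False
      then have "hd As \<in> A" using As by auto
      moreover have "imem [] v \<longleftrightarrow> v = []" for v by (cases v) auto
      ultimately show ?thesis using False As
        by (auto simp: star_def imem_Cons_iff[of "(As, hd As)" "[]"] intro: exI[of _ "[]"])
    qed
    define Ps where "Ps = star # concat (map (\<lambda>b. map (\<lambda>P. (As, b) # P) (F b)) Bs)"
    have AX: "u @ v \<in> X" if "u \<in> lists A" "v \<in> X" for u v
      using that by (induction u) (auto simp: A_def)
    have "x \<in> X \<longleftrightarrow> (\<exists>P\<in>set Ps. imem P x)" for x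
    proof
      assume x: "x \<in> X"
      let ?u = "takeWhile (\<lambda>a. a \<in> A) x" and ?v = "dropWhile (\<lambda>a. a \<in> A) x"
      have u: "?u \<in> lists A" by (auto dest: set_takeWhileD)
      show "\<exists>P\<in>set Ps. imem P x"
      proof (cases ?v)
        case Nil
        then have "x \<in> lists A" using u by (metis append_Nil2 takeWhile_dropWhile_id)
        then show ?thesis by (simp add: Ps_def star)
      next
        case (Cons b v')
        have "b \<notin> A" using Cons by (metis dropWhile_eq_Cons_conv)
        moreover have "b \<in> set x" using Cons by (metis list.set_intros(1) set_dropWhileD)
        then have "b \<in> \<Sigma>" using x less.prems by auto
        ultimately have b: "b \<in> set Bs" using Bs by simp
        have "subseq ?v x" by (metis subseq_order.refl subseq_drop_many takeWhile_dropWhile_id)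
        then have "v' \<in> d b" using x less.prems(2) Cons by (auto simp: d_def downset_def)
        then obtain P where P: "P \<in> set (F b)" "imem P v'" using F[OF b] by blast
        have "x = ?u @ b # v'" using Cons by (metis takeWhile_dropWhile_id)
        then have "imem ((As, b) # P) x"
          using u P As by (subst imem_Cons_iff) (intro exI[of _ ?u] exI[of _ "b # v'"], simp)
        then show ?thesis using b P by (auto simp: Ps_def)
      qed
    next
      assume "\<exists>P\<in>set Ps. imem P x"
      then consider "imem star x" | b P where "b \<in> set Bs" "P \<in> set (F b)" "imem ((As, b) # P) x"
        by (auto simp: Ps_def)
      then show "x \<in> X"
      proof cases
        case 1
        obtain y where "y \<in> X" using False by blast
        then have "[] \<in> X" using less.prems(2) by (auto simp: downset_def)
        then show ?thesis using AX[of x "[]"] 1 star by simp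
      next
        case 2
        then obtain u v where uv: "x = u @ v" "u \<in> lists A" "imem P v \<or> (\<exists>v'. v = b # v' \<and> imem P v')"
          using As by (auto simp: imem_Cons_iff[of "(As, b)"])
        have "y \<in> d b" if "imem P y" for y using that 2 F by blast
        then have "v \<in> X" using uv(3) dX by (auto simp: d_def)
        then show ?thesis using AX uv by blast
      qed
    qed
    then show ?thesis by blast
  qed
qed

text \<open>The downward closure of the chain is a finite union of ideals. One of them contains
  infinitely many members of the chain, hence everything below the chain.\<close>

lemma chain_ideal:
  assumes fin: "finite \<Sigma>" and f: "\<And>i. f i \<in> lists \<Sigma>" and inc: "\<And>i j. i \<le> j \<Longrightarrow> subseq (f i) (f j)"
  shows "\<exists>P. \<forall>x. imem P x \<longleftrightarrow> (\<exists>i::nat. subseq x (f i))"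
proof -
  let ?X = "{x. \<exists>i. subseq x (f i)}"
  have "?X \<subseteq> lists \<Sigma>"
  proof
    fix x assume "x \<in> ?X"
    then obtain i where "subseq x (f i)" by blast
    then have "set x \<subseteq> set (f i)" by (auto dest: subseq_order.trans simp flip: subseq_singleton_left)
    then show "x \<in> lists \<Sigma>" using f[of i] by auto
  qed
  moreover have "downset ?X" unfolding downset_def by (auto intro: subseq_order.trans)
  ultimately obtain Ps where Ps: "?X = {x. \<exists>P\<in>set Ps. imem P x}"
    using downset_ideals[OF fin] by blast
  then have "\<forall>i. \<exists>P\<in>set Ps. imem P (f i)" by blast
  then have "(\<Union>P\<in>set Ps. {i. imem P (f i)}) = UNIV" by blast
  then obtain P where P: "P \<in> set Ps" "infinite {i. imem P (f i)}"
    by (metis (no_types, lifting) finite_UN finite_set infinite_UNIV_nat)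
  have "imem P x \<longleftrightarrow> (\<exists>i. subseq x (f i))" for x
  proof
    assume "\<exists>i. subseq x (f i)"
    then obtain i where i: "subseq x (f i)" by blast
    obtain j where "j > i" "imem P (f j)" using P(2) by (auto simp: infinite_nat_iff_unbounded)
    moreover have "subseq x (f j)" by (rule subseq_order.trans[OF i inc]) (use \<open>j > i\<close> in simp)
    ultimately show "imem P x" using imem_subseq by blast
  qed (use P Ps in blast)
  then show ?thesis by blast
qed

subsection \<open>Transducers with word labels\<close>

text \<open>Arbitrary state types and word labels let later constructions use structured states
  directly; \<open>wcode\<close> translates all of them into the numeric letter transducers of the
  class.\<close>

type_synonym 'q wedge = "'q \<times> nat list \<times> nat list \<times> 'q"
type_synonym 'q wtrans = "'q list \<times> 'q list \<times> 'q wedge list"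

inductive wrun :: "'q wedge set \<Rightarrow> 'q \<Rightarrow> nat list \<Rightarrow> nat list \<Rightarrow> 'q \<Rightarrow> bool" for E where
  wrun_nil: "wrun E p [] [] p"
| wrun_step: "(p, u, v, q) \<in> E \<Longrightarrow> wrun E q u' v' r \<Longrightarrow> wrun E p (u @ u') (v @ v') r"

definition wrel :: "'q wtrans \<Rightarrow> (nat list \<times> nat list) set" where
  "wrel W = {(u, v). \<exists>p\<in>set (fst W). \<exists>q\<in>set (fst (snd W)). wrun (set (snd (snd W))) p u v q}"

text \<open>A state \<open>(q, u, v)\<close> of the letter transducer has still to read \<open>u\<close> and to write \<open>v\<close>
  before it is in the state \<open>q\<close>.\<close>

definition split_edge :: "'q wedge \<Rightarrow> (('q \<times> nat list \<times> nat list) \<times> nat option \<times> nat option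
    \<times> 'q \<times> nat list \<times> nat list) list" where
  "split_edge e = (case e of (p, u, v, q) \<Rightarrow>
     ((p, [], []), None, None, q, u, v)
     # concat (map (\<lambda>i. case drop i u of [] \<Rightarrow> [] | a # u' \<Rightarrow>
         [((q, a # u', v), Some a, None, q, u', v)]) [0..<length u])
     @ concat (map (\<lambda>i. case drop i v of [] \<Rightarrow> [] | b # v' \<Rightarrow>
         [((q, [], b # v'), None, Some b, q, [], v')]) [0..<length v]))"

definition code_edge :: "('q::enc \<times> nat option \<times> nat option \<times> 'q) \<Rightarrow> nat" where
  "code_edge e = (case e of (s, a, b, t) \<Rightarrow> enc [enc s, enc a, enc b, enc t])"

definition wcode :: "'q::enc wtrans \<Rightarrow> nat" where
  "wcode W = enc [enc (map (\<lambda>p. enc (p, [] :: nat list, [] :: nat list)) (fst W)),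
     enc (map (\<lambda>p. enc (p, [] :: nat list, [] :: nat list)) (fst (snd W))),
     enc (map code_edge (concat (map split_edge (snd (snd W)))))]"

lemma computable_split_edge: "computable_on UNIV (split_edge :: 'q::enc wedge \<Rightarrow> _)"
  unfolding split_edge_def by (intro computable_intros)

lemma computable_code_edge: "computable_on UNIV (code_edge :: _ \<times> _ \<times> _ \<times> 'q::enc \<Rightarrow> _)"
  unfolding code_edge_def by (intro computable_intros computable_enc)

lemma computable_wcode: "computable_on UNIV (wcode :: 'q::enc wtrans \<Rightarrow> _)"
  unfolding wcode_def
  by (intro computable_intros computable_enc computable_comp_UNIV[OF computable_split_edge] computable_comp_UNIV[OF computable_code_edge])

lemma dec_opt_enc [simp]: "dec_opt (enc (x :: nat option)) = x"
  by (cases x) (simp_all add: enc_option_def)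

lemma drop_in_suffix: "(\<exists>i<length u. drop i u = a # u') \<longleftrightarrow> suffix (a # u') u"
proof
  assume "suffix (a # u') u"
  then obtain w where "u = w @ a # u'" by (auto simp: suffix_def)
  then show "\<exists>i<length u. drop i u = a # u'" by (intro exI[of _ "length w"]) simp
qed (metis suffix_drop)

lemma set_concat_drop:
  "x \<in> set (concat (map (\<lambda>i. case drop i u of [] \<Rightarrow> [] | a # u' \<Rightarrow> [F a u']) [0..<length u])) \<longleftrightarrow>
     (\<exists>a u'. suffix (a # u') u \<and> x = F a u')" (is "?l \<longleftrightarrow> ?r")
proof -
  have "x \<in> set (concat (map G [0..<n])) \<longleftrightarrow> (\<exists>i<n. x \<in> set (G i))" for G and n :: nat
    by auto
  then have "?l \<longleftrightarrow> (\<exists>i<length u. x \<in> set (case drop i u of [] \<Rightarrow> [] | a # u' \<Rightarrow> [F a u']))" .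
  also have "\<dots> \<longleftrightarrow> (\<exists>i<length u. \<exists>a u'. drop i u = a # u' \<and> x = F a u')"
  proof (intro ex_cong1 conj_cong refl)
    fix i show "x \<in> set (case drop i u of [] \<Rightarrow> [] | a # u' \<Rightarrow> [F a u']) \<longleftrightarrow>
        (\<exists>a u'. drop i u = a # u' \<and> x = F a u')" by (cases "drop i u") simp_all
  qed
  also have "\<dots> \<longleftrightarrow> ?r" unfolding drop_in_suffix[symmetric] by blast
  finally show ?thesis .
qed

lemma set_split_edge:
  "x \<in> set (split_edge (p, u, v, q)) \<longleftrightarrow> x = ((p, [], []), None, None, q, u, v) \<or>
     (\<exists>a u'. suffix (a # u') u \<and> x = ((q, a # u', v), Some a, None, q, u', v)) \<or>
     (\<exists>b v'. suffix (b # v') v \<and> x = ((q, [], b # v'), None, Some b, q, [], v'))"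
  unfolding split_edge_def prod.case list.set insert_iff set_append Un_iff set_concat_drop ..

lemma dec_trans_wcode:
  "t_init (dec_trans (wcode W)) = map (\<lambda>p. enc (p, [] :: nat list, [] :: nat list)) (fst W)"
  "t_fin (dec_trans (wcode W)) = map (\<lambda>p. enc (p, [] :: nat list, [] :: nat list)) (fst (snd W))"
  "t_edges (dec_trans (wcode W)) =
     map (\<lambda>(s, a, b, t). (enc s, a, b, enc t)) (concat (map split_edge (snd (snd W))))"
  by (auto simp: dec_trans_def wcode_def code_edge_def dec_edge_def getd_def enc_nat_list
      simp del: enc_Cons enc_Nil enc_Pair)

lemma wcode_edges:
  "(x, a, b, y) \<in> set (t_edges (dec_trans (wcode W))) \<longleftrightarrow>
     (\<exists>e\<in>set (snd (snd W)). \<exists>s t. (s, a, b, t) \<in> set (split_edge e) \<and> x = enc s \<and> y = enc t)"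
  unfolding dec_trans_wcode by (force simp del: enc_Pair)

text \<open>For the induction the run may start in the middle of an edge, with \<open>u0\<close>
  still to be read and \<open>v0\<close> still to be written.\<close>

lemma trun_wcode_imp:
  assumes "trun (dec_trans (wcode W)) x u v y"
  shows "x = enc (q, u0, v0) \<Longrightarrow> y = enc (r, [] :: nat list, [] :: nat list) \<Longrightarrow>
    \<exists>u' v'. u = u0 @ u' \<and> v = v0 @ v' \<and> wrun (set (snd (snd W))) q u' v' r"
  using assms
proof (induction arbitrary: q u0 v0)
  case (trun_nil x)
  then show ?case by (auto intro: wrun_nil simp del: enc_Pair)
next
  case (trun_step x a b z u v y)
  obtain p' ue ve q' s t where e: "(p', ue, ve, q') \<in> set (snd (snd W))"
    "(s, a, b, t) \<in> set (split_edge (p', ue, ve, q'))" "x = enc s" "z = enc t"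
    using trun_step.hyps(1) unfolding wcode_edges by (metis prod_cases4)
  have s: "s = (q, u0, v0)" using e(3) trun_step.prems(1) by (simp del: enc_Pair)
  have IH: "\<exists>u' v'. u = u1 @ u' \<and> v = v1 @ v' \<and> wrun (set (snd (snd W))) q1 u' v' r"
    if "t = (q1, u1, v1)" for q1 u1 v1
    using trun_step.IH[of q1 u1 v1] e(4) that trun_step.prems(2) by simp
  from e(2) consider "s = (p', [], [])" "a = None" "b = None" "t = (q', ue, ve)"
    | c u' where "s = (q', c # u', ve)" "a = Some c" "b = None" "t = (q', u', ve)"
    | c v' where "s = (q', [], c # v')" "a = None" "b = Some c" "t = (q', [], v')"
    by (auto simp: set_split_edge)
  then show ?case
  proof cases
    case 1
    with IH[OF 1(4)] s show ?thesis using wrun_step[OF e(1)] by auto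
  next
    case 2
    with IH[OF 2(4)] s show ?thesis by auto
  next
    case 3
    with IH[OF 3(4)] s show ?thesis by auto
  qed
qed

lemma wrun_imp_trun_wcode:
  assumes "wrun (set (snd (snd W))) p u v r"
  shows "trun (dec_trans (wcode W)) (enc (p, [] :: nat list, [] :: nat list)) u v
    (enc (r, [] :: nat list, [] :: nat list))"
  using assms
proof induction
  case (wrun_nil p)
  show ?case by (rule trun.trun_nil)
next
  case (wrun_step p u v q u' v' r)
  let ?T = "dec_trans (wcode W)" and ?r = "enc (r, [] :: nat list, [] :: nat list)"
  have edge: "(enc s, a, b, enc t) \<in> set (t_edges ?T)" if "(s, a, b, t) \<in> set (split_edge (p, u, v, q))" for s a b t
    using wcode_edges wrun_step.hyps(1) that by blast
  have out: "trun ?T (enc (q, [] :: nat list, v0)) u' (v0 @ v') ?r" if "suffix v0 v" for v0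
    using that
  proof (induction v0)
    case Nil
    then show ?case using wrun_step.IH by simp
  next
    case (Cons b v0)
    have "(enc (q, [] :: nat list, b # v0), None, Some b, enc (q, [] :: nat list, v0)) \<in> set (t_edges ?T)"
      by (rule edge) (use Cons.prems in \<open>simp add: set_split_edge\<close>)
    from trun.trun_step[OF this Cons.IH[OF suffix_ConsD[OF Cons.prems]]] show ?case by simp
  qed
  have inp: "trun ?T (enc (q, u0, v)) (u0 @ u') (v @ v') ?r" if "suffix u0 u" for u0
    using that
  proof (induction u0)
    case Nil
    then show ?case using out by simp
  next
    case (Cons a u0)
    have "(enc (q, a # u0, v), Some a, None, enc (q, u0, v)) \<in> set (t_edges ?T)"
      by (rule edge) (use Cons.prems in \<open>simp add: set_split_edge\<close>)
    from trun.trun_step[OF this Cons.IH[OF suffix_ConsD[OF Cons.prems]]] show ?case by simp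
  qed
  have "(enc (p, [] :: nat list, [] :: nat list), None, None, enc (q, u, v)) \<in> set (t_edges ?T)"
    by (rule edge) (simp add: set_split_edge)
  from trun.trun_step[OF this inp[OF suffix_order.refl]] show ?case by simp
qed

theorem trel_wcode: "trel (dec_trans (wcode W)) = wrel W"
proof -
  have "(\<exists>x\<in>set (t_init (dec_trans (wcode W))). \<exists>y\<in>set (t_fin (dec_trans (wcode W))).
      trun (dec_trans (wcode W)) x u v y) \<longleftrightarrow>
    (\<exists>p\<in>set (fst W). \<exists>q\<in>set (fst (snd W)). wrun (set (snd (snd W))) p u v q)" for u v
  proof
    assume "\<exists>x\<in>set (t_init (dec_trans (wcode W))). \<exists>y\<in>set (t_fin (dec_trans (wcode W))).
      trun (dec_trans (wcode W)) x u v y"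
    then obtain p q where pq: "p \<in> set (fst W)" "q \<in> set (fst (snd W))"
      "trun (dec_trans (wcode W)) (enc (p, [] :: nat list, [] :: nat list)) u v (enc (q, [] :: nat list, [] :: nat list))"
      unfolding dec_trans_wcode(1,2) set_map by blast
    then have "wrun (set (snd (snd W))) p u v q"
      using trun_wcode_imp[OF pq(3) refl refl] by simp
    with pq show "\<exists>p\<in>set (fst W). \<exists>q\<in>set (fst (snd W)). wrun (set (snd (snd W))) p u v q" by blast
  next
    assume "\<exists>p\<in>set (fst W). \<exists>q\<in>set (fst (snd W)). wrun (set (snd (snd W))) p u v q"
    then show "\<exists>x\<in>set (t_init (dec_trans (wcode W))). \<exists>y\<in>set (t_fin (dec_trans (wcode W))).
      trun (dec_trans (wcode W)) x u v y"
      unfolding dec_trans_wcode(1,2) set_map using wrun_imp_trun_wcode by blast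
  qed
  then show ?thesis unfolding trel_def wrel_def by simp
qed

text \<open>Fixes one function as the result of the closure procedure, which is only described
  relationally, and lets it take transducers with states of an arbitrary encodable type.\<close>

lemma full_trio_image:
  assumes "full_trio D rep"
  shows "\<exists>f. computable_on (D \<times> UNIV) f \<and>
    (\<forall>c\<in>D. \<forall>W. f (c, W :: 'q::enc wtrans) \<in> D \<and> rep (f (c, W)) = wrel W `` rep c)"
proof -
  obtain p where p: "\<And>c t. c \<in> D \<Longrightarrow> \<exists>y. eval p [prod_encode (c, t)] y \<and> y \<in> D \<and>
      rep y = timage (dec_trans t) (rep c)"
    using assms unfolding full_trio_def by blast
  then obtain g where g: "\<And>c t. c \<in> D \<Longrightarrow> eval p [prod_encode (c, t)] (g c t) \<and> g c t \<in> D \<and>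
      rep (g c t) = timage (dec_trans t) (rep c)"
    by metis
  have "computable_on (D \<times> UNIV) (\<lambda>x. g (fst x) (snd x))"
    using g by (intro cmpI[of _ p]) auto
  then have "computable_on (D \<times> UNIV) (\<lambda>x. (\<lambda>y. g (fst y) (snd y)) (fst x, wcode (snd x :: 'q wtrans)))"
    by (rule computable_comp) ((rule computable_intros computable_comp_UNIV[OF computable_wcode])+, auto)
  then have "computable_on (D \<times> UNIV) (\<lambda>x. g (fst x) (wcode (snd x :: 'q wtrans)))" by simp
  moreover have "timage (dec_trans (wcode W)) L = wrel W `` L" for W :: "'q wtrans" and L
    unfolding timage_def trel_wcode by blast
  ultimately show ?thesis
    by (intro exI[of _ "\<lambda>x. g (fst x) (wcode (snd x))"]) (simp add: g)
qed

subsection \<open>Special transducers\<close>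

definition loops :: "(nat list \<times> nat list) list \<Rightarrow> nat wtrans" where
  "loops L = ([0], [0], map (\<lambda>e. (0, fst e, snd e, 0)) L)"

definition erase_trans :: "nat list \<Rightarrow> nat wtrans" where
  "erase_trans g = loops (map (\<lambda>a. ([a], [])) g)"

definition down_trans :: "nat list \<Rightarrow> nat wtrans" where
  "down_trans g = loops (map (\<lambda>a. ([a], [a])) g @ map (\<lambda>a. ([a], [])) g)"

lemma computable_erase_trans: "computable_on UNIV erase_trans"
  unfolding erase_trans_def loops_def by (intro computable_intros)

lemma computable_down_trans: "computable_on UNIV down_trans"
  unfolding down_trans_def loops_def by (intro computable_intros)

lemma wrel_erase_trans: "wrel (erase_trans g) = {(u, v). u \<in> lists (set g) \<and> v = []}"
proof -
  let ?E = "set (snd (snd (erase_trans g)))"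
  have "u \<in> lists (set g) \<and> v = []" if "wrun ?E p u v q" for p u v q
    using that by induction (auto simp: erase_trans_def loops_def)
  moreover have "wrun ?E 0 u [] 0" if "set u \<subseteq> set g" for u
    using that
  proof (induction u)
    case (Cons a u)
    then have "(0, [a], [], 0) \<in> ?E" by (auto simp: erase_trans_def loops_def)
    from wrun_step[OF this] Cons show ?case by simp
  qed (rule wrun_nil)
  moreover have "fst (erase_trans g) = [0]" "fst (snd (erase_trans g)) = [0]"
    by (simp_all add: erase_trans_def loops_def)
  ultimately show ?thesis
    unfolding wrel_def in_lists_conv_set subset_iff by auto
qed

lemma wrel_down_trans: "wrel (down_trans g) = {(u, v). u \<in> lists (set g) \<and> subseq v u}"
proof -
  let ?E = "set (snd (snd (down_trans g)))"
  have "u \<in> lists (set g) \<and> subseq v u" if "wrun ?E p u v q" for p u v q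
    using that by induction (auto simp: down_trans_def loops_def)
  moreover have "wrun ?E 0 u v 0" if "set u \<subseteq> set g" "subseq v u" for u v
    using that(2,1)
  proof (induction)
    case (list_emb_Nil u)
    then show ?case
    proof (induction u)
      case (Cons a u)
      then have "(0, [a], [], 0) \<in> ?E" by (auto simp: down_trans_def loops_def)
      from wrun_step[OF this] Cons show ?case by simp
    qed (rule wrun_nil)
  next
    case (list_emb_Cons v u a)
    then have "(0, [a], [], 0) \<in> ?E" by (auto simp: down_trans_def loops_def)
    from wrun_step[OF this] list_emb_Cons show ?case by simp
  next
    case (list_emb_Cons2 b a v u)
    then have "(0, [a], [a], 0) \<in> ?E" by (auto simp: down_trans_def loops_def)
    from wrun_step[OF this] list_emb_Cons2 show ?case by simp
  qed
  moreover have "fst (down_trans g) = [0]" "fst (snd (down_trans g)) = [0]"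
    by (simp_all add: down_trans_def loops_def)
  ultimately show ?thesis
    unfolding wrel_def in_lists_conv_set subset_iff by auto
qed

text \<open>A sequence of blocks \<open>(u, v, x, y)\<close>: the label \<open>(u, v)\<close> is repeated at will and followed
  by one occurrence of \<open>(x, y)\<close>.\<close>

type_synonym block = "nat list \<times> nat list \<times> nat list \<times> nat list"

definition stair_trans :: "block list \<Rightarrow> nat wtrans" where
  "stair_trans bs = ([0], [length bs], concat (map (\<lambda>i. case drop i bs of [] \<Rightarrow> []
     | b # _ \<Rightarrow> (case b of (u, v, x, y) \<Rightarrow> [(i, u, v, i), (i, x, y, Suc i)])) [0..<length bs]))"

fun stair_in :: "block list \<Rightarrow> nat list \<Rightarrow> nat list" where
  "stair_in ((u, v, x, y) # bs) (k # ks) = concat (replicate k u) @ x @ stair_in bs ks"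
| "stair_in _ _ = []"

fun stair_out :: "block list \<Rightarrow> nat list \<Rightarrow> nat list" where
  "stair_out ((u, v, x, y) # bs) (k # ks) = concat (replicate k v) @ y @ stair_out bs ks"
| "stair_out _ _ = []"

lemma computable_stair_trans: "computable_on UNIV stair_trans"
  unfolding stair_trans_def by (intro computable_intros)

lemma stair_edges:
  "(i, x, y, j) \<in> set (snd (snd (stair_trans bs))) \<longleftrightarrow> (\<exists>u v x' y' r. drop i bs = (u, v, x', y') # r \<and>
     (j = i \<and> x = u \<and> y = v \<or> j = Suc i \<and> x = x' \<and> y = y'))"
proof -
  have concat: "z \<in> set (concat (map G [0..<n])) \<longleftrightarrow> (\<exists>i<n. z \<in> set (G i))" for z G and n :: nat
    by auto
  let ?Q = "\<lambda>d. \<exists>u v x' y' r. d = (u, v, x', y') # r \<and>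
     (j = i \<and> x = u \<and> y = v \<or> j = Suc i \<and> x = x' \<and> y = y')"
  have "(i, x, y, j) \<in> set (case d of [] \<Rightarrow> [] | b # _ \<Rightarrow> (case b of (u, v, x, y) \<Rightarrow>
      [(k, u, v, k), (k, x, y, Suc k)])) \<longleftrightarrow> i = k \<and> ?Q d" for k and d :: "block list"
    by (cases d) auto
  then have "(i, x, y, j) \<in> set (snd (snd (stair_trans bs))) \<longleftrightarrow> i < length bs \<and> ?Q (drop i bs)"
    unfolding stair_trans_def snd_conv concat by auto
  moreover have "i < length bs" if "drop i bs = e # r" for e r
    using that by (metis drop_eq_Nil list.distinct(1) not_less)
  ultimately show ?thesis by blast
qed

lemma wrun_stair_imp:
  assumes "wrun (set (snd (snd (stair_trans bs)))) i z z' m"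
  shows "m = length bs \<Longrightarrow> i \<le> m \<Longrightarrow> \<exists>ks. length ks = m - i \<and> z = stair_in (drop i bs) ks
    \<and> z' = stair_out (drop i bs) ks"
  using assms
proof induction
  case (wrun_step i x y j x1 y1 m)
  obtain u v x' y' r where d: "drop i bs = (u, v, x', y') # r"
    and j: "j = i \<and> x = u \<and> y = v \<or> j = Suc i \<and> x = x' \<and> y = y'"
    using wrun_step.hyps(1) unfolding stair_edges by blast
  have i: "i < length bs" using d by (metis drop_eq_Nil list.distinct(1) not_less)
  then have "j \<le> m" using j wrun_step.prems by auto
  from wrun_step.IH[OF wrun_step.prems(1) this] obtain ks where
    ks: "length ks = m - j" "x1 = stair_in (drop j bs) ks" "y1 = stair_out (drop j bs) ks" by blast
  from j show ?case
  proof (elim disjE conjE)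
    assume j: "j = i" "x = u" "y = v"
    then obtain k ks' where "ks = k # ks'" using ks(1) i wrun_step.prems by (cases ks) auto
    then show ?thesis using j ks d by (intro exI[of _ "Suc k # ks'"]) auto
  next
    assume j: "j = Suc i" "x = x'" "y = y'"
    have "drop (Suc i) bs = r" using d by (metis drop_Suc list.sel(3) tl_drop)
    then show ?thesis using j ks d i wrun_step.prems by (intro exI[of _ "0 # ks"]) auto
  qed
qed auto

lemma wrun_stair:
  "length ks = length bs - i \<Longrightarrow> i \<le> length bs \<Longrightarrow> wrun (set (snd (snd (stair_trans bs)))) i
     (stair_in (drop i bs) ks) (stair_out (drop i bs) ks) (length bs)"
proof (induction ks arbitrary: i)
  case Nil
  then show ?case by (auto intro: wrun_nil)
next
  case (Cons k ks)
  then have i: "i < length bs" by auto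
  then obtain u v x y where d: "drop i bs = (u, v, x, y) # drop (Suc i) bs"
    by (metis Cons_nth_drop_Suc prod_cases4)
  have e: "(i, u, v, i) \<in> set (snd (snd (stair_trans bs)))" "(i, x, y, Suc i) \<in> set (snd (snd (stair_trans bs)))"
    unfolding stair_edges using d by blast+
  have "wrun (set (snd (snd (stair_trans bs)))) i (concat (replicate k u) @ x @ stair_in (drop (Suc i) bs) ks)
      (concat (replicate k v) @ y @ stair_out (drop (Suc i) bs) ks) (length bs)"
  proof (induction k)
    case 0
    show ?case using wrun_step[OF e(2)] Cons.IH[of "Suc i"] Cons.prems i by simp
  next
    case (Suc k)
    from wrun_step[OF e(1) Suc] show ?case by simp
  qed
  then show ?case using d by simp
qed

lemma wrel_stair_trans: "wrel (stair_trans bs) =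
    {(z, z'). \<exists>ks. length ks = length bs \<and> z = stair_in bs ks \<and> z' = stair_out bs ks}"
proof -
  have [simp]: "fst (stair_trans bs) = [0]" "fst (snd (stair_trans bs)) = [length bs]"
    by (simp_all add: stair_trans_def)
  show ?thesis unfolding wrel_def
    using wrun_stair_imp[of bs 0 _ _ "length bs"] wrun_stair[of _ bs 0] by fastforce
qed

subsection \<open>Membership in ideals as a finite state test\<close>

text \<open>A test \<open>(A, Some P)\<close> checks whether the projection of a word to the letters in \<open>A\<close> belongs
  to the ideal \<open>P\<close>; it has failed once it has become \<open>(A, None)\<close>.\<close>

type_synonym tests = "(nat list \<times> ideal option) list"

definition proj :: "nat list \<Rightarrow> nat list \<Rightarrow> nat list" where
  "proj A z = filter (\<lambda>a. a \<in> set A) z"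

definition tstep :: "tests \<Rightarrow> nat \<Rightarrow> tests" where
  "tstep st a = map (\<lambda>t. (fst t, if a \<in> set (fst t) then
     (case snd t of None \<Rightarrow> None | Some P \<Rightarrow> der P a) else snd t)) st"

text \<open>Derivatives of an ideal are suffixes of its list, so failure and all suffixes, combined
  over the tests, form a finite set that contains all reachable states.\<close>

definition tstates :: "tests \<Rightarrow> tests list" where
  "tstates st = product_lists (map (\<lambda>t. map (\<lambda>r. (fst t, r)) (None #
     (case snd t of None \<Rightarrow> [] | Some P \<Rightarrow> map (\<lambda>i. Some (drop i P)) [0..<Suc (length P)]))) st)"

definition restrict_tests :: "nat list \<Rightarrow> tests \<Rightarrow> tests list \<Rightarrow> tests wtrans" where
  "restrict_tests g st fins = ([st], fins,
     concat (map (\<lambda>s. map (\<lambda>a. (s, [a], [a], tstep s a)) g) (tstates st)))"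

lemma computable_der [computable_intros]: assumes "computable_on A f" "computable_on A g" shows "computable_on A (\<lambda>x. der (f x) (g x))"
proof -
  \<comment> \<open>The fold also rebuilds the list passed so far, because \<open>der\<close>
    returns a suffix of its argument and a fold does not see the remaining list.\<close>
  let ?F = "\<lambda>a e r. (e # fst r, if a \<in> set (fst e) then Some (e # fst r) else
      if a = snd e then Some (fst r) else snd r)"
  have "foldr (?F a) P ([], None) = (P, der P a)" for P a
    by (induction P) auto
  then have "der P a = snd (fold (?F a) (rev P) ([], None))" for P a
    by (simp add: foldr_conv_fold)
  moreover have "computable_on (A \<times> UNIV) (\<lambda>p. g (fst p))"
    by (rule computable_weaken[OF assms(2)])
  ultimately show ?thesis using assms by (simp only:) (intro computable_intros)
qed

lemma computable_tstep: "computable_on UNIV (\<lambda>p. tstep (fst p) (snd p))"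
  unfolding tstep_def by (intro computable_intros)

lemma computable_tstep' [computable_intros]:
  assumes "computable_on A f" "computable_on A g"
  shows "computable_on A (\<lambda>x. tstep (f x) (g x))"
proof -
  have "computable_on A (\<lambda>x. (\<lambda>p. tstep (fst p) (snd p)) (f x, g x))"
    by (rule computable_comp_UNIV[OF computable_tstep]) (intro computable_intros assms)
  then show ?thesis by simp
qed

lemma computable_tstates: "computable_on UNIV tstates"
  unfolding tstates_def by (intro computable_intros)

lemma computable_restrict_tests: "computable_on UNIV (\<lambda>p. restrict_tests (fst p) (fst (snd p)) (snd (snd p)))"
  unfolding restrict_tests_def
  by (intro computable_intros computable_comp_UNIV[OF computable_tstates])

lemma tstates_iff: "s \<in> set (tstates st) \<longleftrightarrow> list_all2 (\<lambda>t t0. fst t = fst t0 \<and>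
    (\<forall>Q. snd t = Some Q \<longrightarrow> (\<exists>P. snd t0 = Some P \<and> suffix Q P))) s st"
proof -
  have suff: "(\<exists>i<Suc (length P). Q = drop i P) \<longleftrightarrow> suffix Q P" for P Q :: ideal
  proof
    assume "suffix Q P"
    then obtain R where "P = R @ Q" by (auto simp: suffix_def)
    then show "\<exists>i<Suc (length P). Q = drop i P" by (intro exI[of _ "length R"]) simp
  qed (auto simp: suffix_drop)
  have "set (tstates st) = {s. list_all2 (\<lambda>x ys. x \<in> set ys) s (map (\<lambda>t. map (\<lambda>r. (fst t, r)) (None #
     (case snd t of None \<Rightarrow> [] | Some P \<Rightarrow> map (\<lambda>i. Some (drop i P)) [0..<Suc (length P)]))) st)}"
    unfolding tstates_def product_lists_set ..
  moreover have "x \<in> set (map (\<lambda>r. (fst t, r)) (None #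
     (case snd t of None \<Rightarrow> [] | Some P \<Rightarrow> map (\<lambda>i. Some (drop i P)) [0..<Suc (length P)]))) \<longleftrightarrow>
    fst x = fst t \<and> (\<forall>Q. snd x = Some Q \<longrightarrow> (\<exists>P. snd t = Some P \<and> suffix Q P))" for x t :: "nat list \<times> ideal option"
  proof -
    have eq: "set (map (\<lambda>i. Some (drop i P)) [0..<Suc (length P)]) = Some ` {Q. suffix Q P}" for P :: ideal
      unfolding set_map set_upt suff[symmetric] by fastforce
    show ?thesis
    proof (cases "snd t")
      case None
      then show ?thesis by (cases x; cases "snd x") auto
    next
      case (Some P)
      define ys where "ys = map (\<lambda>i. Some (drop i P)) [0..<Suc (length P)]"
      have "set ys = Some ` {Q. suffix Q P}" unfolding ys_def by (rule eq)
      then show ?thesis unfolding Some option.case ys_def[symmetric] by (cases x; cases "snd x") auto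
    qed
  qed
  ultimately show ?thesis by (simp only: mem_Collect_eq list_all2_map2)
qed

lemma tstates_refl: "st \<in> set (tstates st)"
  unfolding tstates_iff by (rule list.rel_refl) simp

lemma tstates_tstep: assumes "s \<in> set (tstates st)" shows "tstep s a \<in> set (tstates st)"
  using assms unfolding tstates_iff tstep_def list_all2_map1
  by (rule list_all2_mono) (auto split: option.splits if_splits dest!: der_suffix intro: suffix_order.trans)

lemma tstates_foldl: "s \<in> set (tstates st) \<Longrightarrow> foldl tstep s z \<in> set (tstates st)"
  by (induction z arbitrary: s) (auto intro: tstates_tstep)

definition tpass :: "tests \<Rightarrow> bool list" where
  "tpass st = map (\<lambda>t. snd t \<noteq> None) st"

definition start :: "(nat list \<times> ideal) list \<Rightarrow> tests" where
  "start ts = map (\<lambda>t. (fst t, Some (snd t))) ts"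

lemma tpass_foldl: "tpass (foldl tstep st z) = map (\<lambda>t. case snd t of None \<Rightarrow> False
    | Some P \<Rightarrow> imem P (proj (fst t) z)) st"
proof (induction z arbitrary: st)
  case Nil
  show ?case by (auto simp: tpass_def proj_def split: option.split)
next
  case (Cons a z)
  have "tpass (foldl tstep st (a # z)) = tpass (foldl tstep (tstep st a) z)" by simp
  also have "\<dots> = map (\<lambda>t. case snd t of None \<Rightarrow> False
    | Some P \<Rightarrow> imem P (proj (fst t) z)) (tstep st a)" by (rule Cons.IH)
  also have "\<dots> = map (\<lambda>t. case snd t of None \<Rightarrow> False
    | Some P \<Rightarrow> imem P (proj (fst t) (a # z))) st"
    by (auto simp: tstep_def proj_def split: option.split)
  finally show ?case .
qed

lemma tpass_start: "tpass (foldl tstep (start ts) z) = map (\<lambda>t. imem (snd t) (proj (fst t) z)) ts"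
  by (simp add: tpass_foldl start_def comp_def)

lemma wrun_restr_imp:
  "wrun (set (snd (snd (restrict_tests g st fins)))) s u v s' \<Longrightarrow>
    u \<in> lists (set g) \<and> v = u \<and> s' = foldl tstep s u"
  by (induction rule: wrun.induct) (auto simp: restrict_tests_def)

lemma wrun_restr:
  "set u \<subseteq> set g \<Longrightarrow> s \<in> set (tstates st) \<Longrightarrow>
    wrun (set (snd (snd (restrict_tests g st fins)))) s u u (foldl tstep s u)"
proof (induction u arbitrary: s)
  case (Cons a u)
  have "(s, [a], [a], tstep s a) \<in> set (snd (snd (restrict_tests g st fins)))"
    using Cons.prems by (auto simp: restrict_tests_def)
  from wrun_step[OF this Cons.IH] Cons.prems tstates_tstep show ?case by simp
qed (auto intro: wrun_nil)

lemma wrel_restrict_tests: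
  "wrel (restrict_tests g st fins) = {(u, v). u \<in> lists (set g) \<and> v = u \<and> foldl tstep st u \<in> set fins}"
proof -
  have [simp]: "fst (restrict_tests g st fins) = [st]" "fst (snd (restrict_tests g st fins)) = fins"
    by (simp_all add: restrict_tests_def)
  show ?thesis unfolding wrel_def
  proof (intro Collect_cong, clarify)
    fix u v
    show "(\<exists>p\<in>set (fst (restrict_tests g st fins)). \<exists>q\<in>set (fst (snd (restrict_tests g st fins))).
        wrun (set (snd (snd (restrict_tests g st fins)))) p u v q) \<longleftrightarrow>
      u \<in> lists (set g) \<and> v = u \<and> foldl tstep st u \<in> set fins"
      (is "?l \<longleftrightarrow> ?r")
    proof
      assume ?l
      then obtain q where "q \<in> set fins" "wrun (set (snd (snd (restrict_tests g st fins)))) st u v q" by auto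
      then show ?r using wrun_restr_imp by blast
    next
      assume r: ?r
      then have "set u \<subseteq> set g" by auto
      with r wrun_restr[OF this tstates_refl] show ?l by auto
    qed
  qed
qed

text \<open>With free choice of initial and final states this yields \<open>T\<close> itself as well
  as the relation of all runs between given states, which later determines the edges of an
  automaton.\<close>

definition subtrans :: "(nat \<times> nat option \<times> nat option \<times> nat) list \<Rightarrow> nat list \<Rightarrow> nat list \<Rightarrow> nat wtrans" where
  "subtrans E I F = (I, F, map (\<lambda>e. (fst e, ocons (fst (snd e)) [], ocons (fst (snd (snd e))) [], snd (snd (snd e)))) E)"

lemma ocons_conv: "ocons a w = ocons a [] @ w"
  by (cases a) auto

lemma wrun_subtrans:
  "wrun (set (snd (snd (subtrans (t_edges T) I F)))) p u v q \<longleftrightarrow> trun T p u v q"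
proof
  assume "wrun (set (snd (snd (subtrans (t_edges T) I F)))) p u v q"
  then show "trun T p u v q"
  proof induction
    case (wrun_step p u v q u' v' r)
    then obtain a b where "(p, a, b, q) \<in> set (t_edges T)" "u = ocons a []" "v = ocons b []"
      by (auto simp: subtrans_def)
    then show ?case using trun.trun_step[OF _ wrun_step.IH] by (metis ocons_conv)
  qed (rule trun.trun_nil)
next
  assume "trun T p u v q"
  then show "wrun (set (snd (snd (subtrans (t_edges T) I F)))) p u v q"
  proof induction
    case (trun_step p a b q u v r)
    then have "(p, ocons a [], ocons b [], q) \<in> set (snd (snd (subtrans (t_edges T) I F)))"
      by (force simp: subtrans_def)
    from wrun_step[OF this trun_step.IH] show ?case by (metis ocons_conv)
  qed (rule wrun_nil)
qed

lemma wrel_subtrans: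
  "wrel (subtrans (t_edges T) I F) = {(u, v). \<exists>p\<in>set I. \<exists>q\<in>set F. trun T p u v q}"
  unfolding wrel_def wrun_subtrans by (simp add: subtrans_def)

lemma wrel_subtrans_trel: "wrel (subtrans (t_edges T) (t_init T) (t_fin T)) = trel T"
  unfolding wrel_subtrans trel_def ..

subsection \<open>Composition and product of transducers\<close>

lemma trun_append: "trun T p u v q \<Longrightarrow> trun T q u' v' r \<Longrightarrow> trun T p (u @ u') (v @ v') r"
proof (induction rule: trun.induct)
  case (trun_step p a b q u v r')
  from trun.trun_step[OF trun_step.hyps(1) trun_step.IH[OF trun_step.prems]]
  show ?case by (metis append_assoc ocons_conv)
qed simp

text \<open>The run is cut right after the edge that reads \<open>a\<close>. The intermediate state
  is then the target of an edge, which leaves only finitely many known candidates.\<close>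

lemma trun_Cons_split:
  "trun T p (a # u) v r \<Longrightarrow> \<exists>q v1 v2. v = v1 @ v2 \<and> trun T p [a] v1 q \<and> trun T q u v2 r \<and>
     q \<in> (\<lambda>e. snd (snd (snd e))) ` set (t_edges T)"
proof (induction p "a # u" v r rule: trun.induct)
  case (trun_step p c b q u1 v r)
  show ?case
  proof (cases c)
    case None
    with trun_step obtain q' v1 v2 where "v = v1 @ v2" "trun T q [a] v1 q'" "trun T q' u v2 r"
      "q' \<in> (\<lambda>e. snd (snd (snd e))) ` set (t_edges T)" by auto
    moreover from trun.trun_step[OF trun_step.hyps(1) this(2)] None have "trun T p [a] (ocons b v1) q'" by simp
    ultimately show ?thesis by (metis append_assoc ocons_conv)
  next
    case (Some c')
    with trun_step have "c' = a" "u1 = u" by auto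
    moreover from trun.trun_step[OF trun_step.hyps(1) trun.trun_nil] Some
    have "trun T p [c'] (ocons b []) q" by simp
    ultimately show ?thesis using trun_step.hyps(1,2) by (force simp: ocons_conv[of b v])
  qed
qed

lemma trun_out_over:
  assumes "trun T p u v q" "trans_over \<Sigma> \<Gamma> T"
  shows "v \<in> lists \<Gamma>"
  using assms(1)
proof induction
  case (trun_step p a b q u v r)
  then show ?case using assms(2) by (cases b) (auto simp: trans_over_def)
qed simp

type_synonym sedge = "nat \<times> nat option \<times> nat list \<times> nat list \<times> nat"

inductive srun :: "sedge set \<Rightarrow> nat \<Rightarrow> nat list \<Rightarrow> nat list \<Rightarrow> nat list \<Rightarrow> nat \<Rightarrow> bool" for A where
  srun_nil: "srun A p [] [] [] p"
| srun_step: "(p, c, x, y, q) \<in> A \<Longrightarrow> srun A q cs xs ys r \<Longrightarrow>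
    srun A p (ocons c cs) (x @ xs) (y @ ys) r"

text \<open>The second entry of an edge is the synchronisation label. The flag \<open>i\<close>
  takes it from the input (two transducers run on the same word) or from the output (composition).
  The flag \<open>k\<close> keeps the input tape, which only one factor may do.\<close>

definition relabel :: "bool \<Rightarrow> bool \<Rightarrow> (nat list \<Rightarrow> nat list) \<Rightarrow> trans \<Rightarrow> sedge set" where
  "relabel i k f T = (\<lambda>(p, a, b, q). (p, if i then a else b, if k then ocons a [] else [], f (ocons b []), q))
     ` set (t_edges T)"

lemma srun_relabel:
  assumes f: "\<And>u v. f (u @ v) = f u @ f v" "f [] = []"
  shows "srun (relabel i k f T) p c x y q \<longleftrightarrow> (\<exists>u v. trun T p u v q \<and> c = (if i then u else v) \<and>
     x = (if k then u else []) \<and> y = f v)"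
proof
  assume "srun (relabel i k f T) p c x y q"
  then show "\<exists>u v. trun T p u v q \<and> c = (if i then u else v) \<and> x = (if k then u else []) \<and> y = f v"
  proof induction
    case (srun_nil p)
    show ?case using f by (intro exI[of _ "[]"]) (simp add: trun.trun_nil)
  next
    case (srun_step p c x y q cs xs ys r)
    obtain a b where e: "(p, a, b, q) \<in> set (t_edges T)" "c = (if i then a else b)"
      "x = (if k then ocons a [] else [])" "y = f (ocons b [])"
      using srun_step.hyps(1) by (auto simp: relabel_def)
    from srun_step.IH obtain u v where uv: "trun T q u v r" "cs = (if i then u else v)"
      "xs = (if k then u else [])" "ys = f v" by blast
    show ?case
      using trun.trun_step[OF e(1) uv(1)] e(2-4) uv(2-4) f(1)[of "ocons b []" v]
      by (intro exI[of _ "ocons a u"] exI[of _ "ocons b v"]) (simp flip: ocons_conv)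
  qed
next
  assume "\<exists>u v. trun T p u v q \<and> c = (if i then u else v) \<and> x = (if k then u else []) \<and> y = f v"
  then obtain u v where "trun T p u v q" and eq: "c = (if i then u else v)" "x = (if k then u else [])" "y = f v"
    by blast
  from this(1) have "srun (relabel i k f T) p (if i then u else v) (if k then u else []) (f v) q"
  proof induction
    case (trun_nil p)
    show ?case using f by (simp add: srun_nil)
  next
    case (trun_step p a b q u v r)
    have "(p, if i then a else b, if k then ocons a [] else [], f (ocons b []), q) \<in> relabel i k f T"
      using trun_step.hyps(1) unfolding relabel_def by force
    from srun.srun_step[OF this trun_step.IH] show ?case
      using f(1)[of "ocons b []" v] by (cases i; cases k) (simp_all flip: ocons_conv)
  qed
  then show "srun (relabel i k f T) p c x y q" unfolding eq .
qed

definition states :: "trans \<Rightarrow> nat set" where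
  "states T = set (t_init T) \<union> fst ` set (t_edges T) \<union> (\<lambda>e. snd (snd (snd e))) ` set (t_edges T)"

lemma finite_states: "finite (states T)"
  by (simp add: states_def)

lemma relabel_target: "(p, c, x, y, q) \<in> relabel i k f T \<Longrightarrow> q \<in> states T"
  unfolding relabel_def states_def by force

text \<open>The product synchronises the two automata on their first label.\<close>

definition prod_edges :: "nat set \<Rightarrow> nat set \<Rightarrow> sedge set \<Rightarrow> sedge set \<Rightarrow> (nat \<times> nat) wedge set" where
  "prod_edges Q1 Q2 A1 A2 =
     (\<lambda>((p, c, x, y, q), s). ((p, s), x, y, (q, s))) ` ({e \<in> A1. fst (snd e) = None} \<times> Q2) \<union>
     (\<lambda>((s, c, x, y, t), p). ((p, s), x, y, (p, t))) ` ({e \<in> A2. fst (snd e) = None} \<times> Q1) \<union>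
     (\<lambda>((p, c, x, y, q), (s, c', x', y', t)). ((p, s), x @ x', y @ y', (q, t))) `
       {(e, e'). e \<in> A1 \<and> e' \<in> A2 \<and> fst (snd e) = fst (snd e') \<and> fst (snd e) \<noteq> None}"

lemma finite_prod_edges:
  assumes "finite Q1" "finite Q2" "finite A1" "finite A2"
  shows "finite (prod_edges Q1 Q2 A1 A2)"
proof -
  have "finite {(e, e'). e \<in> A1 \<and> e' \<in> A2 \<and> fst (snd e) = fst (snd e') \<and> fst (snd e) \<noteq> None}"
    by (rule finite_subset[of _ "A1 \<times> A2"]) (use assms in auto)
  then show ?thesis using assms by (simp add: prod_edges_def)
qed

lemma prod_edges_cases:
  assumes "(ps, x, y, qt) \<in> prod_edges Q1 Q2 A1 A2"
  obtains (left) p q s where "ps = (p, s)" "qt = (q, s)" "(p, None, x, y, q) \<in> A1"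
  | (right) p s t where "ps = (p, s)" "qt = (p, t)" "(s, None, x, y, t) \<in> A2"
  | (both) p q s t c x1 y1 x2 y2 where "ps = (p, s)" "qt = (q, t)" "x = x1 @ x2" "y = y1 @ y2"
      "(p, Some c, x1, y1, q) \<in> A1" "(s, Some c, x2, y2, t) \<in> A2"
  using assms unfolding prod_edges_def by auto

lemma prod_edges_left: "(p, None, x, y, q) \<in> A1 \<Longrightarrow> s \<in> Q2 \<Longrightarrow> ((p, s), x, y, (q, s)) \<in> prod_edges Q1 Q2 A1 A2"
  unfolding prod_edges_def
  by (intro UnI1, rule image_eqI[where x="((p, None, x, y, q), s)"]) simp_all

lemma prod_edges_right: "(s, None, x, y, t) \<in> A2 \<Longrightarrow> p \<in> Q1 \<Longrightarrow> ((p, s), x, y, (p, t)) \<in> prod_edges Q1 Q2 A1 A2"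
  unfolding prod_edges_def
  by (rule UnI1, rule UnI2, rule image_eqI[where x="((s, None, x, y, t), p)"]) simp_all

lemma prod_edges_both: "(p, Some c, x, y, q) \<in> A1 \<Longrightarrow> (s, Some c, x', y', t) \<in> A2 \<Longrightarrow>
    ((p, s), x @ x', y @ y', (q, t)) \<in> prod_edges Q1 Q2 A1 A2"
  unfolding prod_edges_def
  by (rule UnI2, rule image_eqI[where x="((p, Some c, x, y, q), (s, Some c, x', y', t))"]) simp_all

text \<open>The product shuffles the two outputs in an uncontrolled order. They are over disjoint
  sets of letters, told apart by \<open>P\<close>, so filtering recovers each of them.\<close>

lemma wrun_prod_imp:
  assumes "wrun (prod_edges Q1 Q2 A1 A2) ps u w qt"
    and A1: "\<And>p c x y q. (p, c, x, y, q) \<in> A1 \<Longrightarrow> \<forall>a\<in>set y. P a"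
    and A2: "\<And>p c x y q. (p, c, x, y, q) \<in> A2 \<Longrightarrow> x = [] \<and> (\<forall>a\<in>set y. \<not> P a)"
  shows "\<exists>c. srun A1 (fst ps) c u (filter P w) (fst qt) \<and>
    srun A2 (snd ps) c [] (filter (\<lambda>a. \<not> P a) w) (snd qt)"
  using assms(1)
proof induction
  case (wrun_nil ps)
  show ?case by (auto intro: srun_nil)
next
  case (wrun_step ps x y qt u w r)
  then obtain c where IH: "srun A1 (fst qt) c u (filter P w) (fst r)"
    "srun A2 (snd qt) c [] (filter (\<lambda>a. \<not> P a) w) (snd r)" by blast
  from wrun_step.hyps(1) show ?case
  proof (cases rule: prod_edges_cases)
    case (left p q s)
    from srun_step[OF left(3), of c u "filter P w" "fst r"] IH left A1[OF left(3)]
    show ?thesis by (intro exI[of _ c]) (simp add: filter_id_conv filter_empty_conv)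
  next
    case (right p s t)
    from srun_step[OF right(3), of c "[]" "filter (\<lambda>a. \<not> P a) w" "snd r"] IH right A2[OF right(3)]
    show ?thesis by (intro exI[of _ c]) (simp add: filter_id_conv filter_empty_conv)
  next
    case (both p q s t d x1 y1 x2 y2)
    from srun_step[OF both(6), of c "[]" "filter (\<lambda>a. \<not> P a) w" "snd r"]
      srun_step[OF both(5), of c u "filter P w" "fst r"] IH both A2[OF both(6)] A1[OF both(5)]
    show ?thesis by (intro exI[of _ "d # c"]) (simp add: filter_id_conv filter_empty_conv)
  qed
qed

text \<open>The outer induction follows the first run; at each of its labelled edges an inner
  induction lets the second factor perform its silent edges until it reaches the same label.\<close>

lemma wrun_prod:
  assumes A1: "\<And>p c x y q. (p, c, x, y, q) \<in> A1 \<Longrightarrow> q \<in> Q1"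
    and A2: "\<And>p c x y q. (p, c, x, y, q) \<in> A2 \<Longrightarrow> x = [] \<and> q \<in> Q2"
    and "srun A1 p c u y q" "srun A2 s c x2 y2 t" "p \<in> Q1" "s \<in> Q2"
  shows "\<exists>w. wrun (prod_edges Q1 Q2 A1 A2) (p, s) u w (q, t)"
  using assms(3-6)
proof (induction arbitrary: s x2 y2 t)
  case (srun_nil p)
  note p = srun_nil.prems(2)
  from srun_nil.prems(1) show ?case
  proof (induction s "[] :: nat list" x2 y2 t rule: srun.induct)
    case (srun_nil s)
    show ?case by (blast intro: wrun_nil)
  next
    case (srun_step s c x y t' cs xs ys r)
    then have c: "c = None" "cs = []" by (cases c; simp)+
    with srun_step obtain w where w: "wrun (prod_edges Q1 Q2 A1 A2) (p, t') [] w (p, r)" by auto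
    have "x = []" using A2 srun_step.hyps(1) by blast
    then have "((p, s), [], y, (p, t')) \<in> prod_edges Q1 Q2 A1 A2"
      using prod_edges_right srun_step.hyps(1) c p by blast
    from wrun_step[OF this w] show ?case by auto
  qed
next
  case (srun_step p c x y q cs xs ys r)
  have q: "q \<in> Q1" using A1 srun_step.hyps(1) by blast
  show ?case
  proof (cases c)
    case None
    then have w: "\<exists>w. wrun (prod_edges Q1 Q2 A1 A2) (q, s) xs w (r, t)"
      using srun_step.IH[of s x2 y2 t] srun_step.prems q by simp
    have "((p, s), x, y, (q, s)) \<in> prod_edges Q1 Q2 A1 A2"
      using prod_edges_left srun_step.hyps(1) srun_step.prems(3) None by blast
    with w show ?thesis by (blast intro: wrun_step)
  next
    case (Some d)
    have e: "(p, Some d, x, y, q) \<in> A1" using Some srun_step.hyps(1) by simp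
    note p = srun_step.prems(2)
    have IH: "\<exists>w. wrun (prod_edges Q1 Q2 A1 A2) (q, s) xs w (r, t)"
      if "srun A2 s cs x2 y2 t" "s \<in> Q2" for s x2 y2 t
      using srun_step.IH[OF that(1) q that(2)] .
    from srun_step.prems(1) have "srun A2 s (d # cs) x2 y2 t" using Some by simp
    then have "\<exists>w. wrun (prod_edges Q1 Q2 A1 A2) (p, s) (x @ xs) w (r, t)"
    proof (induction s "d # cs" x2 y2 t rule: srun.induct)
      case (srun_step s c' x' y' t' ds xs' ys' r')
      have t': "x' = []" "t' \<in> Q2" using A2 srun_step.hyps(1) by blast+
      show ?case
      proof (cases c')
        case None
        with srun_step obtain w where w: "wrun (prod_edges Q1 Q2 A1 A2) (p, t') (x @ xs) w (r, r')" by auto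
        have "((p, s), [], y', (p, t')) \<in> prod_edges Q1 Q2 A1 A2"
          using prod_edges_right srun_step.hyps(1) t' p None by blast
        from wrun_step[OF this w] show ?thesis by auto
      next
        case (Some d')
        with srun_step.hyps have c': "c' = Some d" "ds = cs" by auto
        obtain w where w: "wrun (prod_edges Q1 Q2 A1 A2) (q, t') xs w (r, r')"
          using IH[OF _ t'(2)] srun_step.hyps(2) c' by blast
        have "((p, s), x @ x', y @ y', (q, t')) \<in> prod_edges Q1 Q2 A1 A2"
          using prod_edges_both[OF e] srun_step.hyps(1) c' by blast
        from wrun_step[OF this w] t'(1) show ?thesis by auto
      qed
    qed
    then show ?thesis .
  qed
qed

lemma trans_of_wedges:
  assumes "finite E" "finite I" "finite F"
  shows "\<exists>t. trel (dec_trans t) = {(u, v). \<exists>p\<in>I. \<exists>q\<in>F. wrun (E :: 'q::enc wedge set) p u v q}"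
proof -
  obtain es ps qs where "set es = E" "set ps = I" "set qs = F"
    using assms finite_list by metis
  then show ?thesis
    by (intro exI[of _ "wcode (ps, qs, es)"]) (simp add: trel_wcode wrel_def)
qed

text \<open>Both the composition and the tagged parallel product are instances of this.\<close>

lemma product_transducer:
  assumes f: "\<And>u v. f (u @ v) = f u @ f v" "f [] = []"
    and g: "\<And>u v. g (u @ v) = g u @ g v" "g [] = []"
    and Pf: "\<And>u a. a \<in> set (f u) \<Longrightarrow> P a" and Pg: "\<And>u a. a \<in> set (g u) \<Longrightarrow> \<not> P a"
  shows "\<exists>T. (\<forall>u w. (u, w) \<in> trel T \<longrightarrow> (\<exists>v v' c. (u, v) \<in> trel T1 \<and> (c, v') \<in> trel T2 \<and>
      c = (if i then u else v) \<and> filter P w = f v \<and> filter (\<lambda>a. \<not> P a) w = g v')) \<and>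
    (\<forall>u v v'. (u, v) \<in> trel T1 \<longrightarrow> (if i then u else v, v') \<in> trel T2 \<longrightarrow> (\<exists>w. (u, w) \<in> trel T))"
proof -
  let ?A1 = "relabel i True f T1" and ?A2 = "relabel True False g T2"
  let ?E = "prod_edges (states T1) (states T2) ?A1 ?A2"
  have "finite ?A1" "finite ?A2" by (simp_all add: relabel_def)
  then have "finite ?E" by (intro finite_prod_edges finite_states)
  from trans_of_wedges[OF this, of "set (t_init T1) \<times> set (t_init T2)" "set (t_fin T1) \<times> set (t_fin T2)"]
  obtain T where T: "trel T = {(u, w). \<exists>ps\<in>set (t_init T1) \<times> set (t_init T2).
      \<exists>qt\<in>set (t_fin T1) \<times> set (t_fin T2). wrun ?E ps u w qt}" by auto
  have A1: "\<forall>a\<in>set y. P a" if "(p, c, x, y, q) \<in> ?A1" for p c x y q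
    using that Pf by (auto simp: relabel_def)
  have A2: "x = [] \<and> (\<forall>a\<in>set y. \<not> P a)" if "(p, c, x, y, q) \<in> ?A2" for p c x y q
    using that Pg by (auto simp: relabel_def)
  have "\<exists>v v' c. (u, v) \<in> trel T1 \<and> (c, v') \<in> trel T2 \<and>
      c = (if i then u else v) \<and> filter P w = f v \<and> filter (\<lambda>a. \<not> P a) w = g v'"
    if uw: "(u, w) \<in> trel T" for u w
  proof -
    obtain p s q t where pq: "p \<in> set (t_init T1)" "s \<in> set (t_init T2)" "q \<in> set (t_fin T1)"
      "t \<in> set (t_fin T2)" "wrun ?E (p, s) u w (q, t)" using uw unfolding T by auto
    have "\<exists>c. srun ?A1 (fst (p, s)) c u (filter P w) (fst (q, t)) \<and>
        srun ?A2 (snd (p, s)) c [] (filter (\<lambda>a. \<not> P a) w) (snd (q, t))"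
      by (rule wrun_prod_imp[OF pq(5)]) (erule A1, erule A2)
    then obtain c where
      "srun ?A1 p c u (filter P w) q" "srun ?A2 s c [] (filter (\<lambda>a. \<not> P a) w) t" by auto
    then obtain v v' where "trun T1 p u v q" "c = (if i then u else v)" "filter P w = f v"
      "trun T2 s c v' t" "filter (\<lambda>a. \<not> P a) w = g v'"
      unfolding srun_relabel[OF f] srun_relabel[OF g] by auto
    moreover from this pq have "(u, v) \<in> trel T1" "(c, v') \<in> trel T2"
      unfolding trel_def by blast+
    ultimately show ?thesis by blast
  qed
  moreover have "\<exists>w. (u, w) \<in> trel T"
    if v: "(u, v) \<in> trel T1" "(if i then u else v, v') \<in> trel T2" for u v v'
  proof -
    obtain p q where pq: "p \<in> set (t_init T1)" "q \<in> set (t_fin T1)" "trun T1 p u v q"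
      using v(1) by (auto simp: trel_def)
    obtain s t where st: "s \<in> set (t_init T2)" "t \<in> set (t_fin T2)" "trun T2 s (if i then u else v) v' t"
      using v(2) by (auto simp: trel_def)
    have "srun ?A1 p (if i then u else v) u (f v) q" using pq unfolding srun_relabel[OF f] by auto
    moreover have "srun ?A2 s (if i then u else v) [] (g v') t"
      using st unfolding srun_relabel[OF g] by auto
    moreover have "p \<in> states T1" "s \<in> states T2" using pq st by (auto simp: states_def)
    ultimately obtain w where "wrun ?E (p, s) u w (q, t)"
      using wrun_prod[of ?A1 "states T1" ?A2 "states T2"] relabel_target A2 by metis
    moreover have "(p, s) \<in> set (t_init T1) \<times> set (t_init T2)" "(q, t) \<in> set (t_fin T1) \<times> set (t_fin T2)"
      using pq st by simp_all
    ultimately have "(u, w) \<in> trel T" unfolding T by blast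
    then show ?thesis by blast
  qed
  ultimately show ?thesis by (intro exI[of _ T]) simp
qed

subsection \<open>Parameterized WQOs as products of subword orderings\<close>

definition proj_le :: "nat list list \<Rightarrow> nat list \<Rightarrow> nat list \<Rightarrow> bool" where
  "proj_le C z z' \<longleftrightarrow> (\<forall>A\<in>set C. subseq (proj A z) (proj A z'))"

lemma proj_le_refl: "proj_le C z z"
  by (simp add: proj_le_def)

lemma proj_le_trans: "proj_le C x y \<Longrightarrow> proj_le C y z \<Longrightarrow> proj_le C x z"
  unfolding proj_le_def by (meson subseq_order.trans)

lemma subseq_proj: "subseq x y \<Longrightarrow> subseq (proj A x) (proj A y)"
  unfolding proj_def by (rule subseq_filter)

lemma subseq_proj_le: "subseq x y \<Longrightarrow> proj_le C x y"
  by (simp add: proj_le_def subseq_proj)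

text \<open>Instead of functionality of \<open>T\<close>, \<open>ordered\<close> requires that the
  comparison be correct for any choice of outputs; the shuffles produced by products satisfy this.
  \<open>C\<close> lists the sets of letters, one for each tag, to which outputs are
  projected.\<close>

locale represented =
  fixes \<Sigma> :: "nat set" and r :: "nat list \<Rightarrow> nat list \<Rightarrow> bool" and T :: trans
    and g :: "nat list" and C :: "nat list list"
  assumes finite_alphabet: "finite \<Sigma>"
    and total: "u \<in> lists \<Sigma> \<Longrightarrow> \<exists>z. (u, z) \<in> trel T"
    and over: "(u, z) \<in> trel T \<Longrightarrow> z \<in> lists (set g)"
    and ordered: "u \<in> lists \<Sigma> \<Longrightarrow> v \<in> lists \<Sigma> \<Longrightarrow> (u, z) \<in> trel T \<Longrightarrow> (v, z') \<in> trel T \<Longrightarrow>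
      r u v \<longleftrightarrow> proj_le C z z'"
    and words: "r u v \<Longrightarrow> u \<in> lists \<Sigma> \<and> v \<in> lists \<Sigma>"

lemma represented_subword:
  assumes "finite \<Sigma>"
  shows "\<exists>T g C. represented \<Sigma> (\<lambda>u v. u \<in> lists \<Sigma> \<and> v \<in> lists \<Sigma> \<and> subseq u v) T g C"
proof -
  obtain g where g: "set g = \<Sigma>" using assms finite_list by blast
  have "foldl tstep [] u = []" for u by (induction u) (auto simp: tstep_def)
  \<comment> \<open>A restriction with no tests at all is the identity on \<Sigma>-words.\<close>
  then have T: "trel (dec_trans (wcode (restrict_tests g [] [[]]))) = {(u, v). u \<in> lists \<Sigma> \<and> v = u}"
    by (simp add: trel_wcode wrel_restrict_tests g)
  have proj: "proj g u = u" if "u \<in> lists \<Sigma>" for u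
    using that g by (auto simp: proj_def filter_id_conv)
  have "represented \<Sigma> (\<lambda>u v. u \<in> lists \<Sigma> \<and> v \<in> lists \<Sigma> \<and> subseq u v)
      (dec_trans (wcode (restrict_tests g [] [[]]))) g [g]"
    by standard (auto simp: T assms proj_le_def proj g simp del: in_lists_conv_set)
  then show ?thesis by blast
qed

lemma represented_trans:
  assumes "represented \<Gamma> r T2 g C" "finite \<Sigma>" "trans_over \<Sigma> \<Gamma> T1" "functional_on \<Sigma> T1"
  shows "\<exists>T g C. represented \<Sigma> (\<lambda>u v. u \<in> lists \<Sigma> \<and> v \<in> lists \<Sigma> \<and> r (tfun T1 u) (tfun T1 v)) T g C"
proof -
  interpret represented \<Gamma> r T2 g C by fact
  \<comment> \<open>The first factor writes nothing and hands its output over as synchronisation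
    word, so the product degenerates to composition; accordingly no letter satisfies the
    predicate.\<close>
  have "\<exists>T. (\<forall>u w. (u, w) \<in> trel T \<longrightarrow> (\<exists>v v' c. (u, v) \<in> trel T1 \<and> (c, v') \<in> trel T2 \<and>
      c = (if False then u else v) \<and> filter (\<lambda>_. False) w = [] \<and> filter (\<lambda>a. \<not> False) w = v')) \<and>
    (\<forall>u v v'. (u, v) \<in> trel T1 \<longrightarrow> (if False then u else v, v') \<in> trel T2 \<longrightarrow> (\<exists>w. (u, w) \<in> trel T))"
    by (rule product_transducer) auto
  then obtain T where T: "\<forall>u w. (u, w) \<in> trel T \<longrightarrow> (\<exists>v. (u, v) \<in> trel T1 \<and> (v, w) \<in> trel T2)"
    "\<forall>u v v'. (u, v) \<in> trel T1 \<longrightarrow> (v, v') \<in> trel T2 \<longrightarrow> (\<exists>w. (u, w) \<in> trel T)"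
    by (simp only: if_False not_False_eq_True filter_True filter_False simp_thms) auto
  then have T1: "\<exists>v. (u, v) \<in> trel T1 \<and> (v, w) \<in> trel T2" if "(u, w) \<in> trel T" for u w
    using that by blast
  from T have T2: "\<exists>w. (u, w) \<in> trel T" if "(u, v) \<in> trel T1" "(v, w) \<in> trel T2" for u v w
    using that by blast
  have tfun: "(u, tfun T1 u) \<in> trel T1" "\<And>v. (u, v) \<in> trel T1 \<Longrightarrow> v = tfun T1 u" if "u \<in> lists \<Sigma>" for u
    using assms(4) that theI'[of "\<lambda>v. (u, v) \<in> trel T1"] unfolding functional_on_def tfun_def by blast+
  have v: "v \<in> lists \<Gamma>" if "(u, v) \<in> trel T1" for u v
    using that trun_out_over[OF _ assms(3)] unfolding trel_def by blast
  have "represented \<Sigma> (\<lambda>u v. u \<in> lists \<Sigma> \<and> v \<in> lists \<Sigma> \<and> r (tfun T1 u) (tfun T1 v)) T g C"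
  proof
    fix u assume "u \<in> lists \<Sigma>"
    then show "\<exists>z. (u, z) \<in> trel T" using tfun T2 v total by meson
  next
    fix u z assume "(u, z) \<in> trel T"
    then show "z \<in> lists (set g)" using T1 over by blast
  next
    fix u v z z' assume uv: "u \<in> lists \<Sigma>" "v \<in> lists \<Sigma>" "(u, z) \<in> trel T" "(v, z') \<in> trel T"
    then have "(tfun T1 u, z) \<in> trel T2" "(tfun T1 v, z') \<in> trel T2" using T1 tfun by metis+
    moreover have "tfun T1 u \<in> lists \<Gamma>" "tfun T1 v \<in> lists \<Gamma>" using v tfun uv by blast+
    ultimately show "u \<in> lists \<Sigma> \<and> v \<in> lists \<Sigma> \<and> r (tfun T1 u) (tfun T1 v) \<longleftrightarrow> proj_le C z z'"
      using ordered uv by blast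
  qed (use assms(2) in auto)
  then show ?thesis by blast
qed

lemma subseq_map_inj: "inj f \<Longrightarrow> subseq (map f x) (map f y) \<longleftrightarrow> subseq x y"
  using subseq_map[of "map f x" "map f y" "inv f"] subseq_map[of x y f] by (auto simp: comp_def)

lemma represented_conj:
  assumes "represented \<Sigma> r1 T1 g1 C1" "represented \<Sigma> r2 T2 g2 C2"
  shows "\<exists>T g C. represented \<Sigma> (\<lambda>u v. r1 u v \<and> r2 u v) T g C"
proof -
  interpret a: represented \<Sigma> r1 T1 g1 C1 by fact
  interpret b: represented \<Sigma> r2 T2 g2 C2 by fact
  \<comment> \<open>Even letters carry the first output, odd letters the second.\<close>
  let ?f = "map (\<lambda>n. 2 * n) :: nat list \<Rightarrow> _" and ?h = "map (\<lambda>n. 2 * n + 1) :: nat list \<Rightarrow> _"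
  have "\<exists>T. (\<forall>u w. (u, w) \<in> trel T \<longrightarrow> (\<exists>v v' c. (u, v) \<in> trel T1 \<and> (c, v') \<in> trel T2 \<and>
      c = (if True then u else v) \<and> filter even w = ?f v \<and> filter (\<lambda>a. \<not> even a) w = ?h v')) \<and>
    (\<forall>u v v'. (u, v) \<in> trel T1 \<longrightarrow> (if True then u else v, v') \<in> trel T2 \<longrightarrow> (\<exists>w. (u, w) \<in> trel T))"
    by (rule product_transducer) auto
  then obtain T where T: "\<forall>u w. (u, w) \<in> trel T \<longrightarrow> (\<exists>v v' c. (u, v) \<in> trel T1 \<and> (c, v') \<in> trel T2 \<and>
      c = u \<and> filter even w = ?f v \<and> filter (\<lambda>a. \<not> even a) w = ?h v')"
    "\<forall>u v v'. (u, v) \<in> trel T1 \<longrightarrow> (u, v') \<in> trel T2 \<longrightarrow> (\<exists>w. (u, w) \<in> trel T)"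
    unfolding if_True by blast
  from T(1) have T1: "\<exists>v v'. (u, v) \<in> trel T1 \<and> (u, v') \<in> trel T2 \<and>
      filter even w = ?f v \<and> filter (\<lambda>a. \<not> even a) w = ?h v'" if "(u, w) \<in> trel T" for u w
    using that by blast
  from T(2) have T2: "\<exists>w. (u, w) \<in> trel T" if "(u, v) \<in> trel T1" "(u, v') \<in> trel T2" for u v v'
    using that by blast
  let ?C = "map ?f C1 @ map ?h C2"
  have p1: "proj (?f A) w = ?f (proj A v)" if "filter even w = ?f v" for A w v
  proof -
    have "proj (?f A) w = filter (\<lambda>a. a \<in> set (?f A)) (filter even w)"
      unfolding proj_def filter_filter by (rule filter_cong) auto
    also have "\<dots> = ?f (proj A v)" unfolding that proj_def filter_map by (simp add: comp_def image_iff)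
    finally show ?thesis .
  qed
  have p2: "proj (?h A) w = ?h (proj A v)" if "filter (\<lambda>a. \<not> even a) w = ?h v" for A w v
  proof -
    have "proj (?h A) w = filter (\<lambda>a. a \<in> set (?h A)) (filter (\<lambda>a. \<not> even a) w)"
      unfolding proj_def filter_filter by (rule filter_cong) auto
    also have "\<dots> = ?h (proj A v)" unfolding that proj_def filter_map by (simp add: comp_def image_iff)
    finally show ?thesis .
  qed
  have inj: "inj (\<lambda>n::nat. 2 * n)" "inj (\<lambda>n::nat. 2 * n + 1)" by (auto simp: inj_def)
  have "represented \<Sigma> (\<lambda>u v. r1 u v \<and> r2 u v) T (?f g1 @ ?h g2) ?C"
  proof
    show "finite \<Sigma>" by (rule a.finite_alphabet)
  next
    fix u assume "u \<in> lists \<Sigma>"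
    then show "\<exists>z. (u, z) \<in> trel T" using a.total b.total T2 by blast
  next
    fix u z assume "(u, z) \<in> trel T"
    then obtain v v' where v: "(u, v) \<in> trel T1" "(u, v') \<in> trel T2"
      "filter even z = ?f v" "filter (\<lambda>a. \<not> even a) z = ?h v'" using T1 by blast
    have "x \<in> set (?f g1 @ ?h g2)" if "x \<in> set z" for x
    proof (cases "even x")
      case True
      with that have "x \<in> set (filter even z)" by simp
      then have "x \<in> (\<lambda>n. 2 * n) ` set v" unfolding v(3) by simp
      then show ?thesis using a.over[OF v(1)] by auto
    next
      case False
      with that have "x \<in> set (filter (\<lambda>a. \<not> even a) z)" by simp
      then have "x \<in> (\<lambda>n. 2 * n + 1) ` set v'" unfolding v(4) by simp
      then show ?thesis using b.over[OF v(2)] by auto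
    qed
    then show "z \<in> lists (set (?f g1 @ ?h g2))" by blast
  next
    fix u v z z' assume uv: "u \<in> lists \<Sigma>" "v \<in> lists \<Sigma>" "(u, z) \<in> trel T" "(v, z') \<in> trel T"
    obtain x y where x: "(u, x) \<in> trel T1" "(u, y) \<in> trel T2"
      "filter even z = ?f x" "filter (\<lambda>a. \<not> even a) z = ?h y" using T1[OF uv(3)] by blast
    obtain x' y' where x': "(v, x') \<in> trel T1" "(v, y') \<in> trel T2"
      "filter even z' = ?f x'" "filter (\<lambda>a. \<not> even a) z' = ?h y'" using T1[OF uv(4)] by blast
    have "proj_le ?C z z' \<longleftrightarrow> proj_le C1 x x' \<and> proj_le C2 y y'"
      unfolding proj_le_def set_append ball_Un set_map ball_simps(9)
        p1[OF x(3)] p1[OF x'(3)] p2[OF x(4)] p2[OF x'(4)]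
      by (simp only: subseq_map_inj inj)
    then show "r1 u v \<and> r2 u v \<longleftrightarrow> proj_le ?C z z'"
      using a.ordered[OF uv(1,2) x(1) x'(1)] b.ordered[OF uv(1,2) x(2) x'(2)] by blast
  qed (use a.words in blast)
  then show ?thesis by blast
qed

theorem pwqo_represented: "pwqo \<Sigma> r \<Longrightarrow> \<exists>T g C. represented \<Sigma> r T g C"
proof (induction rule: pwqo.induct)
  case (pwqo_subword \<Sigma>)
  then show ?case by (rule represented_subword)
next
  case (pwqo_trans \<Gamma> r \<Sigma> T)
  then show ?case using represented_trans by blast
next
  case (pwqo_conj \<Sigma> r1 r2)
  then show ?case using represented_conj by blast
qed

subsection \<open>Piecewise testable languages\<close>

lemma ptl_empty: "ptl \<Sigma> r {}"
proof -
  have "ptl \<Sigma> r (uclo r {[]})" by (rule ptl_up) simp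
  from ptl_inter[OF this ptl_compl[OF this]] show ?thesis by simp
qed

context represented
begin

lemma r_refl: "u \<in> lists \<Sigma> \<Longrightarrow> r u u"
  using total[of u] ordered[of u u] proj_le_refl by blast

lemma r_good:
  assumes "\<And>i. f i \<in> lists \<Sigma>"
  shows "\<exists>i j. i < j \<and> r (f i) (f (j::nat))"
proof -
  obtain z where z: "\<And>i. (f i, z i) \<in> trel T" using total[OF assms] by metis
  obtain h :: "nat \<Rightarrow> nat" where h: "strict_mono h" "\<And>i j. i \<le> j \<Longrightarrow> subseq (z (h i)) (z (h j))"
    using wqo_subseqD[OF higman[OF finite_set[of g]], of z] over[OF z] by metis
  have "proj_le C (z (h 0)) (z (h 1))" using h(2)[of 0 1] subseq_proj_le by simp
  then have "r (f (h 0)) (f (h 1))" using ordered[OF assms assms z z] by blast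
  moreover have "h 0 < h 1" using h(1) by (simp add: strict_mono_less)
  ultimately show ?thesis by blast
qed

lemma ptl_full: "ptl \<Sigma> r (lists \<Sigma>)"
  using ptl_compl[OF ptl_empty] by simp

text \<open>An upward closed set has a finite basis, since otherwise dependent choice yields a
  sequence contradicting \<open>r_good\<close>; it is thus a finite union of generators.\<close>

lemma ptl_upclosed:
  assumes X: "X \<subseteq> lists \<Sigma>" and up: "\<And>x y. x \<in> X \<Longrightarrow> r x y \<Longrightarrow> y \<in> X"
  shows "ptl \<Sigma> r X"
proof -
  have ptl: "ptl \<Sigma> r (uclo r B)" if "finite B" "B \<subseteq> X" for B
    using that
  proof (induction B rule: finite_induct)
    case empty
    show ?case using ptl_empty by (simp add: uclo_def)
  next
    case (insert b B)
    then have "ptl \<Sigma> r (uclo r {b} \<union> uclo r B)" using X by (intro ptl_union ptl_up) auto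
    moreover have "uclo r {b} \<union> uclo r B = uclo r (insert b B)" by (auto simp: uclo_def)
    ultimately show ?case by simp
  qed
  have "\<exists>B\<subseteq>X. finite B \<and> X \<subseteq> uclo r B"
  proof (rule ccontr)
    assume no: "\<not> ?thesis"
    have "\<exists>f. \<forall>n::nat. f n \<in> X \<and> (\<forall>i<n. \<not> r (f i) (f n))"
    proof (rule dependent_wellorder_choice)
      fix n and f :: "nat \<Rightarrow> nat list"
      assume f: "\<And>m. m < n \<Longrightarrow> f m \<in> X \<and> (\<forall>i<m. \<not> r (f i) (f m))"
      then have "f ` {..<n} \<subseteq> X" by auto
      then obtain x where "x \<in> X" "x \<notin> uclo r (f ` {..<n})" using no by blast
      then show "\<exists>x. x \<in> X \<and> (\<forall>i<n. \<not> r (f i) x)" by (auto simp: uclo_def)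
    qed auto
    then obtain f where f: "\<And>n. f n \<in> X" "\<And>i n. i < n \<Longrightarrow> \<not> r (f i) (f (n::nat))" by blast
    with r_good[of f] X show False by blast
  qed
  then obtain B where "B \<subseteq> X" "finite B" "X \<subseteq> uclo r B" by blast
  moreover from this have "uclo r B \<subseteq> X" using up by (auto simp: uclo_def)
  ultimately show ?thesis using ptl by (metis subset_antisym)
qed

definition test_set :: "ideal \<Rightarrow> nat list \<Rightarrow> nat list set" where
  "test_set P A = {x \<in> lists \<Sigma>. \<forall>z. (x, z) \<in> trel T \<longrightarrow> imem P (proj A z)}"

text \<open>By reflexivity of \<open>r\<close>, any two outputs of one word are equivalent under
  \<open>proj_le\<close>, and ideals cannot separate equivalent projections.\<close>

lemma test_invariant:
  assumes "x \<in> lists \<Sigma>" "(x, z) \<in> trel T" "(x, z') \<in> trel T" "A \<in> set C"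
  shows "imem P (proj A z) \<longleftrightarrow> imem P (proj A z')"
proof -
  have "proj_le C z z'" "proj_le C z' z" using ordered[of x x] r_refl assms by blast+
  then show ?thesis using assms(4) imem_subseq unfolding proj_le_def by blast
qed

lemma test_set_iff: "x \<in> lists \<Sigma> \<Longrightarrow> (x, z) \<in> trel T \<Longrightarrow> A \<in> set C \<Longrightarrow>
    x \<in> test_set P A \<longleftrightarrow> imem P (proj A z)"
  unfolding test_set_def using test_invariant by blast

text \<open>Ideals are closed under subwords, so failing the test persists upwards and
  \<open>ptl_upclosed\<close> applies to the complement.\<close>

lemma ptl_test_set: assumes "A \<in> set C" shows "ptl \<Sigma> r (test_set P A)"
proof -
  have "ptl \<Sigma> r (lists \<Sigma> - test_set P A)"
  proof (rule ptl_upclosed)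
    fix x y assume x: "x \<in> lists \<Sigma> - test_set P A" and xy: "r x y"
    have xy': "x \<in> lists \<Sigma>" "y \<in> lists \<Sigma>" using words xy by blast+
    obtain z z' where z: "(x, z) \<in> trel T" "(y, z') \<in> trel T" using total xy' by meson
    have "proj_le C z z'" using ordered xy xy' z by blast
    then have "subseq (proj A z) (proj A z')" using assms by (simp add: proj_le_def)
    then show "y \<in> lists \<Sigma> - test_set P A"
      using x xy' z test_set_iff[OF _ _ assms] imem_subseq by blast
  qed blast
  from ptl_compl[OF this] show ?thesis by (simp add: double_diff test_set_def)
qed

text \<open>Sets that only depend on the membership pattern in finitely many piecewise testable sets
  are Boolean combinations of them. The induction removes one set \<open>V\<close> by treating the
  parts inside and outside \<open>V\<close> separately.\<close>

lemma ptl_invariant: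
  assumes "\<And>U. U \<in> set Us \<Longrightarrow> ptl \<Sigma> r U" "X \<subseteq> lists \<Sigma>"
    and "\<And>x y. x \<in> X \<Longrightarrow> y \<in> lists \<Sigma> \<Longrightarrow> (\<And>U. U \<in> set Us \<Longrightarrow> x \<in> U \<longleftrightarrow> y \<in> U) \<Longrightarrow> y \<in> X"
  shows "ptl \<Sigma> r X"
  using assms
proof (induction Us arbitrary: X)
  case Nil
  then have "X = {} \<or> X = lists \<Sigma>" by auto
  then show ?case using ptl_empty ptl_full by auto
next
  case (Cons V Us)
  \<comment> \<open>\<open>E Y\<close> is the saturation of \<open>Y\<close> for the remaining sets,
    to which the induction hypothesis applies; intersecting with \<open>V\<close> or its complement
    restores the dependence on \<open>V\<close>.\<close>
  define E where "E Y = {x \<in> lists \<Sigma>. \<exists>y\<in>Y. \<forall>U\<in>set Us. y \<in> U \<longleftrightarrow> x \<in> U}" for Y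
  have E: "ptl \<Sigma> r (E Y)" for Y
    by (rule Cons.IH) (use Cons.prems(1) in \<open>auto simp: E_def\<close>)
  have "X = (E (X \<inter> V) \<inter> V) \<union> (E (X - V) \<inter> (lists \<Sigma> - V))"
  proof (intro subset_antisym subsetI)
    fix x assume "x \<in> X"
    then show "x \<in> (E (X \<inter> V) \<inter> V) \<union> (E (X - V) \<inter> (lists \<Sigma> - V))"
      using Cons.prems(2) by (cases "x \<in> V") (auto simp: E_def)
  next
    fix x assume "x \<in> (E (X \<inter> V) \<inter> V) \<union> (E (X - V) \<inter> (lists \<Sigma> - V))"
    then obtain y where "y \<in> X" "x \<in> lists \<Sigma>" "y \<in> V \<longleftrightarrow> x \<in> V" "\<forall>U\<in>set Us. y \<in> U \<longleftrightarrow> x \<in> U"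
      by (auto simp: E_def)
    then show "x \<in> X" using Cons.prems(3)[of y x] by auto
  qed
  moreover have "ptl \<Sigma> r ((E (X \<inter> V) \<inter> V) \<union> (E (X - V) \<inter> (lists \<Sigma> - V)))"
    using Cons.prems(1) by (intro ptl_union ptl_inter ptl_compl E) auto
  ultimately show ?case by simp
qed

end

definition same_tests :: "nat list list \<Rightarrow> ideal list \<Rightarrow> nat list \<Rightarrow> nat list \<Rightarrow> bool" where
  "same_tests C Ps z z' \<longleftrightarrow> (\<forall>P\<in>set Ps. \<forall>A\<in>set C. imem P (proj A z) \<longleftrightarrow> imem P (proj A z'))"

context represented
begin

definition decided :: "ideal list \<Rightarrow> nat list set \<Rightarrow> bool" where
  "decided Ps R \<longleftrightarrow> (\<forall>x\<in>lists \<Sigma>. \<forall>y\<in>lists \<Sigma>. \<forall>z z'. (x, z) \<in> trel T \<longrightarrow> (y, z') \<in> trel T \<longrightarrow>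
    same_tests C Ps z z' \<longrightarrow> (x \<in> R \<longleftrightarrow> y \<in> R))"

lemma decidedI: "(\<And>x y z z'. x \<in> lists \<Sigma> \<Longrightarrow> y \<in> lists \<Sigma> \<Longrightarrow> (x, z) \<in> trel T \<Longrightarrow> (y, z') \<in> trel T \<Longrightarrow>
    same_tests C Ps z z' \<Longrightarrow> x \<in> R \<longleftrightarrow> y \<in> R) \<Longrightarrow> decided Ps R"
  unfolding decided_def by simp

lemma decidedD: "decided Ps R \<Longrightarrow> x \<in> lists \<Sigma> \<Longrightarrow> y \<in> lists \<Sigma> \<Longrightarrow> (x, z) \<in> trel T \<Longrightarrow>
    (y, z') \<in> trel T \<Longrightarrow> same_tests C Ps z z' \<Longrightarrow> x \<in> R \<longleftrightarrow> y \<in> R"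
  unfolding decided_def by simp

lemma same_tests_append:
  "same_tests C (Ps @ Qs) z z' \<longleftrightarrow> same_tests C Ps z z' \<and> same_tests C Qs z z'"
  by (auto simp: same_tests_def)

text \<open>Not being above \<open>w\<close> means that some projection of the output avoids that of
  \<open>w\<close>. The avoiding words over \<open>g\<close> form a downset, so finitely many ideals
  detect this; Boolean operations just merge the lists of ideals.\<close>

lemma ptl_same_tests:
  assumes "ptl \<Sigma> r R"
  shows "\<exists>Ps. decided Ps R"
  using assms
proof induction
  case (ptl_up w)
  obtain v where v: "(w, v) \<in> trel T" using total ptl_up by blast
  have "\<exists>Ps. {x \<in> lists (set g). \<not> subseq (proj A v) x} = {x. \<exists>P\<in>set Ps. imem P x}" for A
  proof (rule downset_ideals[OF finite_set])
    show "downset {x \<in> lists (set g). \<not> subseq (proj A v) x}" unfolding downset_def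
    proof (intro ballI allI impI)
      fix x y assume x: "x \<in> {x \<in> lists (set g). \<not> subseq (proj A v) x}" "subseq y x"
      then have "set y \<subseteq> set x" by (auto dest: subseq_order.trans simp flip: subseq_singleton_left)
      then show "y \<in> {x \<in> lists (set g). \<not> subseq (proj A v) x}" using x subseq_order.trans by auto
    qed
  qed blast
  then have "\<forall>A. \<exists>Ps. {x \<in> lists (set g). \<not> subseq (proj A v) x} = {x. \<exists>P\<in>set Ps. imem P x}"
    by (rule allI)
  from choice[OF this] obtain F where
    F: "\<And>A. {x \<in> lists (set g). \<not> subseq (proj A v) x} = {x. \<exists>P\<in>set (F A). imem P x}"
    by blast
  have mem: "x \<in> uclo r {w} \<longleftrightarrow> (\<forall>A\<in>set C. \<forall>P\<in>set (F A). \<not> imem P (proj A z))"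
    if x: "x \<in> lists \<Sigma>" "(x, z) \<in> trel T" for x z
  proof -
    have "proj A z \<in> lists (set g)" for A using over[OF x(2)] by (auto simp: proj_def)
    then have "subseq (proj A v) (proj A z) \<longleftrightarrow> (\<forall>P\<in>set (F A). \<not> imem P (proj A z))" for A
      using F[of A] by blast
    then show ?thesis using ordered[OF ptl_up x(1) v x(2)] by (simp add: uclo_def proj_le_def)
  qed
  have "decided (concat (map F C)) (uclo r {w})"
  proof (rule decidedI)
    fix x y z z' assume xy: "x \<in> lists \<Sigma>" "y \<in> lists \<Sigma>" "(x, z) \<in> trel T" "(y, z') \<in> trel T"
      and same: "same_tests C (concat (map F C)) z z'"
    have "imem P (proj A z) \<longleftrightarrow> imem P (proj A z')" if "A \<in> set C" "P \<in> set (F A)" for A P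
      using same that unfolding same_tests_def by auto
    then show "x \<in> uclo r {w} \<longleftrightarrow> y \<in> uclo r {w}"
      unfolding mem[OF xy(1,3)] mem[OF xy(2,4)] by simp
  qed
  then show ?case by blast
next
  case (ptl_compl R)
  then obtain Ps where Ps: "decided Ps R" by blast
  have "decided Ps (lists \<Sigma> - R)" by (rule decidedI) (use decidedD[OF Ps] in simp)
  then show ?case by blast
next
  case (ptl_inter R1 R2)
  then obtain Ps Qs where P: "decided Ps R1" and Q: "decided Qs R2" by blast
  have "decided (Ps @ Qs) (R1 \<inter> R2)"
    by (rule decidedI) (use decidedD[OF P] decidedD[OF Q] in \<open>simp add: same_tests_append\<close>)
  then show ?case by blast
next
  case (ptl_union R1 R2)
  then obtain Ps Qs where P: "decided Ps R1" and Q: "decided Qs R2" by blast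
  have "decided (Ps @ Qs) (R1 \<union> R2)"
    by (rule decidedI) (use decidedD[OF P] decidedD[OF Q] in \<open>simp add: same_tests_append\<close>)
  then show ?case by blast
qed

text \<open>The right side speaks about outputs only and can be evaluated on the transduced
  languages. \<open>ptl_same_tests\<close> gives one direction and \<open>ptl_invariant\<close> the
  other.\<close>

theorem separable_iff:
  assumes K: "K \<subseteq> lists \<Sigma>" and L: "L \<subseteq> lists \<Sigma>"
  shows "(\<exists>R. ptl \<Sigma> r R \<and> K \<subseteq> R \<and> L \<inter> R = {}) \<longleftrightarrow>
    (\<exists>Ps. \<forall>z\<in>trel T `` K. \<forall>z'\<in>trel T `` L. \<not> same_tests C Ps z z')"
proof
  assume "\<exists>R. ptl \<Sigma> r R \<and> K \<subseteq> R \<and> L \<inter> R = {}"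
  then obtain R where R: "ptl \<Sigma> r R" "K \<subseteq> R" "L \<inter> R = {}" by blast
  obtain Ps where Ps: "decided Ps R" using ptl_same_tests[OF R(1)] by blast
  have "\<not> same_tests C Ps z z'" if zz': "z \<in> trel T `` K" "z' \<in> trel T `` L" for z z'
  proof
    assume s: "same_tests C Ps z z'"
    obtain x y where "x \<in> K" "y \<in> L" "(x, z) \<in> trel T" "(y, z') \<in> trel T" using zz' by blast
    then show False using decidedD[OF Ps, of x y z z'] s K L R by blast
  qed
  then show "\<exists>Ps. \<forall>z\<in>trel T `` K. \<forall>z'\<in>trel T `` L. \<not> same_tests C Ps z z'" by blast
next
  assume "\<exists>Ps. \<forall>z\<in>trel T `` K. \<forall>z'\<in>trel T `` L. \<not> same_tests C Ps z z'"
  then obtain Ps where Ps: "\<And>z z'. z \<in> trel T `` K \<Longrightarrow> z' \<in> trel T `` L \<Longrightarrow> \<not> same_tests C Ps z z'" by blast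
  define Us where "Us = concat (map (\<lambda>P. map (\<lambda>A. test_set P A) C) Ps)"
  have Us: "(\<forall>U\<in>set Us. x \<in> U \<longleftrightarrow> y \<in> U) \<longleftrightarrow> same_tests C Ps z z'"
    if "x \<in> lists \<Sigma>" "y \<in> lists \<Sigma>" "(x, z) \<in> trel T" "(y, z') \<in> trel T" for x y z z'
    using test_set_iff[OF that(1,3)] test_set_iff[OF that(2,4)]
    by (simp add: Us_def same_tests_def)
  \<comment> \<open>The least candidate: the saturation of \<open>K\<close> under equality of all
    test results.\<close>
  define R where "R = {y \<in> lists \<Sigma>. \<exists>x\<in>K. \<forall>U\<in>set Us. x \<in> U \<longleftrightarrow> y \<in> U}"
  have "ptl \<Sigma> r R"
  proof (rule ptl_invariant[of Us])
    fix U assume "U \<in> set Us"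
    then show "ptl \<Sigma> r U" using ptl_test_set by (auto simp: Us_def)
  qed (auto simp: R_def)
  moreover have "K \<subseteq> R" using K by (auto simp: R_def)
  moreover have "y \<notin> R" if y: "y \<in> L" for y
  proof
    assume "y \<in> R"
    then obtain x where x: "x \<in> K" "\<forall>U\<in>set Us. x \<in> U \<longleftrightarrow> y \<in> U" by (auto simp: R_def)
    have xy: "x \<in> lists \<Sigma>" "y \<in> lists \<Sigma>" using x y K L by blast+
    obtain z z' where "(x, z) \<in> trel T" "(y, z') \<in> trel T" using total xy by meson
    then show False using Us[OF xy] x y Ps[of z z'] by blast
  qed
  ultimately show "\<exists>R. ptl \<Sigma> r R \<and> K \<subseteq> R \<and> L \<inter> R = {}" by blast
qed

end

subsection \<open>Adherent ideals and inseparability\<close>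

text \<open>The ideal of the product ordering generated by the chain \<open>expn P\<close>; it
  contains the word ideal \<open>P\<close> and may be larger, as letters of different tags are not
  ordered relative to each other.\<close>

definition in_proj_ideal :: "nat list list \<Rightarrow> ideal \<Rightarrow> nat list \<Rightarrow> bool" where
  "in_proj_ideal C P z \<longleftrightarrow> (\<forall>A\<in>set C. imem P (proj A z))"

text \<open>As \<open>expn P\<close> is cofinal in \<open>P\<close>, this says that the ideal
  \<open>P\<close> is included in the subword closure of \<open>M\<close>.\<close>

definition dense :: "nat list set \<Rightarrow> ideal \<Rightarrow> bool" where
  "dense M P \<longleftrightarrow> (\<forall>n. \<exists>z\<in>M. subseq (expn P n) z)"

lemma in_proj_ideal_leC: "proj_le C z z' \<Longrightarrow> in_proj_ideal C P z' \<Longrightarrow> in_proj_ideal C P z"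
  unfolding in_proj_ideal_def proj_le_def using imem_subseq by blast

lemma imem_in_proj_ideal: "imem P z \<Longrightarrow> in_proj_ideal C P z"
  unfolding in_proj_ideal_def proj_def using imem_subseq subseq_filter_left by blast

text \<open>The index \<open>length z\<close> bounds the lengths of all projections of
  \<open>z\<close>, so it serves all sets in \<open>C\<close> at once.\<close>

lemma in_proj_ideal_expn: assumes "in_proj_ideal C P z" shows "\<exists>n. proj_le C z (expn P n)"
proof -
  have "subseq (proj A z) (proj A (expn P (length z)))" if "A \<in> set C" for A
  proof -
    have "subseq (proj A z) (expn P (length (proj A z)))"
      using assms that imem_subseq_expn by (auto simp: in_proj_ideal_def)
    moreover have "length (proj A z) \<le> length z" by (simp add: proj_def)
    ultimately have "subseq (proj A z) (expn P (length z))"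
      using expn_mono subseq_order.trans by blast
    from subseq_proj[OF this, of A] show ?thesis by (simp add: proj_def)
  qed
  then show ?thesis unfolding proj_le_def by blast
qed

text \<open>An antitone property holds forever or fails from some index on; finitely many of them
  have a common index after which nothing changes.\<close>

lemma uniform_bound:
  assumes "\<And>x n m. n \<le> m \<Longrightarrow> Q x m \<Longrightarrow> Q x (n::nat)"
  shows "\<exists>n. \<forall>x\<in>set xs. Q x n \<longrightarrow> (\<forall>m. Q x m)"
proof (induction xs)
  case (Cons x xs)
  then obtain n where n: "\<forall>x\<in>set xs. Q x n \<longrightarrow> (\<forall>m. Q x m)" by blast
  obtain k where k: "Q x k \<longrightarrow> (\<forall>m. Q x m)" by blast
  have "\<forall>y\<in>set (x # xs). Q y (max n k) \<longrightarrow> (\<forall>m. Q y m)"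
    using n k assms[of n "max n k"] assms[of k "max n k"] by fastforce
  then show ?case by blast
qed simp

text \<open>Along \<open>expn P\<close> the results of the given tests stabilise at some
  \<open>n\<close>. Every word above \<open>expn P n\<close> that still lies in the product ideal of
  \<open>P\<close> shows these stable results, and both languages contain such a word.\<close>

lemma adherent_inseparable:
  assumes M1: "dense {z \<in> M1. in_proj_ideal C P z \<and> in_proj_ideal C Q z} P"
    and M2: "dense {z \<in> M2. in_proj_ideal C P z \<and> in_proj_ideal C Q z} Q"
  shows "\<exists>z\<in>M1. \<exists>z'\<in>M2. same_tests C Ps z z'"
proof -
  let ?V = "\<lambda>x n. imem (fst x) (proj (snd x) (expn P n))"
  have anti: "?V x n" if "n \<le> m" "?V x m" for x n m
    using that(2) subseq_proj[OF expn_mono[OF that(1)]] by (rule imem_subseq)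
  have "\<exists>n. \<forall>x\<in>set (List.product Ps C). ?V x n \<longrightarrow> (\<forall>m. ?V x m)"
    by (rule uniform_bound) (rule anti)
  then obtain n where n: "\<forall>x\<in>set (List.product Ps C). ?V x n \<longrightarrow> (\<forall>m. ?V x m)" by blast
  have eventually: "imem P' (proj A z) \<longleftrightarrow> ?V (P', A) n"
    if e: "proj_le C (expn P n) z" "in_proj_ideal C P z" "P' \<in> set Ps" "A \<in> set C" for z P' A
  proof
    assume "imem P' (proj A z)"
    moreover have "subseq (proj A (expn P n)) (proj A z)" using e(1,4) by (simp add: proj_le_def)
    ultimately show "?V (P', A) n" using imem_subseq[of P' "proj A z"] by simp
  next
    assume "?V (P', A) n"
    then have "\<forall>m. ?V (P', A) m" using n e(3,4) by fastforce
    moreover obtain m where "proj_le C z (expn P m)" using in_proj_ideal_expn[OF e(2)] by blast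
    moreover from this have "subseq (proj A z) (proj A (expn P m))" using e(4) by (simp add: proj_le_def)
    ultimately show "imem P' (proj A z)" using imem_subseq[of P' "proj A (expn P m)"] by simp
  qed
  obtain z where z: "z \<in> M1" "in_proj_ideal C P z" "in_proj_ideal C Q z" "subseq (expn P n) z"
    using M1 unfolding dense_def by blast
  \<comment> \<open>Here it matters that the witnesses lie in both ideals: \<open>z\<close> carries
    \<open>expn P n\<close> into the ideal of \<open>Q\<close>, for which the second language is
    dense.\<close>
  have "in_proj_ideal C Q (expn P n)" using in_proj_ideal_leC[OF subseq_proj_le[OF z(4)] z(3)] .
  then obtain m where m: "proj_le C (expn P n) (expn Q m)" using in_proj_ideal_expn by blast
  obtain z' where z': "z' \<in> M2" "in_proj_ideal C P z'" "subseq (expn Q m) z'"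
    using M2 unfolding dense_def by blast
  have "proj_le C (expn P n) z'" using proj_le_trans[OF m subseq_proj_le[OF z'(3)]] .
  then have "same_tests C Ps z z'"
    unfolding same_tests_def using eventually[OF subseq_proj_le[OF z(4)] z(2)] eventually[OF _ z'(2)] by simp
  then show ?thesis using z z' by blast
qed

text \<open>Choose pairs that agree on more and more ideals of an enumeration of all ideals and pass
  to a subsequence ascending in both components. The two chains generate \<open>P\<close> and
  \<open>Q\<close>, which themselves occur in the enumeration, so from some index on the pairs agree
  on them.\<close>

lemma inseparable_adherent:
  assumes over: "M1 \<subseteq> lists (set g)" "M2 \<subseteq> lists (set g)"
    and insep: "\<And>Ps. \<exists>z\<in>M1. \<exists>z'\<in>M2. same_tests C Ps z z'"
  shows "\<exists>P Q. dense {z \<in> M1. in_proj_ideal C P z \<and> in_proj_ideal C Q z} P \<and> dense {z \<in> M2. in_proj_ideal C P z \<and> in_proj_ideal C Q z} Q"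
proof -
  define Ps :: "nat \<Rightarrow> ideal list" where "Ps n = map dec [0..<n]" for n
  have "\<forall>n. \<exists>zz. fst zz \<in> M1 \<and> snd zz \<in> M2 \<and> same_tests C (Ps n) (fst zz) (snd zz)"
    using insep by fastforce
  from choice[OF this] obtain zz where zz: "\<And>n. fst (zz n) \<in> M1" "\<And>n. snd (zz n) \<in> M2"
    "\<And>n. same_tests C (Ps n) (fst (zz n)) (snd (zz n))" by blast
  obtain h :: "nat \<Rightarrow> nat" where h: "strict_mono h"
    "\<And>i j. i \<le> j \<Longrightarrow> subseq (fst (zz (h i))) (fst (zz (h j)))"
    using wqo_subseqD[OF higman[OF finite_set[of g]], of "\<lambda>i. fst (zz i)"] zz(1) over by blast
  obtain l :: "nat \<Rightarrow> nat" where l: "strict_mono l"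
    "\<And>i j. i \<le> j \<Longrightarrow> subseq (snd (zz (h (l i)))) (snd (zz (h (l j))))"
    using wqo_subseqD[OF higman[OF finite_set[of g]], of "\<lambda>i. snd (zz (h i))"] zz(2) over by blast
  define k where "k i = h (l i)" for i
  \<comment> \<open>Passing to the subsequence only increases the number of ideals on which a pair
    agrees.\<close>
  have k: "i \<le> k i" for i
    unfolding k_def using strict_mono_imp_increasing[OF h(1)] strict_mono_imp_increasing[OF l(1)]
    by (meson le_trans)
  define x y where "x i = fst (zz (k i))" and "y i = snd (zz (k i))" for i
  have x: "x i \<in> M1" "i \<le> j \<Longrightarrow> subseq (x i) (x j)" for i j
    using zz(1) h(2)[of "l i" "l j"] l(1) by (auto simp: x_def k_def strict_mono_less_eq)
  have y: "y i \<in> M2" "i \<le> j \<Longrightarrow> subseq (y i) (y j)" for i j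
    using zz(2) l(2) by (auto simp: y_def k_def)
  obtain P where P: "\<And>w. imem P w \<longleftrightarrow> (\<exists>i. subseq w (x i))"
    using chain_ideal[OF finite_set[of g], of x] x over by blast
  obtain Q where Q: "\<And>w. imem Q w \<longleftrightarrow> (\<exists>i. subseq w (y i))"
    using chain_ideal[OF finite_set[of g], of y] y over by blast
  have Px: "imem P (x i)" and Qy: "imem Q (y i)" for i
    unfolding P Q by blast+
  have same: "imem R (proj A (x j)) \<longleftrightarrow> imem R (proj A (y j))" if "enc R < j" "A \<in> set C" for R A j
  proof -
    have "enc R < k j" using that(1) k[of j] by simp
    then have "dec (enc R) \<in> set (Ps (k j))" unfolding Ps_def by (auto simp del: dec_enc)
    then show ?thesis using zz(3)[of "k j"] that(2) by (simp add: same_tests_def x_def y_def)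
  qed
  have "in_proj_ideal C Q (x i)" for i unfolding in_proj_ideal_def
  proof
    fix A assume A: "A \<in> set C"
    \<comment> \<open>Late enough for the pair to agree on \<open>Q\<close>, and not before
      \<open>i\<close>, so that the conclusion descends to \<open>x i\<close> along the
      chain.\<close>
    let ?j = "max i (Suc (enc Q))"
    have "imem Q (proj A (y ?j))" using imem_in_proj_ideal[OF Qy] A by (auto simp: in_proj_ideal_def)
    then have "imem Q (proj A (x ?j))" using same[of Q ?j A] A by simp
    then show "imem Q (proj A (x i))" using imem_subseq subseq_proj[OF x(2)[of i ?j]] by simp
  qed
  moreover have "in_proj_ideal C P (y i)" for i unfolding in_proj_ideal_def
  proof
    fix A assume A: "A \<in> set C"
    let ?j = "max i (Suc (enc P))"
    have "imem P (proj A (x ?j))" using imem_in_proj_ideal[OF Px] A by (auto simp: in_proj_ideal_def)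
    then have "imem P (proj A (y ?j))" using same[of P ?j A] A by simp
    then show "imem P (proj A (y i))" using imem_subseq subseq_proj[OF y(2)[of i ?j]] by simp
  qed
  moreover have "in_proj_ideal C P (x i)" "in_proj_ideal C Q (y i)" for i using Px Qy imem_in_proj_ideal by blast+
  moreover have "\<exists>i. subseq (expn P n) (x i)" "\<exists>i. subseq (expn Q n) (y i)" for n
    using imem_expn P Q by blast+
  ultimately have "dense {z \<in> M1. in_proj_ideal C P z \<and> in_proj_ideal C Q z} P" "dense {z \<in> M2. in_proj_ideal C P z \<and> in_proj_ideal C Q z} Q"
    unfolding dense_def using x(1) y(1) by blast+
  then show ?thesis by blast
qed

subsection \<open>Reducing density of an ideal to simultaneous unboundedness\<close>

text \<open>Each round of a loop writes one letter that numbers the component, counted from the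
  right; the optional letter is read without output. The output thus records the vector of
  repetitions, in decreasing and distinct letters.\<close>

primrec pblocks :: "ideal \<Rightarrow> block list" where
  "pblocks [] = []"
| "pblocks (e # P) = (fst e, [length P], [snd e], []) # pblocks P"

lemma length_pblocks [simp]: "length (pblocks P) = length P"
  by (induction P) auto

lemma computable_pblocks: "computable_on UNIV pblocks"
proof -
  have "pblocks P = foldr (\<lambda>e r. (fst e, [length r], [snd e], []) # r) P []" for P
    by (induction P) (simp_all, metis length_pblocks)
  then have eq: "pblocks = (\<lambda>P. fold (\<lambda>e r. (fst e, [length r], [snd e], []) # r) (rev P) [])"
    by (simp add: fun_eq_iff foldr_conv_fold)
  show ?thesis unfolding eq by (intro computable_intros)
qed

lemma stair_in_pblocks: "stair_in (pblocks P) (replicate (length P) n) = expn P n"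
  by (induction P) auto

lemma stair_in_pblocks_mono:
  "length ks = length P \<Longrightarrow> \<forall>k\<in>set ks. n \<le> k \<Longrightarrow> subseq (expn P n) (stair_in (pblocks P) ks)"
proof (induction P arbitrary: ks)
  case (Cons e P)
  then obtain k ks' where ks: "ks = k # ks'" by (cases ks) auto
  have "replicate k (fst e) = replicate n (fst e) @ replicate (k - n) (fst e)"
    using Cons.prems ks by (simp flip: replicate_add)
  then have "subseq (concat (replicate n (fst e))) (concat (replicate k (fst e)))" by auto
  then show ?case using Cons ks by (simp add: list_emb_append_mono)
qed simp

definition power_word :: "nat list \<Rightarrow> nat list" where
  "power_word ks = concat (map2 replicate ks (rev [0..<length ks]))"

lemma power_word_simps [simp]: "power_word [] = []" "power_word (k # ks) = replicate k (length ks) @ power_word ks"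
  by (simp_all add: power_word_def)

lemma stair_out_pblocks: "length ks = length P \<Longrightarrow> stair_out (pblocks P) ks = power_word ks"
proof (induction P arbitrary: ks)
  case (Cons e P)
  have "concat (replicate k [a]) = replicate k a" for k and a :: nat by (induction k) auto
  with Cons show ?case by (cases ks) auto
qed simp

lemma blang_bword: "blang (rev [0..<m]) = {power_word ks |ks. length ks = m}"
  unfolding blang_def power_word_def by auto

lemma set_bword: "set (power_word ks) \<subseteq> {..<length ks}"
  by (induction ks) auto

lemma bword_mono: "length ks = length ls \<Longrightarrow> (\<And>i. i < length ks \<Longrightarrow> ks ! i \<le> ls ! i) \<Longrightarrow>
    subseq (power_word ks) (power_word ls)"
proof (induction ks ls rule: list_induct2)
  case (Cons k ks l ls)
  have "k \<le> l" using Cons.prems[of 0] by simp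
  then have "replicate l (length ks) = replicate k (length ks) @ replicate (l - k) (length ks)"
    by (simp flip: replicate_add)
  moreover have "subseq (power_word ks) (power_word ls)"
    using Cons.prems[of "Suc _"] by (intro Cons.IH) simp
  ultimately show ?case using Cons.hyps by (simp add: subseq_append' subseq_drop_many)
qed simp

text \<open>The block letters are pairwise distinct, so filtering by the leading letter compares the
  first exponents and filtering it out leaves the remaining blocks.\<close>

lemma bword_subseq_replicate: "length ls = m \<Longrightarrow> subseq (power_word (replicate m n)) (power_word ls) \<Longrightarrow>
    \<forall>l\<in>set ls. n \<le> l"
proof (induction ls arbitrary: m)
  case (Cons l ls)
  let ?m = "length ls"
  have [simp]: "filter (\<lambda>a. a = ?m) (power_word ks) = []" "filter (\<lambda>a. a \<noteq> ?m) (power_word ks) = power_word ks"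
    if "length ks = ?m" for ks
    using set_bword[of ks] that by (auto simp: filter_empty_conv filter_id_conv)
  have s: "subseq (replicate n ?m @ power_word (replicate ?m n)) (replicate l ?m @ power_word ls)"
    using Cons.prems by auto
  from subseq_filter[OF s, of "\<lambda>a. a = ?m"] have "n \<le> l"
    by (auto dest: list_emb_length)
  moreover from subseq_filter[OF s, of "\<lambda>a. a \<noteq> ?m"] have "subseq (power_word (replicate ?m n)) (power_word ls)"
    by simp
  ultimately show ?case using Cons.IH by simp
qed simp

text \<open>Taking subwords first turns words of \<open>L\<close> into words of the shape prescribed
  by \<open>P\<close>; the stair transducer then replaces each by its vector of repetitions. The
  language \<open>K\<close> contains vectors large in all entries exactly if all
  \<open>expn P n\<close> lie below \<open>L\<close>.\<close>

lemma dense_iff_SUP: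
  fixes P :: ideal
  assumes L: "L \<subseteq> lists (set g)"
  defines "K \<equiv> wrel (stair_trans (pblocks P)) `` (wrel (down_trans g) `` L)"
  shows "K \<subseteq> blang (rev [0..<length P])"
    and "dense L P \<longleftrightarrow> blang (rev [0..<length P]) \<subseteq> dclo subseq K"
proof -
  have K: "w \<in> K \<longleftrightarrow> (\<exists>ks. length ks = length P \<and> w = power_word ks \<and>
      (\<exists>u\<in>L. subseq (stair_in (pblocks P) ks) u))" for w
  proof -
    have down: "wrel (down_trans g) `` L = {v. \<exists>u\<in>L. subseq v u}"
      using L unfolding wrel_down_trans by (auto simp del: in_lists_conv_set)
    have stair_trans: "(v, w) \<in> wrel (stair_trans (pblocks P)) \<longleftrightarrow>
        (\<exists>ks. length ks = length P \<and> v = stair_in (pblocks P) ks \<and> w = power_word ks)" for v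
      unfolding wrel_stair_trans by (simp add: stair_out_pblocks cong: conj_cong)
    have "w \<in> K \<longleftrightarrow> (\<exists>v. (\<exists>u\<in>L. subseq v u) \<and>
        (\<exists>ks. length ks = length P \<and> v = stair_in (pblocks P) ks \<and> w = power_word ks))"
      unfolding K_def down Image_iff stair_trans Bex_def mem_Collect_eq ..
    then show ?thesis by blast
  qed
  show "K \<subseteq> blang (rev [0..<length P])"
    unfolding blang_bword using K by blast
  show "dense L P \<longleftrightarrow> blang (rev [0..<length P]) \<subseteq> dclo subseq K"
  proof
    assume d: "dense L P"
    show "blang (rev [0..<length P]) \<subseteq> dclo subseq K"
    proof
      fix w assume "w \<in> blang (rev [0..<length P])"
      then obtain ks where ks: "length ks = length P" "w = power_word ks" by (auto simp: blang_bword)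
      let ?n = "Max (insert 0 (set ks))"
      have "subseq w (power_word (replicate (length P) ?n))"
        unfolding ks(2) using ks(1) by (intro bword_mono) auto
      moreover have "power_word (replicate (length P) ?n) \<in> K"
        unfolding K using d stair_in_pblocks[of P ?n] unfolding dense_def
        by (intro exI[of _ "replicate (length P) ?n"]) simp
      ultimately show "w \<in> dclo subseq K" by (auto simp: dclo_def)
    qed
  next
    assume sub: "blang (rev [0..<length P]) \<subseteq> dclo subseq K"
    show "dense L P" unfolding dense_def
    proof
      fix n
      have "power_word (replicate (length P) n) \<in> dclo subseq K"
        using sub unfolding blang_bword by (rule subsetD) (auto intro!: exI[of _ "replicate (length P) n"])
      then obtain ks u where ks: "length ks = length P" "subseq (power_word (replicate (length P) n)) (power_word ks)"
        and u: "u \<in> L" "subseq (stair_in (pblocks P) ks) u" unfolding dclo_def using K by auto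
      have "subseq (expn P n) (stair_in (pblocks P) ks)"
        using bword_subseq_replicate[OF ks] stair_in_pblocks_mono[OF ks(1)] by blast
      then show "\<exists>z\<in>L. subseq (expn P n) z" using u subseq_order.trans by blast
    qed
  qed
qed

subsection \<open>Algorithms for full trios\<close>

locale trio =
  fixes D :: "nat set" and rep :: "nat \<Rightarrow> nat list set"
  assumes full_trio: "full_trio D rep"
begin

text \<open>The choice is made once for each state type and does not depend on \<open>c\<close> and
  \<open>W\<close>, which keeps the result computable in both.\<close>

definition apply_code :: "nat \<Rightarrow> 'q::enc wtrans \<Rightarrow> nat" where
  "apply_code c W = (SOME f. computable_on (D \<times> UNIV) f \<and>
    (\<forall>c\<in>D. \<forall>W. f (c, W :: 'q wtrans) \<in> D \<and> rep (f (c, W)) = wrel W `` rep c)) (c, W)"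

lemma apply_code_spec: "computable_on (D \<times> UNIV) (\<lambda>x. apply_code (fst x) (snd x :: 'q::enc wtrans)) \<and>
    (\<forall>c\<in>D. \<forall>W. apply_code c (W :: 'q wtrans) \<in> D \<and> rep (apply_code c W) = wrel W `` rep c)"
  using someI_ex[OF full_trio_image[OF full_trio, where 'q = 'q]] unfolding apply_code_def by simp

lemma apply_code_in: "c \<in> D \<Longrightarrow> apply_code c W \<in> D"
  using apply_code_spec by blast

lemma rep_apply_code: "c \<in> D \<Longrightarrow> rep (apply_code c W) = wrel W `` rep c"
  using apply_code_spec by blast

lemma computable_apply_code:
  fixes W :: "'a::enc \<Rightarrow> 'q::enc wtrans"
  assumes "computable_on A c" "computable_on A W" "\<And>x. x \<in> A \<Longrightarrow> c x \<in> D"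
  shows "computable_on A (\<lambda>x. apply_code (c x) (W x))"
proof -
  have "computable_on (D \<times> UNIV) (\<lambda>x. apply_code (fst x) (snd x :: 'q wtrans))" using apply_code_spec by blast
  then have "computable_on A (\<lambda>x. (\<lambda>y. apply_code (fst y) (snd y)) (c x, W x))"
    by (rule computable_comp) (use assms in \<open>auto intro: computable_Pair\<close>)
  then show ?thesis by simp
qed

lemma rep_finite: "c \<in> D \<Longrightarrow> \<exists>g. rep c \<subseteq> lists (set g)"
  using full_trio finite_list unfolding full_trio_def by metis

end

locale sup_trio = trio +
  assumes SUP: "SUP_decidable D rep"
begin

lemma computable_SUP:
  assumes "computable_on A c" "computable_on A as" "\<And>x. x \<in> A \<Longrightarrow> c x \<in> D" "\<And>x. x \<in> A \<Longrightarrow> rep (c x) \<subseteq> blang (as x)"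
  shows "decidable_on A (\<lambda>x. blang (as x) \<subseteq> dclo subseq (rep (c x)))"
proof -
  let ?B = "{(c, as). c \<in> D \<and> rep c \<subseteq> blang as}"
  obtain p where p: "\<And>c as. c \<in> D \<Longrightarrow> rep c \<subseteq> blang as \<Longrightarrow> eval p [prod_encode (c, list_encode as)]
      (if blang as \<subseteq> dclo subseq (rep c) then 1 else 0)"
    using SUP unfolding SUP_decidable_def by blast
  have "decidable_on ?B (\<lambda>x. blang (snd x) \<subseteq> dclo subseq (rep (fst x)))"
  proof (rule cmpI)
    fix x assume "x \<in> ?B"
    then show "eval p [enc x] (enc (of_bool (blang (snd x) \<subseteq> dclo subseq (rep (fst x))) :: nat))"
      using p[of "fst x" "snd x"] unfolding enc_nat_def of_bool_def
      by (cases x) (simp only: enc_Pair enc_nat_def enc_nat_list fst_conv snd_conv mem_Collect_eq prod.case simp_thms)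
  qed
  then have "decidable_on A (\<lambda>x. blang (snd (c x, as x)) \<subseteq> dclo subseq (rep (fst (c x, as x))))"
    by (rule computable_comp) (use assms in \<open>auto intro: computable_Pair\<close>)
  then show ?thesis by simp
qed

text \<open>Erasing all letters leaves the empty language or the language of the empty word;
  \<open>blang []\<close> consists of the empty word, so the SUP for no letters tells them
  apart.\<close>

lemma computable_nonempty:
  assumes "computable_on A c" "computable_on A g" "\<And>x. x \<in> A \<Longrightarrow> c x \<in> D" "\<And>x. x \<in> A \<Longrightarrow> rep (c x) \<subseteq> lists (set (g x))"
  shows "decidable_on A (\<lambda>x. rep (c x) \<noteq> {})"
proof -
  have rep: "rep (apply_code (c x) (erase_trans (g x))) = (if rep (c x) = {} then {} else {[]})" if "x \<in> A" for x
    unfolding rep_apply_code[OF assms(3)[OF that]] wrel_erase_trans using assms(4)[OF that] by auto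
  have "decidable_on A (\<lambda>x. blang [] \<subseteq> dclo subseq (rep (apply_code (c x) (erase_trans (g x)))))"
  proof (rule computable_SUP)
    show "computable_on A (\<lambda>x. apply_code (c x) (erase_trans (g x)))"
      by (intro computable_apply_code assms computable_comp_UNIV[OF computable_erase_trans])
    show "computable_on A (\<lambda>x. [])" by (rule computable_const)
  qed (use assms(3) rep in \<open>auto simp: blang_def apply_code_in\<close>)
  then show ?thesis
    by (rule computable_cong[THEN iffD1, rotated]) (auto simp: rep blang_def dclo_def)
qed

lemma computable_dense:
  assumes "computable_on A c" "computable_on A g" "computable_on A P" "\<And>x. x \<in> A \<Longrightarrow> c x \<in> D"
    "\<And>x. x \<in> A \<Longrightarrow> rep (c x) \<subseteq> lists (set (g x))"
  shows "decidable_on A (\<lambda>x. dense (rep (c x)) (P x))"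
proof -
  let ?c = "\<lambda>x. apply_code (apply_code (c x) (down_trans (g x))) (stair_trans (pblocks (P x)))"
  have rep: "rep (?c x) = wrel (stair_trans (pblocks (P x))) `` (wrel (down_trans (g x)) `` rep (c x))" if "x \<in> A" for x
    using assms(4)[OF that] by (simp add: rep_apply_code apply_code_in)
  have "decidable_on A (\<lambda>x. blang (rev [0..<length (P x)]) \<subseteq> dclo subseq (rep (?c x)))"
  proof (rule computable_SUP)
    show "computable_on A ?c"
      by (intro computable_apply_code assms computable_comp_UNIV[OF computable_down_trans] computable_comp_UNIV[OF computable_stair_trans]
          computable_comp_UNIV[OF computable_pblocks] apply_code_in)
    show "computable_on A (\<lambda>x. rev [0..<length (P x)])" by (intro computable_intros assms)
    fix x assume x: "x \<in> A"
    show "?c x \<in> D" using assms(4)[OF x] by (simp add: apply_code_in)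
    show "rep (?c x) \<subseteq> blang (rev [0..<length (P x)])"
      unfolding rep[OF x] by (rule dense_iff_SUP(1)[OF assms(5)[OF x]])
  qed
  then show ?thesis
    by (rule computable_cong[THEN iffD1, rotated]) (simp add: rep dense_iff_SUP(2)[OF assms(5)])
qed

end

text \<open>Results are numbers 0 and 1 so that patterns are encodable and can be compared by a
  program.\<close>

definition tflags :: "tests \<Rightarrow> nat list" where
  "tflags s = map (\<lambda>t. of_bool (\<not> snd t = None)) s"

definition ideal_flags :: "(nat list \<times> ideal) list \<Rightarrow> nat list \<Rightarrow> nat list" where
  "ideal_flags ts z = map (\<lambda>t. of_bool (imem (snd t) (proj (fst t) z))) ts"

lemma tflags_start: "tflags (foldl tstep (start ts) z) = ideal_flags ts z"
proof -
  have "tflags s = map of_bool (tpass s)" for s by (simp add: tflags_def tpass_def)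
  then show ?thesis by (simp add: tpass_start ideal_flags_def)
qed

lemma computable_tflags: "computable_on UNIV tflags"
  unfolding tflags_def by (intro computable_intros)

lemma computable_start: "computable_on UNIV start"
  unfolding start_def by (intro computable_intros)

lemma computable_restrict_tests' [computable_intros]:
  assumes "computable_on A a" "computable_on A b" "computable_on A c"
  shows "computable_on A (\<lambda>x. restrict_tests (a x) (b x) (c x))"
proof -
  have "computable_on A (\<lambda>x. (\<lambda>p. restrict_tests (fst p) (fst (snd p)) (snd (snd p))) (a x, b x, c x))"
    by (rule computable_comp_UNIV[OF computable_restrict_tests]) (intro computable_intros assms)
  then show ?thesis by simp
qed

lemmas computable_unary [computable_intros] = computable_comp_UNIV[OF computable_tflags] computable_comp_UNIV[OF computable_start]
  computable_comp_UNIV[OF computable_tstates]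

lemma computable_subtrans [computable_intros]:
  assumes "computable_on A I" "computable_on A F" shows "computable_on A (\<lambda>x. subtrans E (I x) (F x))"
  unfolding subtrans_def by (intro computable_intros assms)

text \<open>The alphabet \<open>g\<close> has to cover the outputs of all runs, not only of
  accepting ones: later the runs between arbitrary states are tested for emptiness over
  \<open>g\<close>.\<close>

locale sup_repr = sup_trio D rep + represented \<Sigma> r T g C
  for D :: "nat set" and rep :: "nat \<Rightarrow> nat list set" and \<Sigma> :: "nat set"
    and r :: "nat list \<Rightarrow> nat list \<Rightarrow> bool" and T :: trans and g :: "nat list" and C :: "nat list list" +
  assumes trun_over: "trun T p u v q \<Longrightarrow> v \<in> lists (set g)"
begin

definition image_code :: "nat \<Rightarrow> nat" where
  "image_code c = apply_code c (subtrans (t_edges T) (t_init T) (t_fin T))"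

lemma image_code_in: "c \<in> D \<Longrightarrow> image_code c \<in> D"
  unfolding image_code_def by (rule apply_code_in)

lemma rep_image_code: "c \<in> D \<Longrightarrow> rep (image_code c) = trel T `` rep c"
  unfolding image_code_def by (simp add: rep_apply_code wrel_subtrans_trel)

lemma rep_image_code_over: "c \<in> D \<Longrightarrow> rep (image_code c) \<subseteq> lists (set g)"
  using rep_image_code over by blast

lemma computable_image_code: "computable_on A c \<Longrightarrow> (\<And>x. x \<in> A \<Longrightarrow> c x \<in> D) \<Longrightarrow> computable_on A (\<lambda>x. image_code (c x))"
  unfolding image_code_def by (intro computable_apply_code computable_intros)

definition cell :: "nat \<Rightarrow> (nat list \<times> ideal) list \<Rightarrow> nat list \<Rightarrow> nat" where
  "cell c ts bs = apply_code c (restrict_tests g (start ts) (filter (\<lambda>s. tflags s = bs) (tstates (start ts))))"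

lemma cell_D: "c \<in> D \<Longrightarrow> cell c ts bs \<in> D"
  unfolding cell_def by (rule apply_code_in)

lemma rep_cell:
  assumes "c \<in> D" "rep c \<subseteq> lists (set g)"
  shows "rep (cell c ts bs) = {z \<in> rep c. ideal_flags ts z = bs}"
proof -
  have "foldl tstep (start ts) z \<in> set (filter (\<lambda>s. tflags s = bs) (tstates (start ts))) \<longleftrightarrow>
      ideal_flags ts z = bs" for z
    using tstates_foldl[OF tstates_refl, of "start ts" z] by (simp add: tflags_start)
  then show ?thesis
    unfolding cell_def rep_apply_code[OF assms(1)] wrel_restrict_tests using assms(2) by blast
qed

lemma rep_cell_over: "c \<in> D \<Longrightarrow> rep c \<subseteq> lists (set g) \<Longrightarrow> rep (cell c ts bs) \<subseteq> lists (set g)"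
  using rep_cell by blast

lemma computable_cell:
  assumes "computable_on A c" "computable_on A ts" "computable_on A bs" "\<And>x. x \<in> A \<Longrightarrow> c x \<in> D"
  shows "computable_on A (\<lambda>x. cell (c x) (ts x) (bs x))"
proof -
  have "computable_on (A \<times> UNIV) (\<lambda>p. bs (fst p))"
    by (rule computable_weaken[OF assms(3)])
  then show ?thesis unfolding cell_def by (intro computable_apply_code computable_intros assms)
qed

lemma ideal_flags_eq_iff: "ideal_flags ts z = ideal_flags ts z' \<longleftrightarrow>
    (\<forall>t\<in>set ts. imem (snd t) (proj (fst t) z) \<longleftrightarrow> imem (snd t) (proj (fst t) z'))"
  by (auto simp: ideal_flags_def)

lemma ideal_flags_const: "b \<in> {0, 1} \<Longrightarrow> ideal_flags ts z = map (\<lambda>_. b) ts \<longleftrightarrow>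
    (\<forall>t\<in>set ts. imem (snd t) (proj (fst t) z) \<longleftrightarrow> b = 1)"
  by (auto simp: ideal_flags_def)

definition all_tests :: "ideal list \<Rightarrow> (nat list \<times> ideal) list" where
  "all_tests Ps = concat (map (\<lambda>P. map (\<lambda>A. (A, P)) C) Ps)"

text \<open>Comparing pairs of words is replaced by finitely many result patterns: no pattern may be
  realised in both languages. Each cell of words with a given pattern can be tested for
  emptiness.\<close>

definition separates :: "nat \<Rightarrow> nat \<Rightarrow> ideal list \<Rightarrow> bool" where
  "separates c1 c2 Ps \<longleftrightarrow> (\<forall>bs\<in>set (product_lists (map (\<lambda>_. [0, 1]) (all_tests Ps))).
     \<not> (rep (cell (image_code c1) (all_tests Ps) bs) \<noteq> {} \<and> rep (cell (image_code c2) (all_tests Ps) bs) \<noteq> {}))"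

definition adherent :: "nat \<Rightarrow> ideal \<Rightarrow> ideal \<Rightarrow> ideal \<Rightarrow> bool" where
  "adherent c P Q R \<longleftrightarrow> dense (rep (cell (image_code c) (all_tests [P, Q]) (map (\<lambda>_. 1) (all_tests [P, Q])))) R"

lemma separates_iff:
  assumes "c1 \<in> D" "c2 \<in> D"
  shows "separates c1 c2 Ps \<longleftrightarrow> (\<forall>z\<in>rep (image_code c1). \<forall>z'\<in>rep (image_code c2). \<not> same_tests C Ps z z')"
proof -
  have mem: "ideal_flags ts z \<in> set (product_lists (map (\<lambda>_. [0, 1]) ts))" for ts z
    by (simp add: product_lists_set ideal_flags_def list_all2_map1 list_all2_map2 list_all2_same of_bool_def)
  have "same_tests C Ps z z' \<longleftrightarrow> ideal_flags (all_tests Ps) z = ideal_flags (all_tests Ps) z'" for z z'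
    unfolding ideal_flags_eq_iff same_tests_def all_tests_def by auto
  then show ?thesis
    unfolding separates_def using mem[of "all_tests Ps"] assms
    by (fastforce simp: rep_cell image_code_in rep_image_code_over)
qed

lemma adherent_iff:
  assumes "c \<in> D"
  shows "adherent c P Q R \<longleftrightarrow> dense {z \<in> rep (image_code c). in_proj_ideal C P z \<and> in_proj_ideal C Q z} R"
proof -
  have "ideal_flags (all_tests [P, Q]) z = map (\<lambda>_. 1) (all_tests [P, Q]) \<longleftrightarrow> in_proj_ideal C P z \<and> in_proj_ideal C Q z" for z
    by (subst ideal_flags_const) (simp_all add: all_tests_def in_proj_ideal_def ball_Un)
  then show ?thesis unfolding adherent_def by (simp only: rep_cell image_code_in rep_image_code_over assms)
qed

lemma computable_all_tests: "computable_on A f \<Longrightarrow> computable_on A (\<lambda>x. all_tests (f x))"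
  unfolding all_tests_def by (intro computable_intros)

lemma computable_separates:
  assumes "computable_on A c1" "computable_on A c2" "computable_on A Ps" "\<And>x. x \<in> A \<Longrightarrow> c1 x \<in> D" "\<And>x. x \<in> A \<Longrightarrow> c2 x \<in> D"
  shows "decidable_on A (\<lambda>x. separates (c1 x) (c2 x) (Ps x))"
proof -
  have weak: "computable_on (A \<times> UNIV) (\<lambda>p. f (fst p))" if "computable_on A f" for f :: "_ \<Rightarrow> 'z::enc"
    by (rule computable_weaken[OF that])
  have ne: "decidable_on (A \<times> UNIV) (\<lambda>p. rep (cell (image_code (c (fst p))) (all_tests (Ps (fst p))) (snd p)) \<noteq> {})"
    if "computable_on A c" "\<And>x. x \<in> A \<Longrightarrow> c x \<in> D" for c
  proof (rule computable_nonempty[where g="\<lambda>_. g"])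
    fix p assume "p \<in> A \<times> (UNIV :: nat list set)"
    then have "c (fst p) \<in> D" using that(2) by auto
    then show "cell (image_code (c (fst p))) (all_tests (Ps (fst p))) (snd p) \<in> D"
      "rep (cell (image_code (c (fst p))) (all_tests (Ps (fst p))) (snd p)) \<subseteq> lists (set g)"
      by (intro cell_D rep_cell_over image_code_in rep_image_code_over; assumption)+
  qed (use that in \<open>auto intro!: computable_cell computable_image_code computable_all_tests weak assms computable_intros image_code_in\<close>)
  show ?thesis unfolding separates_def
    by (intro decidable_Ball decidable_not decidable_conj ne assms computable_product_lists computable_map computable_all_tests computable_const)
qed

lemma computable_adherent:
  assumes "computable_on A c" "computable_on A P" "computable_on A Q" "computable_on A R" "\<And>x. x \<in> A \<Longrightarrow> c x \<in> D"
  shows "decidable_on A (\<lambda>x. adherent (c x) (P x) (Q x) (R x))"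
  unfolding adherent_def
proof (rule computable_dense[where g="\<lambda>_. g"])
  fix x assume "x \<in> A"
  then have "c x \<in> D" by (rule assms(5))
  then show "cell (image_code (c x)) (all_tests [P x, Q x]) (map (\<lambda>_. 1) (all_tests [P x, Q x])) \<in> D"
    "rep (cell (image_code (c x)) (all_tests [P x, Q x]) (map (\<lambda>_. 1) (all_tests [P x, Q x]))) \<subseteq> lists (set g)"
    by (intro cell_D rep_cell_over image_code_in rep_image_code_over; assumption)+
qed (use assms in \<open>auto intro!: computable_cell computable_image_code computable_all_tests computable_intros image_code_in\<close>)

text \<open>Separability and inseparability both have decidable certificates, and exactly one kind
  exists, so a single unbounded search over both kinds terminates.\<close>

theorem sep: "sep_decidable D rep \<Sigma> r"
proof -
  define A where "A = {(c1, c2). c1 \<in> D \<and> c2 \<in> D \<and> rep c1 \<subseteq> lists \<Sigma> \<and> rep c2 \<subseteq> lists \<Sigma>}"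
  define Sep where "Sep x \<longleftrightarrow> (\<exists>R. ptl \<Sigma> r R \<and> rep (fst x) \<subseteq> R \<and> rep (snd x) \<inter> R = {})" for x
  \<comment> \<open>The first entry of a candidate names its kind and is at the same time the
    answer: 1 with a separating list of ideals, 0 with an adherent pair.\<close>
  define ok :: "nat \<times> nat \<Rightarrow> nat \<times> ideal list \<times> ideal \<times> ideal \<Rightarrow> bool" where
    "ok x y \<longleftrightarrow> (fst y = 1 \<and> separates (fst x) (snd x) (fst (snd y))) \<or>
       (fst y = 0 \<and> adherent (fst x) (fst (snd (snd y))) (snd (snd (snd y))) (fst (snd (snd y))) \<and>
         adherent (snd x) (fst (snd (snd y))) (snd (snd (snd y))) (snd (snd (snd y))))" for x y
  have Sep: "Sep x \<longleftrightarrow> (\<exists>Ps. separates (fst x) (snd x) Ps)" if "x \<in> A" for x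
  proof -
    have x: "fst x \<in> D" "snd x \<in> D" "rep (fst x) \<subseteq> lists \<Sigma>" "rep (snd x) \<subseteq> lists \<Sigma>"
      using that unfolding A_def by auto
    show ?thesis
      unfolding Sep_def separates_iff[OF x(1,2)] rep_image_code[OF x(1)] rep_image_code[OF x(2)] by (rule separable_iff[OF x(3,4)])
  qed
  have N: "\<not> Sep x \<longleftrightarrow> (\<exists>P Q. adherent (fst x) P Q P \<and> adherent (snd x) P Q Q)" if "x \<in> A" for x
  proof -
    have x: "fst x \<in> D" "snd x \<in> D" using that by (auto simp: A_def)
    have "\<not> Sep x \<longleftrightarrow> (\<forall>Ps. \<exists>z\<in>rep (image_code (fst x)). \<exists>z'\<in>rep (image_code (snd x)). same_tests C Ps z z')"
      unfolding Sep[OF that] separates_iff[OF x] by blast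
    then show ?thesis unfolding adherent_iff[OF x(1)] adherent_iff[OF x(2)]
      using inseparable_adherent[OF rep_image_code_over rep_image_code_over, OF x, of C]
        adherent_inseparable[of "rep (image_code (fst x))" C _ _ "rep (image_code (snd x))"] by blast
  qed
  have "decidable_on (A \<times> UNIV) (\<lambda>p. ok (fst p) (snd p))"
    unfolding ok_def
    by (intro computable_intros computable_separates computable_adherent) (auto simp: A_def)
  moreover have "\<exists>y. ok x y" if xA: "x \<in> A" for x
  proof (cases "Sep x")
    case True
    then obtain Ps where "separates (fst x) (snd x) Ps" using Sep[OF xA] by blast
    then show ?thesis by (intro exI[of _ "(1, Ps, [], [])"]) (simp add: ok_def)
  next
    case False
    then obtain P Q where "adherent (fst x) P Q P" "adherent (snd x) P Q Q" using N[OF xA] by blast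
    then show ?thesis by (intro exI[of _ "(0, [], P, Q)"]) (simp add: ok_def)
  qed
  ultimately obtain F where F: "computable_on A F" "\<And>x. x \<in> A \<Longrightarrow> ok x (F x)"
    using computable_search[of A ok] by blast
  have out: "fst (F x) = (if Sep x then 1 else 0)" if "x \<in> A" for x
    using F(2)[OF that] Sep[OF that] N[OF that] by (auto simp: ok_def)
  obtain p where p: "\<And>x. x \<in> A \<Longrightarrow> eval p [enc x] (enc (fst (F x)))"
    using computable_fst[OF F(1)] unfolding computable_on_def by blast
  have "eval p [prod_encode (c1, c2)] (if Sep (c1, c2) then 1 else 0)"
    if "(c1, c2) \<in> A" for c1 c2
    using p[OF that] out[OF that] by simp
  then show ?thesis
    unfolding sep_decidable_def Sep_def A_def fst_conv snd_conv mem_Collect_eq prod.case by blast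
qed

subsection \<open>Downward closures\<close>

text \<open>The cell with all results 0 consists of the words that lie in none of the ideals;
  projecting to \<open>g\<close> keeps every letter of the image.\<close>

definition covers :: "nat \<Rightarrow> ideal list \<Rightarrow> bool" where
  "covers c Ps \<longleftrightarrow> (\<forall>P\<in>set Ps. dense (rep (image_code c)) P) \<and>
     \<not> rep (cell (image_code c) (map (Pair g) Ps) (map (\<lambda>_. 0) Ps)) \<noteq> {}"

lemma covers_iff:
  assumes "c \<in> D"
  shows "covers c Ps \<longleftrightarrow> (\<forall>P\<in>set Ps. dense (rep (image_code c)) P) \<and> (\<forall>z\<in>rep (image_code c). \<exists>P\<in>set Ps. imem P z)"
proof -
  have "proj g z = z" if "z \<in> rep (image_code c)" for z
    using rep_image_code_over[OF assms] that by (auto simp: proj_def filter_id_conv)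
  moreover have "ideal_flags (map (Pair g) Ps) z = map (\<lambda>_. 0) Ps \<longleftrightarrow> (\<forall>P\<in>set Ps. \<not> imem P (proj g z))" for z
    by (auto simp: ideal_flags_def)
  ultimately show ?thesis unfolding covers_def by (auto simp: rep_cell image_code_in rep_image_code_over assms)
qed

lemma computable_covers:
  assumes "computable_on A c" "computable_on A Ps" "\<And>x. x \<in> A \<Longrightarrow> c x \<in> D"
  shows "decidable_on A (\<lambda>x. covers (c x) (Ps x))"
proof -
  have "computable_on (A \<times> UNIV) (\<lambda>p. c (fst p))"
    by (rule computable_weaken[OF assms(1)])
  then have dense: "decidable_on (A \<times> UNIV) (\<lambda>p. dense (rep (image_code (c (fst p)))) (snd p))"
    by (intro computable_dense[where g="\<lambda>_. g"] computable_image_code computable_intros image_code_in rep_image_code_over) (auto simp: assms(3))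
  have cell: "decidable_on A (\<lambda>x. rep (cell (image_code (c x)) (map (Pair g) (Ps x)) (map (\<lambda>_. 0) (Ps x))) \<noteq> {})"
    by (intro computable_nonempty[where g="\<lambda>_. g"] computable_cell computable_image_code computable_intros cell_D image_code_in rep_cell_over rep_image_code_over assms)
  show ?thesis
    unfolding covers_def by (rule decidable_conj[OF decidable_Ball[OF assms(2) dense] decidable_not[OF cell]])
qed

lemma covers_ex:
  assumes "c \<in> D"
  shows "\<exists>Ps. covers c Ps"
proof -
  let ?X = "{x. \<exists>z\<in>rep (image_code c). subseq x z}"
  have "?X \<subseteq> lists (set g)"
  proof
    fix x assume "x \<in> ?X"
    then obtain z where z: "z \<in> rep (image_code c)" "subseq x z" by blast
    then have "set x \<subseteq> set z" by (auto dest: subseq_order.trans simp flip: subseq_singleton_left)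
    then show "x \<in> lists (set g)" using z rep_image_code_over[OF assms] by auto
  qed
  moreover have "downset ?X" unfolding downset_def by (auto intro: subseq_order.trans)
  ultimately have "\<exists>Ps. ?X = {x. \<exists>P\<in>set Ps. imem P x}" by (rule downset_ideals[OF finite_set])
  then obtain Ps where "?X = {x. \<exists>P\<in>set Ps. imem P x}" by blast
  then have Ps: "(\<exists>z\<in>rep (image_code c). subseq x z) \<longleftrightarrow> (\<exists>P\<in>set Ps. imem P x)" for x
    by (simp add: set_eq_iff)
  have "dense (rep (image_code c)) P" if "P \<in> set Ps" for P
    unfolding dense_def Ps using that imem_expn by blast
  moreover have "\<exists>P\<in>set Ps. imem P z" if "z \<in> rep (image_code c)" for z
    unfolding Ps[symmetric] using that by blast
  ultimately show ?thesis unfolding covers_iff[OF assms] by blast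
qed

text \<open>A covering list describes the subword closure of the image. The coarser product ordering
  enlarges each ideal \<open>P\<close> to \<open>in_proj_ideal C P\<close>: covering gives one
  inclusion, and density along \<open>expn P\<close> gives the other.\<close>

lemma dclo_covers:
  assumes c: "c \<in> D" "rep c \<subseteq> lists \<Sigma>" and "covers c Ps"
  shows "dclo r (rep c) = {x \<in> lists \<Sigma>. \<exists>P\<in>set Ps. \<exists>z. (x, z) \<in> trel T \<and> in_proj_ideal C P z}"
proof (intro subset_antisym subsetI)
  fix x assume "x \<in> dclo r (rep c)"
  then obtain y where y: "y \<in> rep c" "r x y" by (auto simp: dclo_def)
  then have xy: "x \<in> lists \<Sigma>" "y \<in> lists \<Sigma>" using words by blast+
  obtain z z' where z: "(x, z) \<in> trel T" "(y, z') \<in> trel T" using total xy by meson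
  then have "z' \<in> rep (image_code c)" using y rep_image_code c by blast
  then obtain P where P: "P \<in> set Ps" "imem P z'" using assms(3) covers_iff c by blast
  have "proj_le C z z'" using ordered xy y z by blast
  then have "in_proj_ideal C P z" using P imem_in_proj_ideal in_proj_ideal_leC by blast
  then show "x \<in> {x \<in> lists \<Sigma>. \<exists>P\<in>set Ps. \<exists>z. (x, z) \<in> trel T \<and> in_proj_ideal C P z}"
    using xy z P by blast
next
  fix x assume "x \<in> {x \<in> lists \<Sigma>. \<exists>P\<in>set Ps. \<exists>z. (x, z) \<in> trel T \<and> in_proj_ideal C P z}"
  then obtain P z where x: "x \<in> lists \<Sigma>" "P \<in> set Ps" "(x, z) \<in> trel T" "in_proj_ideal C P z" by blast
  obtain n where n: "proj_le C z (expn P n)" using in_proj_ideal_expn x(4) by blast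
  have "dense (rep (image_code c)) P" using x(2) assms(3) covers_iff c by blast
  then obtain z' where z': "z' \<in> rep (image_code c)" "subseq (expn P n) z'" unfolding dense_def by blast
  then obtain y where y: "y \<in> rep c" "(y, z') \<in> trel T" using rep_image_code c by blast
  have "r x y" using ordered[of x y z z'] x y c proj_le_trans[OF n subseq_proj_le[OF z'(2)]] by blast
  then show "x \<in> dclo r (rep c)" using y by (auto simp: dclo_def)
qed

end

text \<open>The automaton for the downward closure simulates the transducer together with the tests of one
  ideal. As the transducer may have \<open>\<epsilon>\<close>-moves, its transitions are determined by testing images of
  singletons for emptiness, for which the class must contain some nonempty language.\<close>

locale sup_repr_nonempty = sup_repr +
  fixes c0 :: nat and g0 :: "nat list" and l :: "nat list"
  assumes c0: "c0 \<in> D" "rep c0 \<noteq> {}" "rep c0 \<subseteq> lists (set g0)" and l: "set l = \<Sigma>"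
begin

definition single :: "nat list \<Rightarrow> nat" where
  "single w = apply_code (apply_code c0 (erase_trans g0)) (stair_trans [([], [], [], w)])"

lemma single: "single w \<in> D" "rep (single w) = {w}"
proof -
  have [simp]: "concat (replicate k []) = []" for k by (induction k) auto
  have "rep (apply_code c0 (erase_trans g0)) = {[]}"
    unfolding rep_apply_code[OF c0(1)] wrel_erase_trans using c0(2,3) by (auto simp del: in_lists_conv_set)
  moreover have "wrel (stair_trans [([], [], [], w)]) = {([], w)}"
    unfolding wrel_stair_trans by (auto simp: length_Suc_conv intro: exI[of _ "[0]"])
  moreover have "{([], w)} `` {[]} = {w}" by auto
  ultimately show "single w \<in> D" "rep (single w) = {w}"
    unfolding single_def using c0 by (simp_all add: apply_code_in rep_apply_code)
qed

lemma computable_single [computable_intros]: "computable_on A w \<Longrightarrow> computable_on A (\<lambda>x. single (w x))"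
  unfolding single_def using c0 by (intro computable_apply_code computable_intros computable_comp_UNIV[OF computable_stair_trans]) (auto simp: apply_code_in)

definition transit :: "nat list \<Rightarrow> nat \<times> tests \<Rightarrow> nat list \<Rightarrow> tests list \<Rightarrow> nat" where
  "transit w p F fins = apply_code (apply_code (single w) (subtrans (t_edges T) [fst p] F)) (restrict_tests g (snd p) fins)"

lemma transit_D: "transit w p F fins \<in> D"
  unfolding transit_def by (intro apply_code_in single)

lemma rep_transit: "rep (transit w p F fins) =
    {v. (\<exists>q\<in>set F. trun T (fst p) w v q) \<and> foldl tstep (snd p) v \<in> set fins}"
proof -
  have "v \<in> lists (set g)" if "trun T (fst p) w v q" for v q using trun_over[OF that] .
  then show ?thesis
    unfolding transit_def rep_apply_code[OF apply_code_in[OF single(1)]] rep_apply_code[OF single(1)] single(2)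
      wrel_subtrans wrel_restrict_tests by auto
qed

lemma computable_transit:
  assumes "computable_on A w" "computable_on A p" "computable_on A F" "computable_on A fins"
  shows "decidable_on A (\<lambda>x. rep (transit (w x) (p x) (F x) (fins x)) \<noteq> {})"
proof (rule computable_nonempty[where g="\<lambda>_. g"])
  show "computable_on A (\<lambda>x. transit (w x) (p x) (F x) (fins x))"
    unfolding transit_def using single by (intro computable_apply_code computable_intros assms) (auto simp: apply_code_in)
  show "rep (transit (w x) (p x) (F x) (fins x)) \<subseteq> lists (set g)" for x
    unfolding rep_transit using trun_over by blast
qed (auto intro: transit_D computable_intros)

definition all_alive :: "tests \<Rightarrow> bool" where
  "all_alive s \<longleftrightarrow> (\<forall>t\<in>set s. \<not> snd t = None)"

definition start_all :: "ideal \<Rightarrow> tests" where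
  "start_all P = start (map (\<lambda>A. (A, P)) C)"

lemma all_alive_tstart: "all_alive (foldl tstep (start_all P) z) \<longleftrightarrow> in_proj_ideal C P z"
proof -
  have "all_alive s \<longleftrightarrow> (\<forall>b\<in>set (tflags s). b = 1)" for s
    by (auto simp: all_alive_def tflags_def)
  then show ?thesis unfolding start_all_def by (simp add: tflags_start ideal_flags_def in_proj_ideal_def)
qed

lemma computable_start_all [computable_intros]: "computable_on A P \<Longrightarrow> computable_on A (\<lambda>x. start_all (P x))"
proof -
  assume P: "computable_on A P"
  have "computable_on (A \<times> UNIV) (\<lambda>p. P (fst p))"
    by (rule computable_weaken[OF P])
  then show ?thesis unfolding start_all_def by (intro computable_intros)
qed

text \<open>By \<open>trun_Cons_split\<close> a run may be cut right after each letter is read, so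
  initial states and edge targets are enough.\<close>

definition tgts :: "nat list" where
  "tgts = t_init T @ map (\<lambda>e. snd (snd (snd e))) (t_edges T)"

definition nstates :: "ideal list \<Rightarrow> (nat \<times> tests) list" where
  "nstates Ps = concat (map (\<lambda>P. concat (map (\<lambda>s. map (\<lambda>q. (q, s)) tgts) (tstates (start_all P)))) Ps)"

definition nedges :: "ideal list \<Rightarrow> ((nat \<times> tests) \<times> nat \<times> nat \<times> tests) list" where
  "nedges Ps = filter (\<lambda>e. rep (transit [fst (snd e)] (fst e) [fst (snd (snd e))] [snd (snd (snd e))]) \<noteq> {})
     (concat (map (\<lambda>p. concat (map (\<lambda>a. map (\<lambda>q. (p, a, q)) (nstates Ps)) l)) (nstates Ps)))"

text \<open>After the last letter the transducer may still move silently and write output, so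
  acceptance asks for a closing run on the empty word that ends with all tests passed.\<close>

definition nfins :: "ideal list \<Rightarrow> (nat \<times> tests) list" where
  "nfins Ps = filter (\<lambda>p. rep (transit [] p (t_fin T) (filter all_alive (tstates (snd p)))) \<noteq> {}) (nstates Ps)"

definition ninits :: "ideal list \<Rightarrow> (nat \<times> tests) list" where
  "ninits Ps = concat (map (\<lambda>P. map (\<lambda>q. (q, start_all P)) (t_init T)) Ps)"

definition ncode :: "ideal list \<Rightarrow> nat" where
  "ncode Ps = enc [enc (map enc (ninits Ps)), enc (map enc (nfins Ps)),
     enc (map (\<lambda>e. enc [enc (fst e), fst (snd e), enc (snd (snd e))]) (nedges Ps))]"

lemma computable_ncode: "computable_on UNIV ncode"
proof -
  have st: "computable_on A (\<lambda>x. nstates (f x))" if "computable_on A f" for A and f :: "'z::enc \<Rightarrow> ideal list"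
    unfolding nstates_def by (intro computable_intros that)
  have ed: "computable_on UNIV nedges" unfolding nedges_def by (intro computable_intros computable_transit st)
  have fi: "computable_on UNIV nfins" unfolding nfins_def all_alive_def by (intro computable_intros computable_transit st)
  have ini: "computable_on UNIV ninits" unfolding ninits_def by (intro computable_intros)
  show ?thesis unfolding ncode_def
    by (intro computable_intros computable_enc computable_comp_UNIV[OF ed] computable_comp_UNIV[OF fi] computable_comp_UNIV[OF ini])
qed

lemma dec_nfa_ncode:
  "n_init (dec_nfa (ncode Ps)) = map enc (ninits Ps)"
  "n_fin (dec_nfa (ncode Ps)) = map enc (nfins Ps)"
  "n_edges (dec_nfa (ncode Ps)) = map (\<lambda>e. (enc (fst e), fst (snd e), enc (snd (snd e)))) (nedges Ps)"
  by (auto simp: dec_nfa_def ncode_def dec_nedge_def getd_def enc_nat_list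
      simp del: enc_Cons enc_Nil enc_Pair)

lemma nstates_iff: "(q, s) \<in> set (nstates Ps) \<longleftrightarrow> q \<in> set tgts \<and> (\<exists>P\<in>set Ps. s \<in> set (tstates (start_all P)))"
  unfolding nstates_def by auto

lemma nedges_iff: "(p, a, q) \<in> set (nedges Ps) \<longleftrightarrow> p \<in> set (nstates Ps) \<and> a \<in> \<Sigma> \<and> q \<in> set (nstates Ps) \<and>
    (\<exists>v. trun T (fst p) [a] v (fst q) \<and> foldl tstep (snd p) v = snd q)"
  unfolding nedges_def by (auto simp: rep_transit l)

lemma nfins_iff: "p \<in> set (nfins Ps) \<longleftrightarrow> p \<in> set (nstates Ps) \<and>
    (\<exists>v. \<exists>f\<in>set (t_fin T). trun T (fst p) [] v f \<and> all_alive (foldl tstep (snd p) v))"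
  unfolding nfins_def using tstates_foldl[OF tstates_refl] by (auto simp: rep_transit)

text \<open>An edge absorbs the silent moves before its letter and \<open>nfins\<close> those after
  the last one. With the run of \<open>T\<close> cut right after each reading edge, the two kinds of
  runs correspond letter by letter.\<close>

lemma nrun_iff:
  assumes "p \<in> set (nstates Ps)"
  shows "(\<exists>f\<in>set (n_fin (dec_nfa (ncode Ps))). nrun (dec_nfa (ncode Ps)) (enc p) x f) \<longleftrightarrow>
    x \<in> lists \<Sigma> \<and> (\<exists>v. \<exists>f\<in>set (t_fin T). trun T (fst p) x v f \<and> all_alive (foldl tstep (snd p) v))"
  using assms
proof (induction x arbitrary: p)
  case Nil
  have "nrun A (enc p) [] f \<longleftrightarrow> f = enc p" for A f
    by (auto intro: nrun_nil elim: nrun.cases)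
  then have "(\<exists>f\<in>set (n_fin (dec_nfa (ncode Ps))). nrun (dec_nfa (ncode Ps)) (enc p) [] f) \<longleftrightarrow>
      p \<in> set (nfins Ps)" unfolding dec_nfa_ncode(2) by (auto simp del: enc_Pair)
  then show ?case using Nil by (simp add: nfins_iff)
next
  case (Cons a x)
  let ?A = "dec_nfa (ncode Ps)"
  have "(\<exists>f\<in>set (n_fin ?A). nrun ?A (enc p) (a # x) f) \<longleftrightarrow>
      (\<exists>q'. (enc p, a, q') \<in> set (n_edges ?A) \<and> (\<exists>f\<in>set (n_fin ?A). nrun ?A q' x f))"
    by (blast intro: nrun_step elim: nrun.cases)
  also have "\<dots> \<longleftrightarrow> (\<exists>q. (p, a, q) \<in> set (nedges Ps) \<and> (\<exists>f\<in>set (n_fin ?A). nrun ?A (enc q) x f))"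
    unfolding dec_nfa_ncode(3) by (force simp del: enc_Pair)
  also have "\<dots> \<longleftrightarrow> (\<exists>q. (p, a, q) \<in> set (nedges Ps) \<and> x \<in> lists \<Sigma> \<and>
      (\<exists>v. \<exists>f\<in>set (t_fin T). trun T (fst q) x v f \<and> all_alive (foldl tstep (snd q) v)))"
    using Cons.IH nedges_iff by blast
  also have "\<dots> \<longleftrightarrow> a # x \<in> lists \<Sigma> \<and>
      (\<exists>v. \<exists>f\<in>set (t_fin T). trun T (fst p) (a # x) v f \<and> all_alive (foldl tstep (snd p) v))"
    (is "?l \<longleftrightarrow> ?r")
  proof
    assume ?l
    then obtain q v f where q: "(p, a, q) \<in> set (nedges Ps)" "x \<in> lists \<Sigma>" "f \<in> set (t_fin T)"
      "trun T (fst q) x v f" "all_alive (foldl tstep (snd q) v)" by blast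
    then obtain v' where "a \<in> \<Sigma>" "trun T (fst p) [a] v' (fst q)" "foldl tstep (snd p) v' = snd q"
      unfolding nedges_iff by blast
    moreover from trun_append[OF this(2) q(4)] have "trun T (fst p) (a # x) (v' @ v) f" by simp
    ultimately show ?r using q by (intro conjI exI[of _ "v' @ v"]) auto
  next
    assume r: ?r
    then obtain v f where v: "f \<in> set (t_fin T)" "trun T (fst p) (a # x) v f" "all_alive (foldl tstep (snd p) v)"
      by blast
    obtain q v1 v2 where q: "v = v1 @ v2" "trun T (fst p) [a] v1 q" "trun T q x v2 f" "q \<in> set tgts"
      using trun_Cons_split[OF v(2)] unfolding tgts_def by auto
    let ?q = "(q, foldl tstep (snd p) v1)"
    have "?q \<in> set (nstates Ps)"
      using Cons.prems q(4) tstates_foldl nstates_iff[of "fst p" "snd p"] unfolding nstates_iff prod.collapse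
      by blast
    then have "(p, a, ?q) \<in> set (nedges Ps)" unfolding nedges_iff using Cons.prems r q by auto
    moreover have "all_alive (foldl tstep (snd ?q) v2)" using v(3) q(1) by simp
    ultimately show ?l using r v(1) q(3) by (intro exI[of _ ?q]) auto
  qed
  finally show ?case .
qed

lemma nlang_ncode:
  "nlang (dec_nfa (ncode Ps)) = {x \<in> lists \<Sigma>. \<exists>P\<in>set Ps. \<exists>z. (x, z) \<in> trel T \<and> in_proj_ideal C P z}"
proof -
  have init: "(q, start_all P) \<in> set (nstates Ps)" if "q \<in> set (t_init T)" "P \<in> set Ps" for q P
    using that tstates_refl by (auto simp: nstates_iff tgts_def)
  have "x \<in> nlang (dec_nfa (ncode Ps)) \<longleftrightarrow> (\<exists>P\<in>set Ps. \<exists>q\<in>set (t_init T).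
      \<exists>f\<in>set (n_fin (dec_nfa (ncode Ps))). nrun (dec_nfa (ncode Ps)) (enc (q, start_all P)) x f)" for x
    unfolding nlang_def dec_nfa_ncode(1) ninits_def by auto
  also have "\<dots> x \<longleftrightarrow> (\<exists>P\<in>set Ps. \<exists>q\<in>set (t_init T). x \<in> lists \<Sigma> \<and>
      (\<exists>v. \<exists>f\<in>set (t_fin T). trun T q x v f \<and> in_proj_ideal C P v))" for x
    using nrun_iff[OF init] by (simp add: all_alive_tstart)
  finally show ?thesis unfolding trel_def by blast
qed

theorem dclo: "dclo_computable D rep \<Sigma> r"
proof -
  let ?A = "{c \<in> D. rep c \<subseteq> lists \<Sigma>}"
  have "decidable_on (?A \<times> UNIV) (\<lambda>p. covers (fst p) (snd p))"
    by (intro computable_covers computable_intros) auto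
  then obtain F where F: "computable_on ?A F" "\<And>c. c \<in> ?A \<Longrightarrow> covers c (F c)"
    using computable_search[of ?A covers] covers_ex by blast
  obtain p where p: "\<And>c. c \<in> ?A \<Longrightarrow> eval p [enc c] (enc (ncode (F c)))"
    using computable_comp_UNIV[OF computable_ncode F(1)] unfolding computable_on_def by blast
  have "eval p [c] (ncode (F c)) \<and> nlang (dec_nfa (ncode (F c))) = dclo r (rep c)"
    if "c \<in> D" "rep c \<subseteq> lists \<Sigma>" for c
    using p[of c] F(2)[of c] that unfolding nlang_ncode by (simp add: dclo_covers)
  then show ?thesis unfolding dclo_computable_def by blast
qed

end

text \<open>Taking for \<open>g\<close> the letters written on the edges of \<open>T\<close> also
  covers runs that cannot be completed to accepting ones.\<close>

lemma represented_outputs: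
  assumes "represented \<Sigma> r T g C"
  shows "\<exists>g. represented \<Sigma> r T g C \<and> (\<forall>p u v q. trun T p u v q \<longrightarrow> v \<in> lists (set g))"
proof -
  let ?g = "concat (map (\<lambda>e. ocons (fst (snd (snd e))) []) (t_edges T))"
  have out: "v \<in> lists (set ?g)" if "trun T p u v q" for p u v q
    using that
  proof induction
    case (trun_step p a b q u v r)
    have "set (ocons b []) \<subseteq> set ?g" using trun_step.hyps(1) by force
    then show ?case using trun_step.IH by (cases b) auto
  qed simp
  interpret represented \<Sigma> r T g C by fact
  have "represented \<Sigma> r T ?g C"
  proof
    show "finite \<Sigma>" by (rule finite_alphabet)
    show "\<exists>z. (u, z) \<in> trel T" if "u \<in> lists \<Sigma>" for u using that by (rule total)
    show "z \<in> lists (set ?g)" if "(u, z) \<in> trel T" for u z using that out unfolding trel_def by blast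
    show "r u v \<longleftrightarrow> proj_le C z z'" if "u \<in> lists \<Sigma>" "v \<in> lists \<Sigma>" "(u, z) \<in> trel T" "(v, z') \<in> trel T" for u v z z'
      using that by (rule ordered)
    show "u \<in> lists \<Sigma> \<and> v \<in> lists \<Sigma>" if "r u v" for u v using that by (rule words)
  qed
  with out show ?thesis by blast
qed

context sup_trio
begin

theorem SUP_imp_sep: assumes "pwqo \<Sigma> r" shows "sep_decidable D rep \<Sigma> r"
proof -
  obtain T g C where "represented \<Sigma> r T g C" "\<forall>p u v q. trun T p u v q \<longrightarrow> v \<in> lists (set g)"
    using pwqo_represented[OF assms] represented_outputs by blast
  then interpret represented \<Sigma> r T g C + sup_repr D rep \<Sigma> r T g C
    by (auto intro!: sup_repr.intro sup_repr_axioms.intro sup_trio_axioms)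
  show ?thesis by (rule sep)
qed

theorem SUP_imp_dclo: assumes "pwqo \<Sigma> r" shows "dclo_computable D rep \<Sigma> r"
proof (cases "\<exists>c\<in>D. rep c \<noteq> {}")
  case True
  then obtain c0 g0 where c0: "c0 \<in> D" "rep c0 \<noteq> {}" "rep c0 \<subseteq> lists (set g0)"
    using rep_finite by blast
  obtain T g C where R: "represented \<Sigma> r T g C" "\<forall>p u v q. trun T p u v q \<longrightarrow> v \<in> lists (set g)"
    using pwqo_represented[OF assms] represented_outputs by blast
  interpret represented \<Sigma> r T g C by fact
  obtain l where l: "set l = \<Sigma>" using finite_alphabet finite_list by blast
  interpret sup_repr_nonempty D rep \<Sigma> r T g C c0 g0 l
    using R c0 l by (auto intro!: sup_repr_nonempty.intro sup_repr.intro sup_repr_axioms.intro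
        sup_repr_nonempty_axioms.intro sup_trio_axioms)
  show ?thesis by (rule dclo)
next
  case False
  \<comment> \<open>If all languages are empty, so are all closures; the number 0 decodes to an
    automaton without initial states.\<close>
  have "eval Z [c] 0 \<and> nlang (dec_nfa 0) = dclo r (rep c)" if "c \<in> D" for c
    using False that by (auto simp: eval_Z nlang_def dec_nfa_def dclo_def getd_def)
  then show ?thesis unfolding dclo_computable_def by blast
qed

end

subsection \<open>From downward closures or separability to simultaneous unboundedness\<close>

text \<open>A unary encoding of a vector with end markers: vectors of every length live over the
  same two letters, hence under one ordering.\<close>

definition block_word :: "nat list \<Rightarrow> nat list" where
  "block_word ks = concat (map (\<lambda>k. replicate k 0 @ [1]) ks)"

lemma block_word_simps [simp]: "block_word [] = []" "block_word (k # ks) = replicate k 0 @ 1 # block_word ks"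
  by (simp_all add: block_word_def)

lemma block_word_over: "block_word ks \<in> lists {0, 1}"
  by (induction ks) auto

lemma count_block_word: "length (filter (\<lambda>a. a = 1) (block_word ks)) = length ks"
  by (induction ks) auto

text \<open>Both sides contain the same number of markers, so an embedding has to match them in
  order and cannot spend a marker of the right side on anything else.\<close>

lemma subseq_block_iff:
  assumes "length (filter (\<lambda>a. a = 1) X) = length (filter (\<lambda>a. a = 1) Y)"
  shows "subseq (replicate k (0::nat) @ 1 # X) (replicate m 0 @ 1 # Y) \<Longrightarrow> k \<le> m \<and> subseq X Y"
proof (induction m arbitrary: k)
  case 0
  show ?case
  proof (cases k)
    case (Suc k')
    with 0 have "subseq (replicate k 0 @ 1 # X) Y" by auto
    from list_emb_length[OF subseq_filter[OF this, of "\<lambda>a. a = 1"]]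
    have "length (filter (\<lambda>a. a = 1) (replicate k 0 @ 1 # X)) \<le> length (filter (\<lambda>a. a = 1) Y)" .
    then show ?thesis using assms by simp
  qed (use 0 in auto)
next
  case (Suc m)
  show ?case
  proof (cases k)
    case 0
    then show ?thesis using Suc.prems Suc.IH[of 0] by auto
  next
    case (Suc k')
    then show ?thesis using Suc.prems Suc.IH[of k'] by auto
  qed
qed

lemma subseq_replicate_mono: "k \<le> m \<Longrightarrow> subseq (replicate k a) (replicate m a)"
  by (metis le_add_diff_inverse replicate_add subseq_rev_drop_many subseq_order.refl)

lemma subseq_block_word_iff: "length ks = length ms \<Longrightarrow> subseq (block_word ks) (block_word ms) \<longleftrightarrow> list_all2 (\<le>) ks ms"
proof (induction ks ms rule: list_induct2)
  case (Cons k ks m ms)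
  have "subseq (block_word (k # ks)) (block_word (m # ms)) \<longleftrightarrow> k \<le> m \<and> subseq (block_word ks) (block_word ms)"
  proof
    assume "subseq (block_word (k # ks)) (block_word (m # ms))"
    then show "k \<le> m \<and> subseq (block_word ks) (block_word ms)"
      using Cons.hyps by (simp only: block_word_simps) (rule subseq_block_iff, simp_all only: count_block_word)
  next
    assume "k \<le> m \<and> subseq (block_word ks) (block_word ms)"
    then show "subseq (block_word (k # ks)) (block_word (m # ms))"
      by (auto intro!: list_emb_append_mono subseq_replicate_mono)
  qed
  then show ?case using Cons.IH by simp
qed simp

text \<open>Cut \<open>w\<close> along the blocks that host it. Each piece of zeros is no longer
  than \<open>w\<close> itself and therefore fits into any block of length at least
  \<open>length w\<close>.\<close>

lemma subseq_block_word_large: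
  "subseq w (block_word ks) \<Longrightarrow> length ms = length ks \<Longrightarrow> \<forall>m\<in>set ms. length w \<le> m \<Longrightarrow> subseq w (block_word ms)"
proof (induction ks arbitrary: w ms)
  case (Cons k ks)
  then obtain m ms' where ms: "ms = m # ms'" "length ms' = length ks" by (cases ms) auto
  have "subseq w (replicate k 0 @ [1] @ block_word ks)" using Cons.prems by simp
  then obtain w1 v where w: "w = w1 @ v" "subseq w1 (replicate k 0)" "subseq v ([1] @ block_word ks)"
    by (rule subseq_appendE)
  from w(3) obtain w2 w3 where v: "v = w2 @ w3" "subseq w2 [1]" "subseq w3 (block_word ks)"
    by (rule subseq_appendE)
  have "set w1 \<subseteq> set (replicate k (0::nat))"
    using w(2) by (auto dest: subseq_order.trans simp flip: subseq_singleton_left)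
  then have "\<forall>x\<in>set w1. x = 0" by (auto simp: set_replicate_conv_if split: if_splits)
  then have "w1 = replicate (length w1) 0" by (simp add: replicate_length_same)
  moreover have "length w1 \<le> m" using Cons.prems(3) ms w(1) by simp
  ultimately have "subseq w1 (replicate m 0)" using subseq_replicate_mono by metis
  moreover have "subseq w3 (block_word ms')" by (rule Cons.IH[OF v(3) ms(2)]) (use Cons.prems(3) ms w v in auto)
  ultimately have "subseq (w1 @ w2 @ w3) (replicate m 0 @ [1] @ block_word ms')"
    using v(2) by (intro list_emb_append_mono)
  then show ?case using w v ms by simp
qed auto

section \<open>Exponent vectors below a language and simultaneous unboundedness\<close>

definition powers :: "nat list \<Rightarrow> nat list \<Rightarrow> nat list" where
  "powers as ks = concat (map2 replicate ks as)"

lemma powers_mono: "list_all2 (\<le>) ks ms \<Longrightarrow> subseq (powers as ks) (powers as ms)"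
  unfolding powers_def
proof (induction arbitrary: as rule: list_all2_induct)
  case (Cons k ks m ms)
  then show ?case by (cases as) (auto intro!: list_emb_append_mono subseq_replicate_mono)
qed simp

text \<open>The letters in \<open>as\<close> may repeat, so a word does not determine its exponents;
  all vectors whose word lies below \<open>L\<close> are collected instead.\<close>

definition exponents :: "nat list \<Rightarrow> nat list set \<Rightarrow> nat list set" where
  "exponents as L = {ks. length ks = length as \<and> (\<exists>u\<in>L. subseq (powers as ks) u)}"

text \<open>By \<open>powers_mono\<close> a vector that exceeds the maximum of \<open>ks\<close> in
  every entry dominates \<open>ks\<close>, so vectors with uniformly large entries suffice.\<close>

lemma SUP_iff_unbounded:
  "blang as \<subseteq> dclo subseq L \<longleftrightarrow> (\<forall>N. \<exists>ks\<in>exponents as L. \<forall>k\<in>set ks. N \<le> k)" (is "?l \<longleftrightarrow> ?r")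
proof
  assume l: ?l
  show ?r
  proof
    fix N
    have "powers as (replicate (length as) N) \<in> blang as"
      unfolding blang_def powers_def mem_Collect_eq
      by (intro exI[of _ "replicate (length as) N"] conjI refl) simp
    then have "replicate (length as) N \<in> exponents as L"
      using l by (auto simp: exponents_def dclo_def)
    then show "\<exists>ks\<in>exponents as L. \<forall>k\<in>set ks. N \<le> k" by (rule bexI[rotated]) simp
  qed
next
  assume r: ?r
  show ?l
  proof
    fix w assume "w \<in> blang as"
    then obtain ks where ks: "length ks = length as" "w = powers as ks"
      by (auto simp: blang_def powers_def)
    obtain ms where ms: "ms \<in> exponents as L" "\<forall>m\<in>set ms. Max (insert 0 (set ks)) \<le> m"
      using r by blast
    have "list_all2 (\<le>) ks ms" unfolding list_all2_conv_all_nth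
    proof (intro conjI allI impI)
      show len: "length ks = length ms" using ks ms by (simp add: exponents_def)
      fix i assume i: "i < length ks"
      have "ks ! i \<le> Max (insert 0 (set ks))" using i by simp
      also have "\<dots> \<le> ms ! i" using ms(2) i len by simp
      finally show "ks ! i \<le> ms ! i" .
    qed
    from powers_mono[OF this] ms(1) ks(2) show "w \<in> dclo subseq L"
      unfolding exponents_def dclo_def using subseq_order.trans by blast
  qed
qed

definition r01 :: "nat list \<Rightarrow> nat list \<Rightarrow> bool" where
  "r01 u v \<longleftrightarrow> u \<in> lists {0, 1} \<and> v \<in> lists {0, 1} \<and> subseq u v"

lemma pwqo_r01: "pwqo {0, 1} r01"
proof -
  have "pwqo {0, 1} (\<lambda>u v. u \<in> lists {0, 1} \<and> v \<in> lists {0, 1} \<and> subseq u v)"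
    by (rule pwqo_subword) simp
  moreover have "r01 = (\<lambda>u v. u \<in> lists {0, 1} \<and> v \<in> lists {0, 1} \<and> subseq u v)"
    unfolding r01_def by (rule refl)
  ultimately show ?thesis by simp
qed

lemma stair_blocks:
  "stair_in (map (\<lambda>a. ([a], v, [], y)) as) ks = powers as ks"
  "stair_in (map (\<lambda>a. ([], v, [], y)) as) ks = []"
proof -
  have [simp]: "concat (replicate k [a]) = replicate k a" "concat (replicate k []) = ([] :: nat list)"
    for k and a :: nat by (induction k) auto
  show "stair_in (map (\<lambda>a. ([a], v, [], y)) as) ks = powers as ks"
    unfolding powers_def by (induction as ks rule: list_induct2') auto
  show "stair_in (map (\<lambda>a. ([], v, [], y)) as) ks = []"
    by (induction as ks rule: list_induct2') auto
qed

lemma stair_out_blocks: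
  assumes "length ks = length as"
  shows "stair_out (map (\<lambda>a. (f a, replicate i 0, [], replicate j 0 @ [1])) as) ks = block_word (map (\<lambda>k. i * k + j) ks)"
proof -
  have "concat (replicate k (replicate i 0)) = replicate (i * k) 0" for k
    by (induction k) (auto simp flip: replicate_add)
  then have 1: "concat (replicate k (replicate i 0)) @ replicate j 0 @ z = replicate (i * k + j) 0 @ z" for k z
    by (simp add: replicate_add)
  show ?thesis using assms[symmetric]
    by (induction as ks rule: list_induct2) (simp_all add: 1)
qed

context trio
begin

text \<open>The factor \<open>i\<close> will be 1 for downward closures and 2 for separability,
  where the exponents have to be even.\<close>

definition exponent_code :: "nat \<Rightarrow> nat list \<Rightarrow> nat \<Rightarrow> nat" where
  "exponent_code c as i = apply_code (apply_code c (down_trans as)) (stair_trans (map (\<lambda>a. ([a], replicate i 0, [], replicate 0 0 @ [1])) as))"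

text \<open>The words with odd exponents do not depend on \<open>c\<close>, but the class need not
  offer them directly: \<open>c\<close> is erased to the empty word and they are written from there.
  This works only if \<open>rep c\<close> is nonempty.\<close>

definition odd_code :: "nat \<Rightarrow> nat list \<Rightarrow> nat" where
  "odd_code c as = apply_code (apply_code c (erase_trans as)) (stair_trans (map (\<lambda>a. ([], replicate 2 0, [], replicate 1 0 @ [1])) as))"

lemma blang_over: "blang as \<subseteq> lists (set as)"
  unfolding blang_def by (auto dest!: set_zip_rightD)

lemma exponent_code_in: "c \<in> D \<Longrightarrow> exponent_code c as i \<in> D" and odd_code_in: "c \<in> D \<Longrightarrow> odd_code c as \<in> D"
  unfolding exponent_code_def odd_code_def by (intro apply_code_in; assumption)+

lemma rep_exponent_code:
  assumes "c \<in> D" "rep c \<subseteq> blang as"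
  shows "rep (exponent_code c as i) = {block_word (map (\<lambda>k. i * k) ks) |ks. ks \<in> exponents as (rep c)}"
proof -
  have "rep c \<subseteq> lists (set as)" using assms(2) blang_over by blast
  then have down: "rep (apply_code c (down_trans as)) = {v. \<exists>u\<in>rep c. subseq v u}"
    unfolding rep_apply_code[OF assms(1)] wrel_down_trans by (auto simp del: in_lists_conv_set)
  have "(v, w) \<in> wrel (stair_trans (map (\<lambda>a. ([a], replicate i 0, [], replicate 0 0 @ [1])) as)) \<longleftrightarrow>
      (\<exists>ks. length ks = length as \<and> v = powers as ks \<and> w = block_word (map (\<lambda>k. i * k) ks))" for v w
    unfolding wrel_stair_trans stair_blocks
    using stair_out_blocks[of _ as "\<lambda>a. [a]" i 0] by (auto simp del: replicate_0 append_Nil)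
  then have "w \<in> rep (exponent_code c as i) \<longleftrightarrow> (\<exists>v. (\<exists>u\<in>rep c. subseq v u) \<and>
      (\<exists>ks. length ks = length as \<and> v = powers as ks \<and> w = block_word (map (\<lambda>k. i * k) ks)))" for w
    unfolding exponent_code_def rep_apply_code[OF apply_code_in[OF assms(1)]] down by (simp only: Image_iff Bex_def mem_Collect_eq)
  then show ?thesis unfolding exponents_def by blast
qed

lemma rep_odd_code:
  assumes "c \<in> D" "rep c \<subseteq> blang as"
  shows "rep (odd_code c as) = (if rep c = {} then {} else {block_word (map (\<lambda>k. 2 * k + 1) ks) |ks. length ks = length as})"
proof -
  have "rep c \<subseteq> lists (set as)" using assms(2) blang_over by blast
  then have eras: "rep (apply_code c (erase_trans as)) = (if rep c = {} then {} else {[]})"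
    unfolding rep_apply_code[OF assms(1)] wrel_erase_trans by (auto simp del: in_lists_conv_set)
  have "(v, w) \<in> wrel (stair_trans (map (\<lambda>a. ([], replicate 2 0, [], replicate 1 0 @ [1])) as)) \<longleftrightarrow>
      (\<exists>ks. length ks = length as \<and> v = [] \<and> w = block_word (map (\<lambda>k. 2 * k + 1) ks))" for v w
    unfolding wrel_stair_trans stair_blocks
    using stair_out_blocks[of _ as "\<lambda>a. []" 2 1] by (auto simp del: replicate_Suc One_nat_def)
  then have "wrel (stair_trans (map (\<lambda>a. ([], replicate 2 0, [], replicate 1 0 @ [1])) as)) `` {[]} =
      {block_word (map (\<lambda>k. 2 * k + 1) ks) |ks. length ks = length as}"
    by (simp add: Image_singleton) blast
  then show ?thesis
    unfolding odd_code_def rep_apply_code[OF apply_code_in[OF assms(1)]] eras by simp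
qed

lemma rep_expo_over: "c \<in> D \<Longrightarrow> rep c \<subseteq> blang as \<Longrightarrow> rep (exponent_code c as i) \<subseteq> lists {0, 1}"
  unfolding rep_exponent_code using block_word_over by blast

lemma rep_regu_over: "c \<in> D \<Longrightarrow> rep c \<subseteq> blang as \<Longrightarrow> rep (odd_code c as) \<subseteq> lists {0, 1}"
  unfolding rep_odd_code using block_word_over by (simp del: in_lists_conv_set) blast

lemma computable_exponent_code: "computable_on A c \<Longrightarrow> computable_on A as \<Longrightarrow> (\<And>x. x \<in> A \<Longrightarrow> c x \<in> D) \<Longrightarrow> computable_on A (\<lambda>x. exponent_code (c x) (as x) i)"
  unfolding exponent_code_def
  by (intro computable_apply_code computable_comp_UNIV[OF computable_down_trans] computable_comp_UNIV[OF computable_stair_trans] computable_intros apply_code_in)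

lemma computable_odd_code: "computable_on A c \<Longrightarrow> computable_on A as \<Longrightarrow> (\<And>x. x \<in> A \<Longrightarrow> c x \<in> D) \<Longrightarrow> computable_on A (\<lambda>x. odd_code (c x) (as x))"
  unfolding odd_code_def
  by (intro computable_apply_code computable_comp_UNIV[OF computable_erase_trans] computable_comp_UNIV[OF computable_stair_trans] computable_intros apply_code_in)

lemma SUP_decidableI:
  assumes "decidable_on {(c, as). c \<in> D \<and> rep c \<subseteq> blang as} (\<lambda>x. blang (snd x) \<subseteq> dclo subseq (rep (fst x)))"
  shows "SUP_decidable D rep"
proof -
  obtain p where p: "\<And>x. x \<in> {(c, as). c \<in> D \<and> rep c \<subseteq> blang as} \<Longrightarrow>
      eval p [enc x] (enc (of_bool (blang (snd x) \<subseteq> dclo subseq (rep (fst x))) :: nat))"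
    using assms unfolding computable_on_def by blast
  have "eval p [prod_encode (c, list_encode as)] (if blang as \<subseteq> dclo subseq (rep c) then 1 else 0)"
    if "c \<in> D" "rep c \<subseteq> blang as" for c as
    using p[of "(c, as)"] that
    by (simp only: enc_Pair enc_nat_def enc_nat_list fst_conv snd_conv mem_Collect_eq prod.case simp_thms of_bool_def)
  then show ?thesis unfolding SUP_decidable_def by blast
qed

end

section \<open>Pumping in finite automata and the SUP from downward closures\<close>

lemma nrun_append: "nrun A p u q \<Longrightarrow> nrun A q v r \<Longrightarrow> nrun A p (u @ v) r"
  by (induction rule: nrun.induct) (auto intro: nrun_step)

lemma nrun_append_split: "nrun A p (u @ v) r \<Longrightarrow> \<exists>q. nrun A p u q \<and> nrun A q v r"
proof (induction u arbitrary: p)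
  case (Cons a u)
  then obtain q where "(p, a, q) \<in> set (n_edges A)" "nrun A q (u @ v) r" by (auto elim: nrun.cases)
  with Cons.IH[of q] show ?case by (blast intro: nrun_step)
qed (auto intro: nrun_nil)

lemma nrun_replicate_states:
  "nrun A p (replicate N a) q \<Longrightarrow> \<exists>s. s 0 = p \<and> s N = q \<and> (\<forall>i<N. (s i, a, s (Suc i)) \<in> set (n_edges A))"
proof (induction N arbitrary: p)
  case 0
  then show ?case by (auto elim: nrun.cases)
next
  case (Suc N)
  then obtain q' where e: "(p, a, q') \<in> set (n_edges A)" "nrun A q' (replicate N a) q" by (auto elim: nrun.cases)
  from Suc.IH[OF e(2)] obtain s where
    s: "s 0 = q'" "s N = q" "\<forall>i<N. (s i, a, s (Suc i)) \<in> set (n_edges A)" by blast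
  let ?s = "\<lambda>i. case i of 0 \<Rightarrow> p | Suc j \<Rightarrow> s j"
  have "(?s i, a, ?s (Suc i)) \<in> set (n_edges A)" if "i < Suc N" for i
    using that e s by (cases i) auto
  then show ?case using s(2) by (intro exI[of _ ?s]) auto
qed

lemma nrun_pump:
  assumes "nrun A p (replicate N a) q" "length (n_edges A) < N"
  shows "\<exists>M\<ge>m. nrun A p (replicate M a) q"
proof -
  obtain s where s: "s 0 = p" "s N = q" "\<And>i. i < N \<Longrightarrow> (s i, a, s (Suc i)) \<in> set (n_edges A)"
    using nrun_replicate_states[OF assms(1)] by blast
  have run: "nrun A (s i) (replicate (j - i) a) (s j)" if "i \<le> j" "j \<le> N" for i j
    using that
  proof (induction rule: dec_induct)
    case (step j)
    have "nrun A (s j) [a] (s (Suc j))" using s(3)[of j] step by (auto intro: nrun_step nrun_nil)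
    from nrun_append[OF step.IH this] step show ?case
      by (simp add: Suc_diff_le replicate_append_same)
  qed (simp add: nrun_nil)
  \<comment> \<open>Each of the first \<open>N\<close> states has an outgoing edge, so there are at
    most as many of them as edges; this is the origin of the pumping threshold.\<close>
  have "s ` {..<N} \<subseteq> fst ` set (n_edges A)" using s(3) by force
  then have "card (s ` {..<N}) \<le> card (fst ` set (n_edges A))" by (intro card_mono) auto
  also have "\<dots> \<le> card (set (n_edges A))" by (rule card_image_le) simp
  also have "\<dots> \<le> length (n_edges A)" by (rule card_length)
  finally have "\<not> inj_on s {..<N}" using assms(2) card_image[of s "{..<N}"] by auto
  then obtain i' j' where ij': "i' \<noteq> j'" "i' < N" "j' < N" "s i' = s j'" by (auto simp: inj_on_def)
  obtain i j where ij: "i < j" "j < N" "s i = s j"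
    using ij' by (cases "i' < j'") (metis, metis nat_neq_iff)
  have loop: "nrun A (s i) (replicate (m * (j - i)) a) (s i)" for m
  proof (induction m)
    case (Suc m)
    have "nrun A (s i) (replicate (j - i) a) (s i)" using run[of i j] ij by simp
    from nrun_append[OF this Suc] show ?case by (simp add: replicate_add)
  qed (simp add: nrun_nil)
  have "nrun A p (replicate i a @ replicate (m * (j - i)) a @ replicate (N - i) a) q"
    using run[of 0 i] run[of i N] ij s(1,2) loop by (intro nrun_append[of _ _ _ "s i"]) auto
  then have run': "nrun A p (replicate (i + m * (j - i) + (N - i)) a) q" by (simp add: replicate_add)
  have "1 \<le> j - i" using ij by linarith
  then have le: "m \<le> m * (j - i)" by simp
  have "m \<le> i + m * (j - i) + (N - i)" by (rule le_trans[OF le]) simp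
  with run' show ?thesis by blast
qed

lemma nrun_block_word_pump:
  assumes "length (n_edges A) < N"
  shows "nrun A p (block_word (replicate n N)) q \<Longrightarrow>
    \<exists>ms. length ms = n \<and> (\<forall>k\<in>set ms. m \<le> k) \<and> nrun A p (block_word ms) q"
proof (induction n arbitrary: p)
  case (Suc n)
  have "nrun A p (replicate N 0 @ [1] @ block_word (replicate n N)) q" using Suc.prems by simp
  then obtain q1 q2 where q: "nrun A p (replicate N 0) q1" "nrun A q1 [1] q2" "nrun A q2 (block_word (replicate n N)) q"
    using nrun_append_split by metis
  obtain M where M: "m \<le> M" "nrun A p (replicate M 0) q1" using nrun_pump[OF q(1) assms] by blast
  obtain ms where ms: "length ms = n" "\<forall>k\<in>set ms. m \<le> k" "nrun A q2 (block_word ms) q" using Suc.IH[OF q(3)] by blast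
  have "nrun A p (block_word (M # ms)) q" using nrun_append[OF M(2) nrun_append[OF q(2) ms(3)]] by simp
  then show ?case using M(1) ms by (intro exI[of _ "M # ms"]) auto
qed auto

text \<open>The subset simulation, written with folds over lists so that acceptance of a given word
  is visibly computable.\<close>

definition nreach :: "nfa \<Rightarrow> nat list \<Rightarrow> nat list" where
  "nreach A w = fold (\<lambda>a R. concat (map (\<lambda>e. if fst e \<in> set R \<and> fst (snd e) = a
     then [snd (snd e)] else []) (n_edges A))) w (n_init A)"

lemma nreach_iff: "q \<in> set (nreach A w) \<longleftrightarrow> (\<exists>p\<in>set (n_init A). nrun A p w q)"
proof -
  let ?f = "\<lambda>a R. concat (map (\<lambda>e. if fst e \<in> set R \<and> fst (snd e) = a
     then [snd (snd e)] else []) (n_edges A))"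
  have "q \<in> set (fold ?f w I) \<longleftrightarrow> (\<exists>p\<in>set I. nrun A p w q)" for I
  proof (induction w arbitrary: I)
    case Nil
    show ?case by (auto intro: nrun_nil elim: nrun.cases)
  next
    case (Cons a w)
    have step: "q' \<in> set (?f a I) \<longleftrightarrow> (\<exists>p\<in>set I. (p, a, q') \<in> set (n_edges A))" for q'
      by force
    have "q \<in> set (fold ?f (a # w) I) \<longleftrightarrow> (\<exists>p\<in>set (?f a I). nrun A p w q)"
      using Cons.IH[of "?f a I"] by (simp del: set_concat)
    also have "\<dots> \<longleftrightarrow> (\<exists>q'. (\<exists>p\<in>set I. (p, a, q') \<in> set (n_edges A)) \<and> nrun A q' w q)"
      unfolding Bex_def[of "set (?f a I)"] step by blast
    also have "\<dots> \<longleftrightarrow> (\<exists>p\<in>set I. nrun A p (a # w) q)"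
      by (blast intro: nrun_step elim: nrun.cases)
    finally show ?case .
  qed
  then show ?thesis by (simp add: nreach_def)
qed

text \<open>Every exponent is one more than the number of edges, the least value for which
  \<open>nrun_pump\<close> applies to each block.\<close>

definition big_word_accepted :: "nat list \<Rightarrow> nat \<Rightarrow> bool" where
  "big_word_accepted as y \<longleftrightarrow> (\<exists>q\<in>set (nreach (dec_nfa y)
     (concat (map (\<lambda>_. replicate (Suc (length (n_edges (dec_nfa y)))) 0 @ [1]) as))). q \<in> set (n_fin (dec_nfa y)))"

lemma computable_getd [computable_intros]: "computable_on A f \<Longrightarrow> computable_on A (\<lambda>x. getd (f x) i)"
proof -
  have "getd xs i = (case drop i xs of [] \<Rightarrow> 0 | y # ys \<Rightarrow> y)" for xs
    by (cases "i < length xs") (auto simp: getd_def Cons_nth_drop_Suc[symmetric])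
  then show "computable_on A f \<Longrightarrow> computable_on A (\<lambda>x. getd (f x) i)" by (simp only:) (intro computable_intros)
qed

lemma computable_list_decode [computable_intros]: "computable_on A f \<Longrightarrow> computable_on A (\<lambda>x. list_decode (f x))"
proof -
  have "list_decode n = dec n" for n by (simp add: dec_list_def map_idI)
  then show "computable_on A f \<Longrightarrow> computable_on A (\<lambda>x. list_decode (f x))" by (simp only: computable_dec)
qed

lemma computable_big_word_accepted: "decidable_on UNIV (\<lambda>x. big_word_accepted (fst x) (snd x))"
  unfolding big_word_accepted_def nreach_def dec_nfa_def dec_nedge_def Let_def nfa.sel
  by (intro computable_intros)

lemma big_word_accepted_iff:
  "big_word_accepted as y \<longleftrightarrow> block_word (replicate (length as) (Suc (length (n_edges (dec_nfa y))))) \<in> nlang (dec_nfa y)"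
proof -
  have eq: "map f (replicate (length as) k) = map (\<lambda>_. f k) as" for f :: "nat \<Rightarrow> nat list" and k
    by (simp add: map_replicate_const)
  show ?thesis
    unfolding big_word_accepted_def block_word_def eq nlang_def mem_Collect_eq Bex_def nreach_iff by blast
qed

text \<open>A single membership test decides the SUP. If the automaton accepts the word of threshold
  exponents, pumping all blocks gives arbitrarily large vectors below the language; conversely,
  unbounded vectors dominate the threshold word.\<close>

lemma (in trio) dclo_imp_SUP:
  assumes "dclo_computable D rep {0, 1} r01"
  shows "SUP_decidable D rep"
proof (rule SUP_decidableI)
  let ?A = "{(c, as). c \<in> D \<and> rep c \<subseteq> blang as}"
  obtain p where p: "\<And>c. c \<in> D \<Longrightarrow> rep c \<subseteq> lists {0, 1} \<Longrightarrow>
      \<exists>y. eval p [c] y \<and> nlang (dec_nfa y) = dclo r01 (rep c)"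
    using assms unfolding dclo_computable_def by blast
  \<comment> \<open>The procedure only promises some output with the right language, so one such
    output is fixed for each code.\<close>
  define F where "F c = (SOME y. eval p [c] y \<and> nlang (dec_nfa y) = dclo r01 (rep c))" for c
  let ?B = "{c \<in> D. rep c \<subseteq> lists {0, 1}}"
  have F: "eval p [c] (F c)" "nlang (dec_nfa (F c)) = dclo r01 (rep c)" if "c \<in> ?B" for c
    using someI_ex[OF p[of c]] that unfolding F_def by auto
  have "computable_on ?B F" by (rule cmpI[of _ p]) (simp add: F)
  let ?c = "\<lambda>x. exponent_code (fst x) (snd x) 1"
  have c: "?c x \<in> ?B" if "x \<in> ?A" for x
    using that rep_expo_over exponent_code_in unfolding mem_Collect_eq case_prod_beta by blast
  have "computable_on ?A (\<lambda>x. F (?c x))"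
    by (rule computable_comp[OF \<open>computable_on ?B F\<close> _ c]) (intro computable_exponent_code computable_intros, auto)
  then have "computable_on ?A (\<lambda>x. (snd x, F (?c x)))" by (intro computable_intros)
  then have acc: "decidable_on ?A (\<lambda>x. big_word_accepted (snd x) (F (?c x)))"
    using computable_comp_UNIV[OF computable_big_word_accepted] by fastforce
  have "big_word_accepted (snd x) (F (?c x)) \<longleftrightarrow> blang (snd x) \<subseteq> dclo subseq (rep (fst x))"
    if x: "x \<in> ?A" for x
  proof -
    let ?E = "exponents (snd x) (rep (fst x))" and ?n = "length (snd x)"
    let ?N = "dec_nfa (F (?c x))"
    let ?w = "block_word (replicate ?n (Suc (length (n_edges ?N))))"
    have rep: "rep (?c x) = block_word ` ?E"
      using rep_exponent_code[of "fst x" "snd x" 1] x by auto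
    have lang: "w \<in> nlang ?N \<longleftrightarrow> w \<in> lists {0, 1} \<and> (\<exists>ks\<in>?E. subseq w (block_word ks))" for w
      unfolding F(2)[OF c[OF x]] dclo_def rep r01_def using block_word_over by blast
    have len: "length ks = ?n" if "ks \<in> ?E" for ks using that by (simp add: exponents_def)
    have "?w \<in> nlang ?N \<longleftrightarrow> (\<forall>m. \<exists>ks\<in>?E. \<forall>k\<in>set ks. m \<le> k)"
    proof
      assume "?w \<in> nlang ?N"
      then obtain p q where pq: "p \<in> set (n_init ?N)" "q \<in> set (n_fin ?N)" "nrun ?N p ?w q"
        unfolding nlang_def by blast
      show "\<forall>m. \<exists>ks\<in>?E. \<forall>k\<in>set ks. m \<le> k"
      proof
        fix m
        obtain ms where ms: "length ms = ?n" "\<forall>k\<in>set ms. m \<le> k" "nrun ?N p (block_word ms) q"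
          using nrun_block_word_pump[OF _ pq(3)] by blast
        then have "block_word ms \<in> nlang ?N" using pq unfolding nlang_def by blast
        then obtain ks where ks: "ks \<in> ?E" "subseq (block_word ms) (block_word ks)" using lang by blast
        then have "list_all2 (\<le>) ms ks" using subseq_block_word_iff len ms(1) by simp
        then have "\<forall>k\<in>set ks. m \<le> k"
          using ms(2) by (metis in_set_conv_nth le_trans list_all2_conv_all_nth nth_mem)
        then show "\<exists>ks\<in>?E. \<forall>k\<in>set ks. m \<le> k" using ks by blast
      qed
    next
      assume "\<forall>m. \<exists>ks\<in>?E. \<forall>k\<in>set ks. m \<le> k"
      then obtain ks where ks: "ks \<in> ?E" "\<forall>k\<in>set ks. Suc (length (n_edges ?N)) \<le> k" by blast
      then have "subseq ?w (block_word ks)"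
        using len by (subst subseq_block_word_iff) (auto simp: list_all2_conv_all_nth)
      then show "?w \<in> nlang ?N" unfolding lang using ks(1) block_word_over by blast
    qed
    then show ?thesis unfolding big_word_accepted_iff SUP_iff_unbounded .
  qed
  then show "decidable_on ?A (\<lambda>x. blang (snd x) \<subseteq> dclo subseq (rep (fst x)))"
    using computable_cong[THEN iffD1, OF _ acc] by simp
qed

section \<open>Separation by the parity of bounded exponents\<close>

lemma ptl_UN: "finite I \<Longrightarrow> (\<And>i. i \<in> I \<Longrightarrow> ptl \<Sigma> r (F i)) \<Longrightarrow> ptl \<Sigma> r (\<Union>i\<in>I. F i)"
  by (induction I rule: finite_induct) (auto intro: ptl_empty ptl_union)

definition constant_above :: "nat \<Rightarrow> nat list set \<Rightarrow> bool" where
  "constant_above N R \<longleftrightarrow> (\<forall>ks ms. length ks = length ms \<longrightarrow> (\<forall>k\<in>set ks. N \<le> k) \<longrightarrow>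
     (\<forall>k\<in>set ms. N \<le> k) \<longrightarrow> (block_word ks \<in> R \<longleftrightarrow> block_word ms \<in> R))"

lemma constant_aboveI: "(\<And>ks ms. length ks = length ms \<Longrightarrow> \<forall>k\<in>set ks. N \<le> k \<Longrightarrow>
    \<forall>k\<in>set ms. N \<le> k \<Longrightarrow> block_word ks \<in> R \<longleftrightarrow> block_word ms \<in> R) \<Longrightarrow> constant_above N R"
  unfolding constant_above_def by iprover

lemma constant_aboveD: "constant_above N R \<Longrightarrow> length ks = length ms \<Longrightarrow> \<forall>k\<in>set ks. N \<le> k \<Longrightarrow>
    \<forall>k\<in>set ms. N \<le> k \<Longrightarrow> block_word ks \<in> R \<longleftrightarrow> block_word ms \<in> R"
  unfolding constant_above_def by iprover

text \<open>By \<open>subseq_block_word_large\<close> a generator \<open>w\<close> cannot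
  distinguish vectors of equal length whose entries are at least \<open>length w\<close>.
  Complements keep the threshold; unions and intersections take the maximum.\<close>

lemma ptl_constant_above: "ptl {0, 1} r01 R \<Longrightarrow> \<exists>N. constant_above N R"
proof (induction rule: ptl.induct)
  case (ptl_up w)
  have "block_word ks \<in> uclo r01 {w} \<longleftrightarrow> subseq w (block_word ks)" for ks
    using ptl_up block_word_over[of ks] by (simp add: uclo_def r01_def del: in_lists_conv_set)
  then have "constant_above (length w) (uclo r01 {w})"
    using subseq_block_word_large by (intro constant_aboveI) metis
  then show ?case by blast
next
  case (ptl_compl R)
  then obtain N where N: "constant_above N R" by blast
  have "constant_above N (lists {0, 1} - R)"
  proof (rule constant_aboveI)
    fix ks ms :: "nat list"
    assume "length ks = length ms" "\<forall>k\<in>set ks. N \<le> k" "\<forall>k\<in>set ms. N \<le> k"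
    from constant_aboveD[OF N this] show "block_word ks \<in> lists {0, 1} - R \<longleftrightarrow> block_word ms \<in> lists {0, 1} - R"
      using block_word_over by blast
  qed
  then show ?case by blast
next
  case (ptl_inter R1 R2)
  then obtain N1 N2 where N: "constant_above N1 R1" "constant_above N2 R2" by blast
  have "constant_above (max N1 N2) (R1 \<inter> R2)"
  proof (rule constant_aboveI)
    fix ks ms :: "nat list"
    assume "length ks = length ms" "\<forall>k\<in>set ks. max N1 N2 \<le> k" "\<forall>k\<in>set ms. max N1 N2 \<le> k"
    then show "block_word ks \<in> R1 \<inter> R2 \<longleftrightarrow> block_word ms \<in> R1 \<inter> R2"
      using constant_aboveD[OF N(1), of ks ms] constant_aboveD[OF N(2), of ks ms] by auto
  qed
  then show ?case by blast
next
  case (ptl_union R1 R2)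
  then obtain N1 N2 where N: "constant_above N1 R1" "constant_above N2 R2" by blast
  have "constant_above (max N1 N2) (R1 \<union> R2)"
  proof (rule constant_aboveI)
    fix ks ms :: "nat list"
    assume "length ks = length ms" "\<forall>k\<in>set ks. max N1 N2 \<le> k" "\<forall>k\<in>set ms. max N1 N2 \<le> k"
    then show "block_word ks \<in> R1 \<union> R2 \<longleftrightarrow> block_word ms \<in> R1 \<union> R2"
      using constant_aboveD[OF N(1), of ks ms] constant_aboveD[OF N(2), of ks ms] by auto
  qed
  then show ?case by blast
qed

text \<open>An exponent that stays below a bound is detected by a piecewise testable language, which sees its
  parity; large exponents of different parity cannot be told apart.\<close>

lemma separable_iff_bounded:
  assumes len: "\<And>ks. ks \<in> E \<Longrightarrow> length ks = n"
  defines "K1 \<equiv> {block_word (map (\<lambda>k. 2 * k) ks) |ks. ks \<in> E}"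
    and "K2 \<equiv> {block_word (map (\<lambda>k. 2 * k + 1) ks) |ks. length ks = n}"
  shows "(\<exists>R. ptl {0, 1} r01 R \<and> K1 \<subseteq> R \<and> K2 \<inter> R = {}) \<longleftrightarrow> \<not> (\<forall>N. \<exists>ks\<in>E. \<forall>k\<in>set ks. N \<le> k)"
proof
  assume "\<exists>R. ptl {0, 1} r01 R \<and> K1 \<subseteq> R \<and> K2 \<inter> R = {}"
  then obtain R where R: "ptl {0, 1} r01 R" "K1 \<subseteq> R" "K2 \<inter> R = {}" by blast
  from ptl_constant_above[OF R(1)] obtain N where N: "constant_above N R" by blast
  show "\<not> (\<forall>N. \<exists>ks\<in>E. \<forall>k\<in>set ks. N \<le> k)"
  proof
    assume "\<forall>N. \<exists>ks\<in>E. \<forall>k\<in>set ks. N \<le> k"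
    then obtain ks where ks: "ks \<in> E" "\<forall>k\<in>set ks. N \<le> k" by blast
    have "block_word (map (\<lambda>k. 2 * k) ks) \<in> R" using R(2) ks(1) unfolding K1_def by blast
    moreover have "block_word (map (\<lambda>k. 2 * k + 1) ks) \<in> K2" using len[OF ks(1)] unfolding K2_def by blast
    moreover have "block_word (map (\<lambda>k. 2 * k) ks) \<in> R \<longleftrightarrow> block_word (map (\<lambda>k. 2 * k + 1) ks) \<in> R"
      by (rule constant_aboveD[OF N]) (use ks(2) in fastforce)+
    ultimately show False using R(3) by blast
  qed
next
  assume "\<not> (\<forall>N. \<exists>ks\<in>E. \<forall>k\<in>set ks. N \<le> k)"
  then obtain N where N: "\<And>ks. ks \<in> E \<Longrightarrow> \<exists>k\<in>set ks. k < N" by (metis not_le)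
  \<comment> \<open>Only position \<open>i\<close> is constrained: on words with \<open>n\<close>
    blocks this expresses that the exponent there is at least \<open>v\<close>.\<close>
  define U where "U i v = uclo r01 {block_word ((replicate n 0)[i := v])}" for i v
  have U: "block_word ms \<in> U i v \<longleftrightarrow> v \<le> ms ! i" if "length ms = n" "i < n" for ms i v
  proof -
    have "block_word ms \<in> U i v \<longleftrightarrow> list_all2 (\<le>) ((replicate n 0)[i := v]) ms"
      unfolding U_def uclo_def r01_def using block_word_over that by (simp add: subseq_block_word_iff)
    also have "\<dots> \<longleftrightarrow> v \<le> ms ! i"
      unfolding list_all2_conv_all_nth using that by (auto simp: nth_list_update)
    finally show ?thesis .
  qed
  \<comment> \<open>Some exponent equals an even number \<open>2 * j\<close> with
    \<open>j < N\<close>: it is at least \<open>2 * j\<close> and not at least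
    \<open>2 * j + 1\<close>. Every vector in \<open>E\<close> has an entry below \<open>N\<close>,
    so its doubled word qualifies, while odd words never do.\<close>
  define R where "R = (\<Union>ij\<in>{..<n} \<times> {..<N}. U (fst ij) (2 * snd ij) \<inter> (lists {0, 1} - U (fst ij) (2 * snd ij + 1)))"
  have "ptl {0, 1} r01 R"
    unfolding R_def U_def using block_word_over by (intro ptl_UN ptl_inter ptl_compl ptl_up) auto
  moreover have R: "block_word ms \<in> R \<longleftrightarrow> (\<exists>i<n. \<exists>j<N. 2 * j \<le> ms ! i \<and> ms ! i < 2 * j + 1)" if "length ms = n" for ms
    unfolding R_def using U[OF that] block_word_over by (auto simp: not_le simp del: in_lists_conv_set) 
  have "K1 \<subseteq> R"
  proof
    fix w assume "w \<in> K1"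
    then obtain ks where ks: "ks \<in> E" "w = block_word (map (\<lambda>k. 2 * k) ks)" unfolding K1_def by blast
    obtain i where i: "i < n" "ks ! i < N" using N[OF ks(1)] len[OF ks(1)] by (metis in_set_conv_nth)
    have "2 * (ks ! i) \<le> map (\<lambda>k. 2 * k) ks ! i \<and> map (\<lambda>k. 2 * k) ks ! i < 2 * (ks ! i) + 1"
      using i len[OF ks(1)] by simp
    then show "w \<in> R" unfolding ks(2) using len[OF ks(1)] R i by (metis length_map)
  qed
  moreover have "w \<notin> R" if "w \<in> K2" for w
  proof -
    obtain ks where ks: "length ks = n" "w = block_word (map (\<lambda>k. 2 * k + 1) ks)" using \<open>w \<in> K2\<close> unfolding K2_def by blast
    have "\<not> (2 * j \<le> 2 * k + 1 \<and> 2 * k + 1 < 2 * j + 1)" for j k :: nat by presburger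
    then show ?thesis unfolding ks(2) using ks(1) by (subst R) (auto simp del: not_less)
  qed
  ultimately show "\<exists>R. ptl {0, 1} r01 R \<and> K1 \<subseteq> R \<and> K2 \<inter> R = {}" by blast
qed

lemma (in trio) sep_imp_SUP:
  assumes "sep_decidable D rep {0, 1} r01"
  shows "SUP_decidable D rep"
proof (rule SUP_decidableI)
  let ?A = "{(c, as). c \<in> D \<and> rep c \<subseteq> blang as}"
  define Sep where "Sep x \<longleftrightarrow> (\<exists>R. ptl {0, 1} r01 R \<and> rep (fst x) \<subseteq> R \<and> rep (snd x) \<inter> R = {})" for x
  let ?B = "{x. fst x \<in> D \<and> snd x \<in> D \<and> rep (fst x) \<subseteq> lists {0, 1} \<and> rep (snd x) \<subseteq> lists {0, 1}}"
  obtain p where p: "\<And>c1 c2. c1 \<in> D \<Longrightarrow> c2 \<in> D \<Longrightarrow> rep c1 \<subseteq> lists {0, 1} \<Longrightarrow> rep c2 \<subseteq> lists {0, 1} \<Longrightarrow>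
      eval p [prod_encode (c1, c2)] (if Sep (c1, c2) then 1 else 0)"
    using assms unfolding sep_decidable_def Sep_def fst_conv snd_conv by blast
  have computable_Sep: "decidable_on ?B Sep"
  proof (rule cmpI)
    fix x assume "x \<in> ?B"
    then show "eval p [enc x] (enc (of_bool (Sep x) :: nat))"
      using p[of "fst x" "snd x"] by (cases x) (simp add: of_bool_def del: in_lists_conv_set)
  qed
  let ?k = "\<lambda>x. (exponent_code (fst x) (snd x) 2, odd_code (fst x) (snd x))"
  have k: "?k x \<in> ?B" if "x \<in> ?A" for x
  proof -
    have "fst x \<in> D" "rep (fst x) \<subseteq> blang (snd x)" using that by auto
    then show ?thesis unfolding mem_Collect_eq fst_conv snd_conv
      by (intro conjI exponent_code_in odd_code_in rep_expo_over rep_regu_over)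
  qed
  have "computable_on ?A ?k" by (intro computable_intros computable_exponent_code computable_odd_code) auto
  from decidable_not[OF computable_comp[OF computable_Sep this k]] have dec: "decidable_on ?A (\<lambda>x. \<not> Sep (?k x))" .
  have iff: "\<not> Sep (?k x) \<longleftrightarrow> blang (snd x) \<subseteq> dclo subseq (rep (fst x))" if x: "x \<in> ?A" for x
  proof -
    have c: "fst x \<in> D" "rep (fst x) \<subseteq> blang (snd x)" using x by auto
    show ?thesis
    proof (cases "rep (fst x) = {}")
      case True
      \<comment> \<open>For empty \<open>rep (fst x)\<close> the seed of \<open>odd_code\<close> is
        missing and both languages are empty. They are then separable, and the SUP fails as well,
        since \<open>blang\<close> is never empty.\<close>
      have "ptl {0, 1} r01 {}" by (rule ptl_empty)
      then have "Sep (?k x)" using True rep_exponent_code[OF c] rep_odd_code[OF c]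
        unfolding Sep_def by (intro exI[of _ "{}"]) (simp add: exponents_def)
      moreover have "\<not> blang (snd x) \<subseteq> dclo subseq (rep (fst x))"
        unfolding SUP_iff_unbounded using True by (simp add: exponents_def)
      ultimately show ?thesis by blast
    next
      case False
      have len: "\<And>ks. ks \<in> exponents (snd x) (rep (fst x)) \<Longrightarrow> length ks = length (snd x)"
        by (simp add: exponents_def)
      show ?thesis
        using separable_iff_bounded[OF len]
        unfolding Sep_def fst_conv snd_conv rep_exponent_code[OF c] rep_odd_code[OF c] if_not_P[OF False] SUP_iff_unbounded
        by simp
    qed
  qed
  show "decidable_on ?A (\<lambda>x. blang (snd x) \<subseteq> dclo subseq (rep (fst x)))"
    by (rule computable_cong[THEN iffD1, OF _ dec]) (simp only: iff)
qed

theorem mainTheorem1: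
  fixes D :: "nat set" and rep :: "nat \<Rightarrow> nat list set"
  assumes "full_trio D rep"
  shows "(SUP_decidable D rep \<longleftrightarrow> (\<forall>\<Sigma> r. pwqo \<Sigma> r \<longrightarrow> dclo_computable D rep \<Sigma> r))
       \<and> ((\<forall>\<Sigma> r. pwqo \<Sigma> r \<longrightarrow> dclo_computable D rep \<Sigma> r)
            \<longleftrightarrow> (\<forall>\<Sigma> r. pwqo \<Sigma> r \<longrightarrow> sep_decidable D rep \<Sigma> r))"
proof -
  interpret trio D rep by standard fact
  have SUP: "(\<forall>\<Sigma> r. pwqo \<Sigma> r \<longrightarrow> dclo_computable D rep \<Sigma> r) \<and> (\<forall>\<Sigma> r. pwqo \<Sigma> r \<longrightarrow> sep_decidable D rep \<Sigma> r)"
    if "SUP_decidable D rep"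
  proof -
    interpret sup_trio D rep by standard fact
    show ?thesis using SUP_imp_dclo SUP_imp_sep by blast
  qed
  \<comment> \<open>The instance \<open>r01\<close> alone suffices, whatever the number of letters
    in the SUP input.\<close>
  moreover have "SUP_decidable D rep" if "\<forall>\<Sigma> r. pwqo \<Sigma> r \<longrightarrow> dclo_computable D rep \<Sigma> r"
    using that pwqo_r01 dclo_imp_SUP by blast
  moreover have "SUP_decidable D rep" if "\<forall>\<Sigma> r. pwqo \<Sigma> r \<longrightarrow> sep_decidable D rep \<Sigma> r"
    using that pwqo_r01 sep_imp_SUP by blast
  ultimately show ?thesis by blast
qed

end
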